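(* Assume $\lim_{n\to\infty}N/n=c\in(0,\infty)$ and $\lim_{n\to\infty}\beta_n=0$. Then for every $z\in\mathbb C^+$, $$\lim_{n\to\infty}\big|\mathbb E\big(S_{\mathbf B_n}(z)\big)-\mathbb E\big(S_{\mathbf G_n}(z)\big)\big|=0 .$$
   Context: Let $(\varepsilon_i)_{i\in\mathbb Z}$ be a strictly stationary sequence of real random variables. For two $\sigma$-algebras $\mathcal A,\mathcal B$, define $$\beta(\mathcal A,\mathcal B)=\tfrac12\sup\sum_{i,j}\big|\mathbb P(A_i\cap B_j)-\mathbb P(A_i)\mathbb P(B_j)\big|,$$ where the supremum is over finite partitions $(A_i)$ into $\mathcal A$-measurable sets and $(B_j)$ into $\mathcal B$-measurable sets. The $\beta$-mixing coefficients are $\beta_0=1$ and $$\beta_n=\sup_{k\in\mathbb Z}\beta\big(\sigma(\varepsilon_\ell,\ \ell\le k),\ \sigma(\varepsilon_{\ell+n},\ \ell\ge k)\big)\quad (n\ge1).$$ Let $g:\mathbb R^{\mathbb Z}\to\mathbb R$ be measurable, and set $X_k=g(\ldots,\varepsilon_{k-1},\varepsilon_k,\varepsilon_{k+1},\ldots)$ with $\mathbb E X_k=0$ and $\mathbb E X_k^2<\infty$. Let $N=N(n)$ be positive integers. Let $\mathcal X_n$ be the $N\times n$ matrix with $(i,j)$ entry $X_{(j-1)N+i}$, and let $\mathbf B_n=\frac1n\mathcal X_n\mathcal X_n^T$. Let $(Z_k)_{k\in\mathbb Z}$ be a centered Gaussian process with $\operatorname{Cov}(Z_k,Z_\ell)=\operatorname{Cov}(X_k,X_\ell)$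 for all $k,\ell$. For $i=1,\dots,n$, let $(Z^{(i)}_k)_k$ be independent copies of $(Z_k)_k$, also independent of $(X_k)_k$. Set $\mathbf Z_i=(Z^{(i)}_1,\dots,Z^{(i)}_N)^T$ and $\mathbf G_n=\frac1n\sum_{i=1}^n\mathbf Z_i\mathbf Z_i^T$. For an $N\times N$ symmetric matrix $A$ and $z\in\mathbb C^+$, $S_A(z)=\frac1N\operatorname{Tr}(A-zI)^{-1}$. *)

theory Defs
  imports "HOL-Probability.Probability" "Jordan_Normal_Form.Gauss_Jordan_Elimination"
begin

definition finite_partition :: "'a set \<Rightarrow> 'a set set \<Rightarrow> nat set \<Rightarrow> (nat \<Rightarrow> 'a set) \<Rightarrow> bool" where
  "finite_partition \<Omega> F I P \<longleftrightarrow> finite I \<and> (\<forall>i\<in>I. P i \<in> F) \<and> disjoint_family_on P I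
     \<and> (\<Union>i\<in>I. P i) = \<Omega>"

definition beta_coef :: "'a measure \<Rightarrow> 'a set set \<Rightarrow> 'a set set \<Rightarrow> real" where
  "beta_coef M A B = 1/2 * Sup {(\<Sum>i\<in>I. \<Sum>j\<in>J. \<bar>measure M (P i \<inter> Q j) - measure M (P i) * measure M (Q j)\<bar>)
      | I J P Q. finite_partition (space M) A I P \<and> finite_partition (space M) B J Q}"

definition gen_sigma :: "'a measure \<Rightarrow> (int \<Rightarrow> 'a \<Rightarrow> real) \<Rightarrow> int set \<Rightarrow> 'a set set" where
  "gen_sigma M eps L = sigma_sets (space M) (\<Union>l\<in>L. {eps l -` B \<inter> space M | B. B \<in> sets borel})"

definition beta_mixing :: "'a measure \<Rightarrow> (int \<Rightarrow> 'a \<Rightarrow> real) \<Rightarrow> nat \<Rightarrow> real" where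
  "beta_mixing M eps n = (if n = 0 then 1 else
     (SUP k::int. beta_coef M (gen_sigma M eps {..k}) (gen_sigma M eps {l + int n | l. l \<ge> k})))"

definition strictly_stationary :: "'a measure \<Rightarrow> (int \<Rightarrow> 'a \<Rightarrow> real) \<Rightarrow> bool" where
  "strictly_stationary M eps \<longleftrightarrow> (\<forall>h::int.
     distr M (PiM UNIV (\<lambda>_::int. borel)) (\<lambda>\<omega> i. eps (i + h) \<omega>)
       = distr M (PiM UNIV (\<lambda>_::int. borel)) (\<lambda>\<omega> i. eps i \<omega>))"

definition covariance :: "'a measure \<Rightarrow> ('a \<Rightarrow> real) \<Rightarrow> ('a \<Rightarrow> real) \<Rightarrow> real" where
  "covariance M U V = (\<integral>\<omega>. (U \<omega> - (\<integral>x. U x \<partial>M)) * (V \<omega> - (\<integral>x. V x \<partial>M)) \<partial>M)"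

definition gaussian_rv :: "'a measure \<Rightarrow> ('a \<Rightarrow> real) \<Rightarrow> real \<Rightarrow> real \<Rightarrow> bool" where
  "gaussian_rv M Y m v \<longleftrightarrow> Y \<in> borel_measurable M \<and>
     ((v = 0 \<and> (AE \<omega> in M. Y \<omega> = m)) \<or> (v > 0 \<and> distributed M lborel Y (normal_density m (sqrt v))))"

definition centered_gaussian_process :: "'a measure \<Rightarrow> (int \<Rightarrow> 'a \<Rightarrow> real) \<Rightarrow> bool" where
  "centered_gaussian_process M Z \<longleftrightarrow>
     (\<forall>I c. finite I \<longrightarrow> (\<exists>m v. gaussian_rv M (\<lambda>\<omega>. \<Sum>k\<in>I. c k * Z k \<omega>) m v))
     \<and> (\<forall>k. integrable M (Z k) \<and> (\<integral>\<omega>. Z k \<omega> \<partial>M) = 0)"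

definition stieltjes :: "complex mat \<Rightarrow> complex \<Rightarrow> complex" where
  "stieltjes A z = (let N = dim_row A; R = the (mat_inverse (A - z \<cdot>\<^sub>m 1\<^sub>m N))
     in (1 / of_nat N) * (\<Sum>i<N. R $$ (i, i)))"

(* B_n = (1/n) X_n X_n^T, with (X_n)_{ij} = X_{(j-1)N+i}  (1-based), here 0-based indices a,b *)
definition B_mat :: "(int \<Rightarrow> 'a \<Rightarrow> real) \<Rightarrow> nat \<Rightarrow> nat \<Rightarrow> 'a \<Rightarrow> complex mat" where
  "B_mat X N n \<omega> = mat N N (\<lambda>(a, b). complex_of_real
     ((1 / real n) * (\<Sum>j<n. X (int (j * N + a + 1)) \<omega> * X (int (j * N + b + 1)) \<omega>)))"

(* G_n = (1/n) sum_{i=1}^n Z_i Z_i^T, with Z_i = (Z^{(i)}_1, ..., Z^{(i)}_N); copies indexed 0..n-1 *)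
definition G_mat :: "(nat \<Rightarrow> int \<Rightarrow> 'a \<Rightarrow> real) \<Rightarrow> nat \<Rightarrow> nat \<Rightarrow> 'a \<Rightarrow> complex mat" where
  "G_mat Zc N n \<omega> = mat N N (\<lambda>(a, b). complex_of_real
     ((1 / real n) * (\<Sum>i<n. Zc i (int (a + 1)) \<omega> * Zc i (int (b + 1)) \<omega>)))"

end

theory Submission
  imports Defs "Jordan_Normal_Form.Determinant"
begin

text \<open>
  Lindeberg's method, exchanging one column at a time. If a column \<open>p\<close> is added to a Gram matrix with
  resolvent \<open>R\<close>, the trace of the resolvent changes by \<open>-a / (1 + b)\<close> with \<open>b = p\<^sup>T R p / n\<close> and
  \<open>a = p\<^sup>T R\<^sup>2 p / n\<close>, a Lipschitz function of the two quadratic forms. Replacing the \<open>j\<close>-th column of the data by a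
  Gaussian one therefore costs \<open>o(1/N)\<close> as soon as both columns have quadratic forms concentrated, to precision
  \<open>o(N)\<close>, around the same mean.

  The process is first approximated in \<open>L\<^sup>2\<close> by a bounded function of finitely many \<open>\<epsilon>\<^sub>i\<close>. Absolute regularity then
  serves twice, always with a fixed gap. It makes the \<open>j\<close>-th column independent of the resolvent built from the earlier
  columns. And, cutting a column into a fixed large number of blocks, it gives the concentration of quadratic forms:
  diagonal blocks are averaged, and off-diagonal ones are small because the covariances tend to \<open>0\<close>, so that the
  covariance matrix has Hilbert-Schmidt norm \<open>o(N)\<close>. The same norm bounds the variance of Gaussian quadratic forms, by
  Isserlis' formula. No rate of mixing is needed, because the number of exchanged columns is of the order of the
  dimension.
\<close>

subsection \<open>Total variation and the mixing coefficient\<close>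

text \<open>The obstacle is that every function to be decoupled, built from a resolvent or a
  quadratic form, depends on a number of variables that grows with \<open>N\<close>. Absolute
  regularity controls a total variation distance, so replacing a joint law by a product costs
  \<open>C * b q\<close> for every function bounded by \<open>C\<close>, whatever the number of its
  arguments. Time dictates the order of exchange: in the hybrid matrices the window columns come
  first and the Gaussian ones last. With the Gaussian columns frozen, the resolvent without column
  \<open>j\<close> depends on the past of column \<open>j\<close> only. Concentration must hold
  uniformly over all matrices with a given operator norm, because the resolvent is random. Only
  second moments of \<open>X\<close> are available; errors that involve \<open>X\<close> itself are
  therefore split by Young's inequality into terms linear in sums of squares, weighted by the size
  of the L2 error. The parameters are chosen so that each depends on earlier ones only: the L2
  error, which fixes the window and the bound of the approximant, then the gap and the number of
  blocks, and the dimension last.\<close>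

lemma mult_divide_self: "x \<noteq> 0 \<Longrightarrow> x * (a / x) = (a :: real)"
  by simp

text \<open>Induction over \<open>sigma_sets\<close>: a countable union is first truncated by
  continuity from below, then its finitely many members are approximated one by one. Two measures
  are treated at once because \<open>beta_set_bound\<close> needs a single set that is close to
  \<open>E\<close> under both the joint law and the product law.\<close>

lemma algebra_approx:
  assumes alg: "Sigma_Algebra.algebra \<Omega> \<A>" and fin: "finite_measure M1" "finite_measure M2"
    and sets: "sets M1 = sigma_sets \<Omega> \<A>" "sets M2 = sigma_sets \<Omega> \<A>"
    and E: "E \<in> sigma_sets \<Omega> \<A>" and e: "e > 0"
  shows "\<exists>A\<in>\<A>. measure M1 (sym_diff E A) < e \<and> measure M2 (sym_diff E A) < e"
  using E e
proof (induction arbitrary: e rule: sigma_sets.induct)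
  case (Basic a)
  then show ?case by (intro bexI[of _ a]) auto
next
  case Empty
  then show ?case using alg by (intro bexI[of _ "{}"]) (auto simp: algebra_iff_Un)
next
  case (Compl a)
  then obtain A where A: "A \<in> \<A>" "measure M1 (sym_diff a A) < e" "measure M2 (sym_diff a A) < e"
    by blast
  have "a \<subseteq> \<Omega>" using Compl sigma_sets_into_sp alg by (metis algebra_iff_Un)
  moreover have "A \<subseteq> \<Omega>" using A alg by (auto simp: algebra_iff_Un)
  ultimately have "sym_diff (\<Omega> - a) (\<Omega> - A) = sym_diff a A" by auto
  moreover have "\<Omega> - A \<in> \<A>" using alg A by (auto simp: algebra_iff_Un)
  ultimately show ?case using A by (metis (no_types))
next
  case (Union a)
  interpret M1: finite_measure M1 by fact
  interpret M2: finite_measure M2 by fact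
  let ?U = "\<Union>i. a i" let ?V = "\<lambda>n. \<Union>i<n. a i"
  have meas: "a i \<in> sets M1" "a i \<in> sets M2" for i using Union sets by auto
  have lim: "(\<lambda>n. measure M (?V n)) \<longlonglongrightarrow> measure M ?U"
    if "finite_measure M" "\<And>i. a i \<in> sets M" for M
  proof -
    interpret finite_measure M by fact
    have "(\<lambda>n. measure M (?V n)) \<longlonglongrightarrow> measure M (\<Union>n. ?V n)"
      by (rule finite_Lim_measure_incseq) (use that in \<open>auto simp: incseq_def\<close>, force)
    moreover have "(\<Union>n. ?V n) = ?U" by auto
    ultimately show ?thesis by simp
  qed
  have "eventually (\<lambda>n. dist (measure M1 (?V n)) (measure M1 ?U) < e/2 \<and>
      dist (measure M2 (?V n)) (measure M2 ?U) < e/2) sequentially"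
    using tendstoD[OF lim[OF fin(1) meas(1)], of "e/2"] tendstoD[OF lim[OF fin(2) meas(2)], of "e/2"]
      Union by (intro eventually_conj) auto
  then obtain n where n: "dist (measure M1 (?V n)) (measure M1 ?U) < e/2"
      "dist (measure M2 (?V n)) (measure M2 ?U) < e/2"
    by (auto simp: eventually_sequentially)
  \<comment> \<open>Half of \<open>e\<close> pays for the truncation, the other half is shared by
    the \<open>n\<close> pieces; \<open>+ 1\<close> covers \<open>n = 0\<close>.\<close>
  define d where "d = e / (2 * (real n + 1))"
  have "d > 0" using Union by (simp add: d_def)
  then have "\<forall>i. \<exists>A\<in>\<A>. measure M1 (sym_diff (a i) A) < d \<and> measure M2 (sym_diff (a i) A) < d"
    using Union by blast
  then obtain A where A: "\<And>i. A i \<in> \<A>" "\<And>i. measure M1 (sym_diff (a i) (A i)) < d"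
      "\<And>i. measure M2 (sym_diff (a i) (A i)) < d" by metis
  have AA: "(\<Union>i<n. A i) \<in> \<A>"
    using Sigma_Algebra.algebra.axioms(1)[OF alg] A by (intro ring_of_sets.finite_UN) auto
  have main: "measure M (sym_diff ?U (\<Union>i<n. A i)) < e"
    if M: "finite_measure M" and sM: "sets M = sigma_sets \<Omega> \<A>"
      and mA: "\<And>i. measure M (sym_diff (a i) (A i)) < d"
      and nM: "dist (measure M (?V n)) (measure M ?U) < e/2" for M
  proof -
    interpret finite_measure M by fact
    have [measurable]: "a i \<in> sets M" "A i \<in> sets M" for i
      using sM Union A by auto
    have "measure M (sym_diff ?U (\<Union>i<n. A i)) \<le> measure M ((?U - ?V n) \<union> (\<Union>i<n. sym_diff (a i) (A i)))"
      by (rule finite_measure_mono) (blast, measurable)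
    also have "\<dots> \<le> measure M (?U - ?V n) + measure M (\<Union>i<n. sym_diff (a i) (A i))"
      by (rule measure_Un_le) auto
    also have "measure M (?U - ?V n) = measure M ?U - measure M (?V n)"
      by (rule finite_measure_Diff) auto
    also have "measure M (\<Union>i<n. sym_diff (a i) (A i)) \<le> (\<Sum>i<n. measure M (sym_diff (a i) (A i)))"
      by (rule finite_measure_subadditive_finite) auto
    also have "\<dots> \<le> (\<Sum>i<n. d)" by (rule sum_mono) (use mA less_imp_le in blast)
    also have "\<dots> < e/2" using Union by (simp add: d_def divide_simps)
    finally show ?thesis using nM unfolding dist_real_def by linarith
  qed
  show ?case using AA main[OF fin(1) sets(1) A(2) n(1)] main[OF fin(2) sets(2) A(3) n(2)] by blast
qed

text \<open>The finite unions of measurable rectangles, encoded as preimages under a pair of finite-valued maps: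
  common refinements of partitions become pairing of the maps.\<close>

definition rect_alg :: "'b measure \<Rightarrow> 'c measure \<Rightarrow> ('b \<times> 'c) set set" where
  "rect_alg S T = {{x \<in> space (S \<Otimes>\<^sub>M T). (\<phi> (fst x), \<psi> (snd x)) \<in> D} | \<phi> \<psi> (D :: (nat \<times> nat) set).
     \<phi> \<in> measurable S (count_space UNIV) \<and> finite (\<phi> ` space S) \<and>
     \<psi> \<in> measurable T (count_space UNIV) \<and> finite (\<psi> ` space T)}"

lemma rect_algI:
  fixes D :: "(nat \<times> nat) set"
  assumes "E = {x \<in> space (S \<Otimes>\<^sub>M T). (\<phi> (fst x), \<psi> (snd x)) \<in> D}"
    "\<phi> \<in> measurable S (count_space UNIV)" "finite (\<phi> ` space S)"
    "\<psi> \<in> measurable T (count_space UNIV)" "finite (\<psi> ` space T)"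
  shows "E \<in> rect_alg S T"
  unfolding rect_alg_def mem_Collect_eq
  by (intro exI[of _ \<phi>] exI[of _ \<psi>] exI[of _ D] conjI assms)

lemma algebra_rect_alg: "Sigma_Algebra.algebra (space (S \<Otimes>\<^sub>M T)) (rect_alg S T)"
  unfolding Sigma_Algebra.algebra_iff_Un
proof (intro conjI ballI)
  show "rect_alg S T \<subseteq> Pow (space (S \<Otimes>\<^sub>M T))" by (auto simp: rect_alg_def)
  show "{} \<in> rect_alg S T"
    by (rule rect_algI[where \<phi>="\<lambda>_. 0" and \<psi>="\<lambda>_. 0" and D="{}"]) (auto intro: finite_subset[of _ "{0}"])
next
  fix a assume "a \<in> rect_alg S T"
  then obtain \<phi> \<psi> and D :: "(nat \<times> nat) set" where a: "a = {x \<in> space (S \<Otimes>\<^sub>M T). (\<phi> (fst x), \<psi> (snd x)) \<in> D}"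
    "\<phi> \<in> measurable S (count_space UNIV)" "finite (\<phi> ` space S)"
    "\<psi> \<in> measurable T (count_space UNIV)" "finite (\<psi> ` space T)"
    by (auto simp: rect_alg_def)
  show "space (S \<Otimes>\<^sub>M T) - a \<in> rect_alg S T"
    by (rule rect_algI[where D="-D", OF _ a(2-5)]) (auto simp: a)
next
  fix a b assume "a \<in> rect_alg S T"
  then obtain \<phi> \<psi> and D :: "(nat \<times> nat) set" where a: "a = {x \<in> space (S \<Otimes>\<^sub>M T). (\<phi> (fst x), \<psi> (snd x)) \<in> D}"
    "\<phi> \<in> measurable S (count_space UNIV)" "finite (\<phi> ` space S)"
    "\<psi> \<in> measurable T (count_space UNIV)" "finite (\<psi> ` space T)"
    by (auto simp: rect_alg_def)
  assume "b \<in> rect_alg S T"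
  then obtain \<phi>' \<psi>' and D' :: "(nat \<times> nat) set" where b: "b = {x \<in> space (S \<Otimes>\<^sub>M T). (\<phi>' (fst x), \<psi>' (snd x)) \<in> D'}"
    "\<phi>' \<in> measurable S (count_space UNIV)" "finite (\<phi>' ` space S)"
    "\<psi>' \<in> measurable T (count_space UNIV)" "finite (\<psi>' ` space T)"
    by (auto simp: rect_alg_def)
  note [measurable] = a(2,4) b(2,4)
  let ?u = "\<lambda>x. prod_encode (\<phi> x, \<phi>' x)" let ?v = "\<lambda>x. prod_encode (\<psi> x, \<psi>' x)"
  have "finite (prod_encode ` (\<phi> ` space S \<times> \<phi>' ` space S))" using a b by blast
  then have f1: "finite (?u ` space S)" by (rule rev_finite_subset) auto
  have "finite (prod_encode ` (\<psi> ` space T \<times> \<psi>' ` space T))" using a b by blast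
  then have f2: "finite (?v ` space T)" by (rule rev_finite_subset) auto
  have m: "(\<lambda>x. prod_encode (p x, q x)) \<in> measurable K (count_space UNIV)"
    if [measurable]: "p \<in> measurable K (count_space UNIV)" "q \<in> measurable K (count_space UNIV)" for p q and K :: "'x measure"
    by (rule measurable_compose_countable[where g=p and f="\<lambda>i x. prod_encode (i, q x)"],
        rule measurable_compose_countable[where g=q and f="\<lambda>j x. prod_encode (i, j)" for i]) auto
  show "a \<union> b \<in> rect_alg S T"
  proof (rule rect_algI[OF _ m f1 m f2])
    show "a \<union> b = {x \<in> space (S \<Otimes>\<^sub>M T). (?u (fst x), ?v (snd x)) \<in> {(p, q). (fst (prod_decode p), fst (prod_decode q)) \<in> D
       \<or> (snd (prod_decode p), snd (prod_decode q)) \<in> D'}}"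
      unfolding a(1) b(1) by (auto simp only: prod.case mem_Collect_eq Un_iff prod_encode_inverse fst_conv snd_conv)
  qed fact+
qed

lemma sigma_sets_rect_alg: "sets (S \<Otimes>\<^sub>M T) = sigma_sets (space (S \<Otimes>\<^sub>M T)) (rect_alg S T)"
proof
  have "{a \<times> b |a b. a \<in> sets S \<and> b \<in> sets T} \<subseteq> rect_alg S T"
  proof safe
    fix a b assume [measurable]: "a \<in> sets S" "b \<in> sets T"
    show "a \<times> b \<in> rect_alg S T"
    proof (rule rect_algI)
      show "a \<times> b = {x \<in> space (S \<Otimes>\<^sub>M T). ((\<lambda>x. of_bool (x \<in> a) :: nat) (fst x), (\<lambda>y. of_bool (y \<in> b) :: nat) (snd x)) \<in> {(1,1)}}"
        using sets.sets_into_space[OF \<open>a \<in> sets S\<close>] sets.sets_into_space[OF \<open>b \<in> sets T\<close>]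
        by (auto simp: space_pair_measure)
    qed (auto intro: finite_subset[of _ "{0,1::nat}"])
  qed
  then show "sets (S \<Otimes>\<^sub>M T) \<subseteq> sigma_sets (space (S \<Otimes>\<^sub>M T)) (rect_alg S T)"
    unfolding sets_pair_measure space_pair_measure[symmetric] by (rule sigma_sets_mono')
next
  have "rect_alg S T \<subseteq> sets (S \<Otimes>\<^sub>M T)"
  proof
    fix E assume "E \<in> rect_alg S T"
    then obtain \<phi> \<psi> and D :: "(nat \<times> nat) set" where a: "E = {x \<in> space (S \<Otimes>\<^sub>M T). (\<phi> (fst x), \<psi> (snd x)) \<in> D}"
      "\<phi> \<in> measurable S (count_space UNIV)"
      "\<psi> \<in> measurable T (count_space UNIV)"
      by (auto simp: rect_alg_def)
    note [measurable] = a(2,3)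
    \<comment> \<open>As a set of pairs of naturals \<open>D\<close> is countable, so a countable
      union suffices even if \<open>D\<close> is infinite.\<close>
    have "E = (\<Union>d\<in>D. {x \<in> space (S \<Otimes>\<^sub>M T). \<phi> (fst x) = fst d \<and> \<psi> (snd x) = snd d})"
      unfolding a by auto
    also have "\<dots> \<in> sets (S \<Otimes>\<^sub>M T)" by (intro sets.countable_UN') auto
    finally show "E \<in> sets (S \<Otimes>\<^sub>M T)" .
  qed
  then show "sigma_sets (space (S \<Otimes>\<^sub>M T)) (rect_alg S T) \<subseteq> sets (S \<Otimes>\<^sub>M T)"
    using sets.sigma_sets_subset by blast
qed

context prob_space begin

text \<open>Makes the supremum in \<open>beta_coef\<close> one over a bounded set. The joint and the
  product masses of the cells each add up to \<open>1\<close>.\<close>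

lemma beta_sum_le_2:
  assumes "finite_partition (space M) A I P" "finite_partition (space M) B J Q" "A \<subseteq> sets M" "B \<subseteq> sets M"
  shows "(\<Sum>i\<in>I. \<Sum>j\<in>J. \<bar>measure M (P i \<inter> Q j) - measure M (P i) * measure M (Q j)\<bar>) \<le> 2"
proof -
  have P: "finite I" "\<And>i. i \<in> I \<Longrightarrow> P i \<in> sets M" "disjoint_family_on P I" "(\<Union>i\<in>I. P i) = space M"
    and Q: "finite J" "\<And>i. i \<in> J \<Longrightarrow> Q i \<in> sets M" "disjoint_family_on Q J" "(\<Union>i\<in>J. Q i) = space M"
    using assms by (auto simp: finite_partition_def)
  have 1: "(\<Sum>i\<in>I. measure M (P i)) = 1"
    using finite_measure_finite_Union[of I P] P by (auto simp: prob_space image_subset_iff)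
  have 2: "(\<Sum>i\<in>J. measure M (Q i)) = 1"
    using finite_measure_finite_Union[of J Q] Q by (auto simp: prob_space image_subset_iff)
  have 3: "(\<Sum>j\<in>J. measure M (P i \<inter> Q j)) = measure M (P i)" if "i \<in> I" for i
  proof -
    have "measure M (\<Union>j\<in>J. P i \<inter> Q j) = (\<Sum>j\<in>J. measure M (P i \<inter> Q j))"
      using Q P that by (intro finite_measure_finite_Union) (auto simp: disjoint_family_on_def)
    moreover have "(\<Union>j\<in>J. P i \<inter> Q j) = P i" using Q P that sets.sets_into_space by fastforce
    ultimately show ?thesis by simp
  qed
  have "(\<Sum>i\<in>I. \<Sum>j\<in>J. \<bar>measure M (P i \<inter> Q j) - measure M (P i) * measure M (Q j)\<bar>)
     \<le> (\<Sum>i\<in>I. \<Sum>j\<in>J. measure M (P i \<inter> Q j) + measure M (P i) * measure M (Q j))"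
    by (intro sum_mono) (smt (verit) measure_nonneg mult_nonneg_nonneg)
  also have "\<dots> = 2" by (simp add: sum.distrib 3 sum_distrib_left[symmetric] 1 2)
  finally show ?thesis .
qed

lemma beta_sum_le:
  assumes "finite_partition (space M) A I P" "finite_partition (space M) B J Q" "A \<subseteq> sets M" "B \<subseteq> sets M"
  shows "(\<Sum>i\<in>I. \<Sum>j\<in>J. \<bar>measure M (P i \<inter> Q j) - measure M (P i) * measure M (Q j)\<bar>) \<le> 2 * beta_coef M A B"
proof -
  have "(\<Sum>i\<in>I. \<Sum>j\<in>J. \<bar>measure M (P i \<inter> Q j) - measure M (P i) * measure M (Q j)\<bar>) \<le>
    Sup {(\<Sum>i\<in>I. \<Sum>j\<in>J. \<bar>measure M (P i \<inter> Q j) - measure M (P i) * measure M (Q j)\<bar>)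
      | I J P Q. finite_partition (space M) A I P \<and> finite_partition (space M) B J Q}"
    by (rule cSup_upper) (use assms beta_sum_le_2 in \<open>auto intro!: bdd_aboveI[of _ 2]\<close>)
  then show ?thesis by (simp add: beta_coef_def)
qed

text \<open>Makes the supremum over \<open>k\<close> in \<open>beta_mixing\<close> one over a
  bounded family. The trivial partitions show that the inner supremum is taken over a nonempty
  set.\<close>

lemma beta_coef_le_1:
  assumes "A \<subseteq> sets M" "B \<subseteq> sets M" "{} \<in> A" "space M \<in> A" "space M \<in> B"
  shows "beta_coef M A B \<le> 1"
proof -
  have "finite_partition (space M) A {0} (\<lambda>_. space M)" "finite_partition (space M) B {0} (\<lambda>_. space M)"
    using assms by (auto simp: finite_partition_def disjoint_family_on_def)
  then have "Sup {(\<Sum>i\<in>I. \<Sum>j\<in>J. \<bar>measure M (P i \<inter> Q j) - measure M (P i) * measure M (Q j)\<bar>)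
      | I J P Q. finite_partition (space M) A I P \<and> finite_partition (space M) B J Q} \<le> 2"
    by (intro cSup_least) (blast, use assms beta_sum_le_2 in \<open>auto\<close>)
  then show ?thesis by (simp add: beta_coef_def)
qed

text \<open>On a finite union of rectangles the difference of the two laws is bounded by a part of
  the sum that defines \<open>beta_coef\<close>; general sets follow by
  \<open>algebra_approx\<close>. The factor \<open>2\<close> undoes the \<open>1/2\<close> of the
  definition. The spaces \<open>S\<close> and \<open>T\<close> are arbitrary, here spaces of
  infinite sequences.\<close>

lemma beta_set_bound:
  assumes U: "U \<in> measurable M S" and V: "V \<in> measurable M T"
    and UA: "\<And>E. E \<in> sets S \<Longrightarrow> U -` E \<inter> space M \<in> A" and VB: "\<And>E. E \<in> sets T \<Longrightarrow> V -` E \<inter> space M \<in> B"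
    and AB: "A \<subseteq> sets M" "B \<subseteq> sets M" and E: "E \<in> sets (S \<Otimes>\<^sub>M T)"
  shows "\<bar>measure (distr M (S \<Otimes>\<^sub>M T) (\<lambda>\<omega>. (U \<omega>, V \<omega>))) E - measure (distr M S U \<Otimes>\<^sub>M distr M T V) E\<bar>
    \<le> 2 * beta_coef M A B"
proof -
  note [measurable] = U V
  define J where "J = distr M (S \<Otimes>\<^sub>M T) (\<lambda>\<omega>. (U \<omega>, V \<omega>))"
  define R where "R = distr M S U \<Otimes>\<^sub>M distr M T V"
  interpret J: prob_space J unfolding J_def by (rule prob_space_distr) measurable
  interpret RU: prob_space "distr M S U" by (rule prob_space_distr) measurable
  interpret RV: prob_space "distr M T V" by (rule prob_space_distr) measurable
  interpret RR: pair_prob_space "distr M S U" "distr M T V" ..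
  interpret R: prob_space R unfolding R_def by (rule RR.prob_space_axioms)
  have sR[measurable_cong]: "sets R = sets (S \<Otimes>\<^sub>M T)" unfolding R_def by (intro sets_pair_measure_cong) auto
  have sJ[measurable_cong]: "sets J = sets (S \<Otimes>\<^sub>M T)" unfolding J_def by auto
  have rect: "\<bar>measure J E - measure R E\<bar> \<le> 2 * beta_coef M A B" if E: "E \<in> rect_alg S T" for E
  proof -
    obtain \<phi> \<psi> and D :: "(nat \<times> nat) set" where a: "E = {x \<in> space (S \<Otimes>\<^sub>M T). (\<phi> (fst x), \<psi> (snd x)) \<in> D}"
      "\<phi> \<in> measurable S (count_space UNIV)" "finite (\<phi> ` space S)"
      "\<psi> \<in> measurable T (count_space UNIV)" "finite (\<psi> ` space T)"
      using E by (auto simp: rect_alg_def)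
    note [measurable] = a(2,4)
    let ?I = "\<phi> ` space S" let ?K = "\<psi> ` space T"
    define F where "F i = \<phi> -` {i} \<inter> space S" for i
    define G where "G j = \<psi> -` {j} \<inter> space T" for j
    have [measurable]: "F i \<in> sets S" "G i \<in> sets T" for i unfolding F_def G_def by measurable
    define P where "P i = U -` F i \<inter> space M" for i
    define Q where "Q j = V -` G j \<inter> space M" for j
    have fP: "finite_partition (space M) A ?I P"
      unfolding finite_partition_def using a(3) UA[of "F _"] measurable_space[OF U]
      by (auto simp: P_def disjoint_family_on_def) (auto simp: F_def)
    have fQ: "finite_partition (space M) B ?K Q"
      unfolding finite_partition_def using a(5) VB[of "G _"] measurable_space[OF V]
      by (auto simp: Q_def disjoint_family_on_def) (auto simp: G_def)
    have FG[measurable]: "F i \<times> G j \<in> sets (S \<Otimes>\<^sub>M T)" for i j by (simp add: pair_measureI)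
    \<comment> \<open>Only attained values of the two maps enter, so the union of cells is finite
      even when \<open>D\<close> is not.\<close>
    have E_eq: "E = (\<Union>x\<in>?I \<times> ?K \<inter> D. F (fst x) \<times> G (snd x))" (is "_ = ?R")
    proof
      show "E \<subseteq> ?R"
      proof
        fix x assume x: "x \<in> E"
        then show "x \<in> ?R" unfolding a(1)
          by (intro UN_I[of "(\<phi> (fst x), \<psi> (snd x))"]) (auto simp: space_pair_measure F_def G_def)
      qed
      show "?R \<subseteq> E" unfolding a(1) by (auto simp: space_pair_measure F_def G_def)
    qed
    have fin: "finite (?I \<times> ?K \<inter> D)" using a by blast
    have disj: "disjoint_family_on (\<lambda>x. F (fst x) \<times> G (snd x)) (?I \<times> ?K \<inter> D)"
      by (auto simp: disjoint_family_on_def F_def G_def)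
    have J1: "measure J (F i \<times> G j) = measure M (P i \<inter> Q j)" for i j
      unfolding J_def by (subst measure_distr) (auto simp: P_def Q_def intro!: arg_cong[where f="measure M"])
    have R1: "measure R (F i \<times> G j) = measure M (P i) * measure M (Q j)" for i j
      unfolding R_def measure_def by (subst RV.emeasure_pair_measure_Times)
        (auto simp: P_def Q_def emeasure_distr enn2real_mult)
    have JE: "measure J E = (\<Sum>x\<in>?I \<times> ?K \<inter> D. measure M (P (fst x) \<inter> Q (snd x)))"
      unfolding E_eq by (subst J.finite_measure_finite_Union[OF fin _ disj]) (auto simp: sJ J1)
    have RE: "measure R E = (\<Sum>x\<in>?I \<times> ?K \<inter> D. measure M (P (fst x)) * measure M (Q (snd x)))"
      unfolding E_eq by (subst R.finite_measure_finite_Union[OF fin _ disj]) (auto simp: sR R1)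
    have "\<bar>measure J E - measure R E\<bar> \<le> (\<Sum>x\<in>?I \<times> ?K \<inter> D. \<bar>measure M (P (fst x) \<inter> Q (snd x)) - measure M (P (fst x)) * measure M (Q (snd x))\<bar>)"
      unfolding JE RE sum_subtractf[symmetric] by (rule sum_abs)
    also have "\<dots> \<le> (\<Sum>x\<in>?I \<times> ?K. \<bar>measure M (P (fst x) \<inter> Q (snd x)) - measure M (P (fst x)) * measure M (Q (snd x))\<bar>)"
      by (rule sum_mono2) (use a in auto)
    also have "\<dots> = (\<Sum>i\<in>?I. \<Sum>j\<in>?K. \<bar>measure M (P i \<inter> Q j) - measure M (P i) * measure M (Q j)\<bar>)"
      by (simp add: sum.cartesian_product case_prod_unfold)
    also have "\<dots> \<le> 2 * beta_coef M A B" by (rule beta_sum_le[OF fP fQ AB])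
    finally show ?thesis .
  qed
  have eps: "\<bar>measure J E - measure R E\<bar> \<le> 2 * beta_coef M A B + e" if e: "e > 0" for e
  proof -
    obtain F where F: "F \<in> rect_alg S T" "measure J (sym_diff E F) < e/2" "measure R (sym_diff E F) < e/2"
      using algebra_approx[OF algebra_rect_alg J.finite_measure_axioms R.finite_measure_axioms, of S T E "e/2"]
        sigma_sets_rect_alg[of S T] sR sJ E e by auto
    have [measurable]: "F \<in> sets (S \<Otimes>\<^sub>M T)" using F sigma_sets_rect_alg by blast
    have [measurable]: "E \<in> sets (S \<Otimes>\<^sub>M T)" by fact
    have d: "\<bar>measure K E - measure K F\<bar> \<le> measure K (sym_diff E F)" if "prob_space K" "sets K = sets (S \<Otimes>\<^sub>M T)" for K
    proof -
      interpret K: prob_space K by fact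
      note [measurable_cong] = that(2)
      have "measure K E \<le> measure K (F \<union> sym_diff E F)" by (rule K.finite_measure_mono) (auto simp: that(2))
      also have "\<dots> \<le> measure K F + measure K (sym_diff E F)" by (rule measure_Un_le) (auto simp: that(2))
      finally have 1: "measure K E \<le> measure K F + measure K (sym_diff E F)" .
      have "measure K F \<le> measure K (E \<union> sym_diff E F)" by (rule K.finite_measure_mono) (auto simp: that(2))
      also have "\<dots> \<le> measure K E + measure K (sym_diff E F)" by (rule measure_Un_le) (auto simp: that(2))
      finally show ?thesis using 1 by auto
    qed
    have "\<bar>measure J E - measure J F\<bar> < e/2" using d[OF J.prob_space_axioms sJ] F(2) by (rule le_less_trans)
    moreover have "\<bar>measure R E - measure R F\<bar> < e/2" using d[OF R.prob_space_axioms sR] F(3) by (rule le_less_trans)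
    ultimately show ?thesis using rect[OF F(1)] by arith
  qed
  have "\<bar>measure J E - measure R E\<bar> \<le> 2 * beta_coef M A B"
    by (rule field_le_epsilon) (rule eps)
  then show ?thesis by (simp only: J_def R_def)
qed

end

text \<open>A discrete layer cake: the number of levels \<open>i / k\<close> below \<open>x\<close>
  is \<open>k * x\<close> rounded up, so the average exceeds \<open>x\<close> by at most
  \<open>1 / k\<close>.\<close>

lemma layer_cake_count:
  assumes "0 \<le> x" "x \<le> 1" "k > 0"
  shows "x \<le> (\<Sum>i<k. of_bool (real i / k < x)) / real k"
    "(\<Sum>i<k. of_bool (real i / k < x)) / real k \<le> x + 1 / real k"
proof -
  have "{i. i < k \<and> real i / real k < x} = {..<nat \<lceil>k * x\<rceil>}"
  proof -
    have "real i / real k < x \<longleftrightarrow> i < nat \<lceil>k * x\<rceil>" for i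
      using assms by (simp add: divide_simps mult.commute) (smt (verit) less_ceiling_iff of_int_of_nat_eq zless_nat_eq_int_zless)
    moreover have "i < nat \<lceil>k * x\<rceil> \<Longrightarrow> i < k" for i
    proof -
      have "k * x \<le> k" using assms by (simp add: mult_left_le)
      then show "i < nat \<lceil>k * x\<rceil> \<Longrightarrow> i < k" by linarith
    qed
    ultimately show ?thesis by blast
  qed
  moreover have "(\<Sum>i<k. of_bool (real i / k < x)) = real (card {i. i < k \<and> real i / real k < x})"
    by (simp add: sum.If_cases of_bool_def Int_def)
  ultimately have s: "(\<Sum>i<k. of_bool (real i / k < x)) = real (nat \<lceil>k * x\<rceil>)" by simp
  have "k * x \<ge> 0" using assms by simp
  then have "k * x \<le> real (nat \<lceil>k * x\<rceil>)" "real (nat \<lceil>k * x\<rceil>) \<le> k * x + 1" by linarith+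
  then show "x \<le> (\<Sum>i<k. of_bool (real i / k < x)) / real k"
    "(\<Sum>i<k. of_bool (real i / k < x)) / real k \<le> x + 1 / real k"
    unfolding s using assms by (auto simp: field_simps)
qed

text \<open>\<open>h\<close> is replaced by the average of the indicators of \<open>k\<close> level
  sets. An average, unlike a sum, does not multiply the error \<open>d\<close>, and the
  discretisation error \<open>1 / k\<close> is arbitrarily small.\<close>

lemma integral_le_of_measure_le:
  fixes h :: "'b \<Rightarrow> real"
  assumes "prob_space J" "prob_space R" and s: "sets J = sets R" and h[measurable]: "h \<in> borel_measurable R"
    and h01: "\<And>x. 0 \<le> h x" "\<And>x. h x \<le> 1"
    and le: "\<And>E. E \<in> sets R \<Longrightarrow> measure J E \<le> measure R E + d"
  shows "(\<integral>x. h x \<partial>J) \<le> (\<integral>x. h x \<partial>R) + d"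
proof -
  interpret J: prob_space J by fact
  interpret R: prob_space R by fact
  note [measurable_cong] = s
  have sp: "space J = space R" using s by (rule sets_eq_imp_space_eq)
  have "(\<integral>x. h x \<partial>J) \<le> (\<integral>x. h x \<partial>R) + d + e" if epos: "e > 0" for e
  proof -
    obtain k' where k': "1 / real (Suc k') < e" by (rule nat_approx_posE[OF epos])
    define k where "k = Suc k'"
    have k: "k > 0" "1 / real k < e" using k' unfolding k_def by simp_all
    have iJ: "(\<integral>x. (\<Sum>i<k. of_bool (real i / k < h x)) / real k \<partial>K) = (\<Sum>i<k. measure K {x\<in>space K. real i / k < h x}) / real k"
      if "prob_space K" and sK: "sets K = sets R" for K
    proof -
      interpret K: prob_space K by fact
      note [measurable_cong] = sK
      have 1: "(\<integral>x. of_bool (real i / k < h x) \<partial>K) = measure K {x\<in>space K. real i / k < h x}" for i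
      proof -
        have "(\<integral>x. of_bool (real i / k < h x) \<partial>K) = (\<integral>x. indicator {x\<in>space K. real i / k < h x} x \<partial>K)"
          by (intro Bochner_Integration.integral_cong) (auto simp: indicator_def)
        also have "\<dots> = measure K {x\<in>space K. real i / k < h x}"
          by (subst Bochner_Integration.integral_indicator) (auto intro!: arg_cong[where f="measure K"])
        finally show ?thesis .
      qed
      show ?thesis
        by (subst integral_divide_zero, subst Bochner_Integration.integral_sum)
          (auto simp: 1 intro!: K.integrable_const_bound[of _ 1])
    qed
    have b: "\<bar>(\<Sum>i<k. of_bool (real i / k < h x)) / real k\<bar> \<le> 2" for x
    proof -
      have "1 / real k \<le> 1" using k by simp
      moreover have "0 \<le> (\<Sum>i<k. of_bool (real i / k < h x)) / real k" by (intro divide_nonneg_nonneg sum_nonneg) auto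
      ultimately show ?thesis using layer_cake_count(2)[of "h x" k] h01[of x] k by linarith
    qed
    have ih: "integrable J h" "integrable R h"
      using h01 by (auto intro!: J.integrable_const_bound[of _ 1] R.integrable_const_bound[of _ 1])
    define f where "f x = (\<Sum>i<k. of_bool (real i / k < h x)) / real k" for x
    have [measurable]: "f \<in> borel_measurable R" unfolding f_def by measurable
    have fi: "integrable J f" "integrable R f"
      by (rule J.integrable_const_bound[of _ 2] R.integrable_const_bound[of _ 2]; use b f_def in simp)+
    have "(\<integral>x. h x \<partial>J) \<le> (\<integral>x. f x \<partial>J)"
      by (rule integral_mono[OF ih(1) fi(1)]) (simp only: f_def layer_cake_count(1)[OF h01 k(1)])
    moreover have "(\<integral>x. f x \<partial>J) = (\<Sum>i<k. measure J {x\<in>space R. real i / k < h x}) / real k"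
      unfolding f_def sp[symmetric] by (rule iJ[OF J.prob_space_axioms s])
    moreover have "(\<Sum>i<k. measure J {x\<in>space R. real i / k < h x}) \<le> (\<Sum>i<k. measure R {x\<in>space R. real i / k < h x} + d)"
      by (rule sum_mono, rule le) measurable
    ultimately have 1: "(\<integral>x. h x \<partial>J) \<le> (\<Sum>i<k. measure R {x\<in>space R. real i / k < h x} + d) / real k"
      using divide_right_mono[of _ _ "real k"] by (smt (verit) of_nat_0_le_iff)
    have 2: "(\<Sum>i<k. measure R {x\<in>space R. real i / k < h x} + d) / real k
        = (\<Sum>i<k. measure R {x\<in>space R. real i / k < h x}) / real k + d"
    proof -
      have "(\<Sum>i<k. d) / real k = d" using k(1) by simp
      then show ?thesis by (simp only: sum.distrib add_divide_distrib)
    qed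
    have 3: "(\<Sum>i<k. measure R {x\<in>space R. real i / k < h x}) / real k = (\<integral>x. f x \<partial>R)"
      unfolding f_def by (rule iJ[OF R.prob_space_axioms refl, symmetric])
    have c: "integrable R (\<lambda>_. 1 / real k)" by (rule R.integrable_const)
    have "(\<integral>x. f x \<partial>R) \<le> (\<integral>x. h x + 1 / real k \<partial>R)"
    proof (rule integral_mono)
      show "integrable R f" by (rule fi)
      show "integrable R (\<lambda>x. h x + 1 / real k)" using ih(2) c by (rule Bochner_Integration.integrable_add)
      show "f x \<le> h x + 1 / real k" for x unfolding f_def by (rule layer_cake_count(2)[OF h01 k(1)])
    qed
    moreover have "(\<integral>x. h x + 1 / real k \<partial>R) = (\<integral>x. h x \<partial>R) + (\<integral>x. 1 / real k \<partial>R)"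
      using ih(2) c by (rule Bochner_Integration.integral_add)
    moreover have "(\<integral>x. 1 / real k \<partial>R) = 1 / real k" by (simp add: R.prob_space)
    ultimately show ?thesis using k 1 2 3 by linarith
  qed
  then show ?thesis by (rule field_le_epsilon)
qed

subsection \<open>Decoupling and approximation by finite windows\<close>

abbreviation seqs :: "(int \<Rightarrow> real) measure" where
  "seqs \<equiv> PiM UNIV (\<lambda>_. borel)"

lemma space_seqs [simp]: "space seqs = UNIV" by (simp add: space_PiM)

lemma measurable_seqs_component [measurable]: "(\<lambda>e. e i) \<in> borel_measurable seqs"
  by (rule measurable_component_singleton) simp

text \<open>The law of the whole sequence, with mixing expressed through integrals of bounded functions of past and future;
  \<open>b\<close> is four times the coefficient, since \<open>\<beta>\<close> is half a total variation and \<open>h\<close> ranges over \<open>[-C, C]\<close>.\<close>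

locale mixing_law = prob_space P for P :: "(int \<Rightarrow> real) measure" +
  fixes b :: "nat \<Rightarrow> real"
  assumes sets_P [measurable_cong]: "sets P = sets seqs"
    and b_lim: "b \<longlonglongrightarrow> 0" and b_nonneg: "0 \<le> b q"
    and decouple: "\<And>q h C k. q \<ge> 1 \<Longrightarrow> h \<in> borel_measurable (seqs \<Otimes>\<^sub>M seqs) \<Longrightarrow> (\<And>e. \<bar>h e\<bar> \<le> C) \<Longrightarrow>
       (\<And>e1 e1' e2 e2'. (\<And>i. i \<le> k \<Longrightarrow> e1 i = e1' i) \<Longrightarrow> (\<And>i. i \<ge> k + int q \<Longrightarrow> e2 i = e2' i) \<Longrightarrow> h (e1, e2) = h (e1', e2')) \<Longrightarrow>
       \<bar>(\<integral>e. h (e, e) \<partial>P) - (\<integral>e1. \<integral>e2. h (e1, e2) \<partial>P \<partial>P)\<bar> \<le> C * b q"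
begin

lemma space_P [simp]: "space P = UNIV"
  using sets_eq_imp_space_eq[OF sets_P] by simp

lemma prob_UNIV [simp]: "prob UNIV = 1"
  using prob_space by simp

end

context prob_space begin

lemma gen_sigma_subset:
  assumes "\<And>i. eps i \<in> borel_measurable M"
  shows "gen_sigma M eps L \<subseteq> sets M"
  unfolding gen_sigma_def using assms by (intro sets.sigma_sets_subset) (auto intro: measurable_sets)

text \<open>Past and future are encoded as full sequences padded with \<open>0\<close> outside
  \<open>L\<close>, so that both take values in \<open>seqs\<close>. Membership in
  \<open>gen_sigma\<close> becomes measurability with respect to a space that has
  \<open>gen_sigma\<close> as its measurable sets.\<close>

lemma vimage_gen_sigma:
  assumes "F \<in> sets seqs" "\<And>i \<omega>. i \<notin> L \<Longrightarrow> U \<omega> i = 0" "\<And>i \<omega>. i \<in> L \<Longrightarrow> U \<omega> i = eps i \<omega>"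
  shows "U -` F \<inter> space M \<in> gen_sigma M eps L"
proof -
  define N where "N = sigma (space M) (\<Union>l\<in>L. {eps l -` B \<inter> space M | B. B \<in> sets (borel :: real measure)})"
  have sp: "space N = space M" unfolding N_def by (rule space_measure_of) auto
  have sN: "sets N = gen_sigma M eps L" unfolding N_def gen_sigma_def by (rule sets_measure_of) auto
  have "(\<lambda>\<omega>. U \<omega> i) \<in> borel_measurable N" for i
  proof (cases "i \<in> L")
    case True
    then have "(\<lambda>\<omega>. U \<omega> i) = eps i" using assms by auto
    moreover have "eps i -` B \<inter> space N \<in> sets N" if "B \<in> sets borel" for B
      unfolding sN sp gen_sigma_def using that True by (intro sigma_sets.Basic) auto
    ultimately show ?thesis by (simp add: measurable_def sp)
  next
    case False
    then have "(\<lambda>\<omega>. U \<omega> i) = (\<lambda>_. 0)" using assms by auto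
    then show ?thesis by simp
  qed
  then have "U \<in> measurable N seqs" by (rule measurable_abs_UNIV)
  from measurable_sets[OF this assms(1)] show ?thesis by (simp add: sp sN)
qed

lemma beta_coef_le_mixing:
  assumes "\<And>i. eps i \<in> borel_measurable M" "q \<ge> 1"
  shows "beta_coef M (gen_sigma M eps {..k}) (gen_sigma M eps {l + int q | l. l \<ge> k}) \<le> beta_mixing M eps q"
proof -
  have "{} \<in> gen_sigma M eps L" "space M \<in> gen_sigma M eps L" for L
    unfolding gen_sigma_def by (auto intro: sigma_sets.Empty sigma_sets_top)
  then have "beta_coef M (gen_sigma M eps {..k}) (gen_sigma M eps {l + int q | l. l \<ge> k}) \<le> 1" for k
    using gen_sigma_subset[OF assms(1)] by (intro beta_coef_le_1) auto
  then have "beta_coef M (gen_sigma M eps {..k}) (gen_sigma M eps {l + int q | l. l \<ge> k})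
     \<le> (SUP k. beta_coef M (gen_sigma M eps {..k}) (gen_sigma M eps {l + int q | l. l \<ge> k}))"
    by (intro cSUP_upper) (auto intro!: bdd_aboveI[of _ 1])
  then show ?thesis using assms by (simp add: beta_mixing_def)
qed

text \<open>Transfer to the canonical space of sequences. The absolute value gives
  \<open>b_nonneg\<close> at once.\<close>

lemma mixing_law_distr:
  assumes eps[measurable]: "\<And>i. eps i \<in> borel_measurable M" and lim: "beta_mixing M eps \<longlonglongrightarrow> 0"
  shows "mixing_law (distr M seqs (\<lambda>\<omega> i. eps i \<omega>)) (\<lambda>q. 4 * \<bar>beta_mixing M eps q\<bar>)"
proof -
  define E where "E = (\<lambda>\<omega> i. eps i \<omega>)"
  have [measurable]: "E \<in> measurable M seqs" unfolding E_def by (rule measurable_abs_UNIV) simp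
  define P where "P = distr M seqs E"
  have sP[measurable_cong]: "sets P = sets seqs" by (simp add: P_def)
  interpret P: prob_space P unfolding P_def by (rule prob_space_distr) measurable
  have "\<bar>(\<integral>e. h (e, e) \<partial>P) - (\<integral>e1. \<integral>e2. h (e1, e2) \<partial>P \<partial>P)\<bar> \<le> C * (4 * \<bar>beta_mixing M eps q\<bar>)"
    if q: "q \<ge> 1" and h[measurable]: "h \<in> borel_measurable (seqs \<Otimes>\<^sub>M seqs)" and hC: "\<And>e. \<bar>h e\<bar> \<le> C"
      and dep: "\<And>e1 e1' e2 e2'. (\<And>i. i \<le> k \<Longrightarrow> e1 i = e1' i) \<Longrightarrow> (\<And>i. i \<ge> k + int q \<Longrightarrow> e2 i = e2' i) \<Longrightarrow> h (e1, e2) = h (e1', e2')"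
    for q h C k
  proof -
    \<comment> \<open>Cutting off the coordinates that \<open>h\<close> ignores leaves
      \<open>h\<close> unchanged and makes its two arguments measurable with respect to past and
      future.\<close>
    define T1 :: "(int \<Rightarrow> real) \<Rightarrow> int \<Rightarrow> real" where "T1 = (\<lambda>e i. if i \<le> k then e i else 0)"
    define T2 :: "(int \<Rightarrow> real) \<Rightarrow> int \<Rightarrow> real" where "T2 = (\<lambda>e i. if i \<ge> k + int q then e i else 0)"
    have [measurable]: "T1 \<in> measurable seqs seqs" unfolding T1_def by (rule measurable_abs_UNIV) simp
    have [measurable]: "T2 \<in> measurable seqs seqs" unfolding T2_def by (rule measurable_abs_UNIV) simp
    define U where "U \<omega> = T1 (E \<omega>)" for \<omega>
    define V where "V \<omega> = T2 (E \<omega>)" for \<omega>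
    have [measurable]: "U \<in> measurable M seqs" "V \<in> measurable M seqs" unfolding U_def V_def by measurable
    define J where "J = distr M (seqs \<Otimes>\<^sub>M seqs) (\<lambda>\<omega>. (U \<omega>, V \<omega>))"
    define R where "R = distr M seqs U \<Otimes>\<^sub>M distr M seqs V"
    interpret J: prob_space J unfolding J_def by (rule prob_space_distr) measurable
    interpret RU: prob_space "distr M seqs U" by (rule prob_space_distr) measurable
    interpret RV: prob_space "distr M seqs V" by (rule prob_space_distr) measurable
    interpret RR: pair_prob_space "distr M seqs U" "distr M seqs V" ..
    interpret R: prob_space R unfolding R_def by (rule RR.prob_space_axioms)
    have sR[measurable_cong]: "sets R = sets (seqs \<Otimes>\<^sub>M seqs)" unfolding R_def by (intro sets_pair_measure_cong) auto
    have sJ[measurable_cong]: "sets J = sets (seqs \<Otimes>\<^sub>M seqs)" unfolding J_def by auto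
    let ?A = "gen_sigma M eps {..k}" let ?B = "gen_sigma M eps {l + int q | l. l \<ge> k}"
    have iB: "i \<in> {l + int q | l. l \<ge> k} \<longleftrightarrow> i \<ge> k + int q" for i
      by (auto intro: exI[of _ "i - int q"])
    have bd: "\<bar>measure J F - measure R F\<bar> \<le> 2 * \<bar>beta_mixing M eps q\<bar>" if "F \<in> sets (seqs \<Otimes>\<^sub>M seqs)" for F
    proof -
      have "\<bar>measure J F - measure R F\<bar> \<le> 2 * beta_coef M ?A ?B"
        unfolding J_def R_def
      proof (rule beta_set_bound[OF _ _ _ _ _ _ that])
        show "U -` G \<inter> space M \<in> ?A" if "G \<in> sets seqs" for G
          by (rule vimage_gen_sigma[OF that]) (auto simp: U_def T1_def E_def)
        show "V -` G \<inter> space M \<in> ?B" if "G \<in> sets seqs" for G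
          by (rule vimage_gen_sigma[OF that]) (simp_all only: iB, auto simp: V_def T2_def E_def)
      qed (auto intro: gen_sigma_subset[OF eps, THEN subsetD])
      then show ?thesis using beta_coef_le_mixing[of eps q k, OF eps q] by linarith
    qed
    have C0: "C \<ge> 0" using hC[of undefined] by linarith
    have hi: "integrable R h" "integrable J h"
      using hC by (auto intro!: R.integrable_const_bound[of _ C] J.integrable_const_bound[of _ C])
    have key: "\<bar>(\<integral>x. h x \<partial>J) - (\<integral>x. h x \<partial>R)\<bar> \<le> C * (4 * \<bar>beta_mixing M eps q\<bar>)"
    proof (cases "C = 0")
      case True
      then have "h x = 0" for x using hC[of x] by simp
      then show ?thesis using True by simp
    next
      case False
      then have Cp: "C > 0" using C0 by simp
      \<comment> \<open>The sign \<open>s\<close> yields the two one-sided estimates. The rescaling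
        maps \<open>[-C, C]\<close> to \<open>[0, 1]\<close>, and undoing it multiplies the error by
        \<open>2 * C\<close>.\<close>
      have one: "s * (\<integral>x. h x \<partial>J) \<le> s * (\<integral>x. h x \<partial>R) + C * (4 * \<bar>beta_mixing M eps q\<bar>)" if s: "s = 1 \<or> s = -1" for s :: real
      proof -
        have r: "0 \<le> (C + s * h x) / (2 * C)" "(C + s * h x) / (2 * C) \<le> 1" for x
          using Cp s hC[of x] by (auto simp: divide_simps)
        have le: "(\<integral>x. (C + s * h x) / (2 * C) \<partial>J) \<le> (\<integral>x. (C + s * h x) / (2 * C) \<partial>R) + 2 * \<bar>beta_mixing M eps q\<bar>"
        proof (rule integral_le_of_measure_le[OF J.prob_space_axioms R.prob_space_axioms _ _ r])
          show "sets J = sets R" by (simp only: sR sJ)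
          show "(\<lambda>x. (C + s * h x) / (2 * C)) \<in> borel_measurable R" by measurable
          show "measure J F \<le> measure R F + 2 * \<bar>beta_mixing M eps q\<bar>" if "F \<in> sets R" for F
            using bd[of F] that sR by auto
        qed
        have e1: "(\<integral>x. (C + s * h x) / (2 * C) \<partial>J) = (C + s * (\<integral>x. h x \<partial>J)) / (2 * C)"
          using hi(2) by (simp add: J.prob_space)
        have e2: "(\<integral>x. (C + s * h x) / (2 * C) \<partial>R) = (C + s * (\<integral>x. h x \<partial>R)) / (2 * C)"
          using hi(1) by (simp add: R.prob_space)
        have "(C + s * (\<integral>x. h x \<partial>J)) / (2 * C) \<le> (C + s * (\<integral>x. h x \<partial>R)) / (2 * C) + 2 * \<bar>beta_mixing M eps q\<bar>"
          using le unfolding e1 e2 .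
        then show ?thesis using Cp by (simp add: divide_simps mult.commute)
      qed
      show ?thesis using one[of 1] one[of "-1"] unfolding abs_le_iff by simp
    qed
    have "(\<integral>x. h x \<partial>J) = (\<integral>e. h (e, e) \<partial>P)"
    proof -
      have "(\<integral>x. h x \<partial>J) = (\<integral>\<omega>. h (U \<omega>, V \<omega>) \<partial>M)" unfolding J_def by (subst integral_distr) auto
      also have "\<dots> = (\<integral>\<omega>. h (E \<omega>, E \<omega>) \<partial>M)"
        by (intro Bochner_Integration.integral_cong refl dep) (auto simp: U_def V_def T1_def T2_def)
      also have "\<dots> = (\<integral>e. h (e, e) \<partial>P)" unfolding P_def by (subst integral_distr) auto
      finally show ?thesis .
    qed
    moreover have "(\<integral>x. h x \<partial>R) = (\<integral>e1. \<integral>e2. h (e1, e2) \<partial>P \<partial>P)"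
    proof -
      have dU: "distr M seqs U = distr P seqs T1" unfolding P_def by (subst distr_distr) (auto simp: U_def[abs_def] o_def)
      have dV: "distr M seqs V = distr P seqs T2" unfolding P_def by (subst distr_distr) (auto simp: V_def[abs_def] o_def)
      have "(\<integral>x. h x \<partial>R) = (\<integral>x. \<integral>y. h (x, y) \<partial>distr M seqs V \<partial>distr M seqs U)"
        using RR.integral_fst'[of h] hi unfolding R_def by simp
      also have "\<dots> = (\<integral>x. \<integral>e2. h (x, T2 e2) \<partial>P \<partial>distr M seqs U)"
        unfolding dV by (intro Bochner_Integration.integral_cong refl integral_distr) auto
      also have "\<dots> = (\<integral>e1. \<integral>e2. h (T1 e1, T2 e2) \<partial>P \<partial>P)"
        unfolding dU by (rule integral_distr) measurable
      also have "\<dots> = (\<integral>e1. \<integral>e2. h (e1, e2) \<partial>P \<partial>P)"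
        by (intro Bochner_Integration.integral_cong refl dep) (auto simp: T1_def T2_def)
      finally show ?thesis .
    qed
    ultimately show ?thesis using key by simp
  qed
  note dec = this
  have lim4: "(\<lambda>q. 4 * \<bar>beta_mixing M eps q\<bar>) \<longlonglongrightarrow> 0"
    using tendsto_mult[OF tendsto_const[of 4] tendsto_rabs[OF lim]] by simp
  have "mixing_law P (\<lambda>q. 4 * \<bar>beta_mixing M eps q\<bar>)"
  proof unfold_locales
    show "sets P = sets seqs" by (rule sP)
    show "(\<lambda>q. 4 * \<bar>beta_mixing M eps q\<bar>) \<longlonglongrightarrow> 0" by (rule lim4)
    show "0 \<le> 4 * \<bar>beta_mixing M eps q\<bar>" for q by simp
    show "\<bar>(\<integral>e. h (e, e) \<partial>P) - (\<integral>e1. \<integral>e2. h (e1, e2) \<partial>P \<partial>P)\<bar> \<le> C * (4 * \<bar>beta_mixing M eps q\<bar>)"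
      if "q \<ge> 1" "h \<in> borel_measurable (seqs \<Otimes>\<^sub>M seqs)" "\<And>e. \<bar>h e\<bar> \<le> C"
        "\<And>e1 e1' e2 e2'. (\<And>i. i \<le> k \<Longrightarrow> e1 i = e1' i) \<Longrightarrow> (\<And>i. i \<ge> k + int q \<Longrightarrow> e2 i = e2' i) \<Longrightarrow> h (e1, e2) = h (e1', e2')"
      for q h C k by (rule dec[OF that])
  qed
  then show ?thesis by (simp add: P_def E_def)
qed

end

section \<open>Density in L2 of bounded functions of finitely many coordinates\<close>

definition window_fun :: "((int \<Rightarrow> real) \<Rightarrow> real) \<Rightarrow> bool" where
  "window_fun w \<longleftrightarrow> w \<in> borel_measurable seqs \<and> (\<exists>T. \<forall>e. \<bar>w e\<bar> \<le> T) \<and>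
     (\<exists>m::nat. \<forall>e e'. (\<forall>i. \<bar>i\<bar> \<le> int m \<longrightarrow> e i = e' i) \<longrightarrow> w e = w e')"

lemma window_fun_add:
  assumes "window_fun u" "window_fun w" shows "window_fun (\<lambda>e. u e + w e)"
proof -
  obtain T m where u: "u \<in> borel_measurable seqs" "\<And>e. \<bar>u e\<bar> \<le> T"
    "\<And>e e'. (\<forall>i. \<bar>i\<bar> \<le> int m \<longrightarrow> e i = e' i) \<Longrightarrow> u e = u e'"
    using assms(1) unfolding window_fun_def by (elim conjE exE) (rule that, auto)
  obtain T' m' where w: "w \<in> borel_measurable seqs" "\<And>e. \<bar>w e\<bar> \<le> T'"
    "\<And>e e'. (\<forall>i. \<bar>i\<bar> \<le> int m' \<longrightarrow> e i = e' i) \<Longrightarrow> w e = w e'"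
    using assms(2) unfolding window_fun_def by (elim conjE exE) (rule that, auto)
  note [measurable] = u(1) w(1)
  show ?thesis unfolding window_fun_def
  proof (intro conjI exI allI impI)
    show "(\<lambda>e. u e + w e) \<in> borel_measurable seqs" by measurable
    show "\<bar>u e + w e\<bar> \<le> T + T'" for e using u(2)[of e] w(2)[of e] by linarith
    show "u e + w e = u e' + w e'" if "\<forall>i. \<bar>i\<bar> \<le> int (max m m') \<longrightarrow> e i = e' i" for e e'
      using that by (intro arg_cong2[where f="(+)"] u(3) w(3)) auto
  qed
qed

text \<open>The growth condition covers the two uses below, multiplication by a constant and
  subtraction of a mean.\<close>

lemma window_fun_compose:
  assumes "window_fun u" and f: "f \<in> borel_measurable borel" "\<And>x. \<bar>f x\<bar> \<le> B * \<bar>x\<bar> + D"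
    and B: "B \<ge> 0"
  shows "window_fun (\<lambda>e. f (u e) :: real)"
proof -
  obtain T m where u: "u \<in> borel_measurable seqs" "\<And>e. \<bar>u e\<bar> \<le> T"
    "\<And>e e'. (\<forall>i. \<bar>i\<bar> \<le> int m \<longrightarrow> e i = e' i) \<Longrightarrow> u e = u e'"
    using assms(1) unfolding window_fun_def by (elim conjE exE) (rule that, auto)
  note [measurable] = u(1) f(1)
  show ?thesis unfolding window_fun_def
  proof (intro conjI exI allI impI)
    show "(\<lambda>e. f (u e)) \<in> borel_measurable seqs" by measurable
    show "\<bar>f (u e)\<bar> \<le> B * T + D" for e
      using f(2)[of "u e"] mult_left_mono[OF u(2)[of e] B] by linarith
    show "f (u e) = f (u e')" if "\<forall>i. \<bar>i\<bar> \<le> int m \<longrightarrow> e i = e' i" for e e'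
      using u(3)[OF that] by simp
  qed
qed

lemma square_add_le: "(x + y)\<^sup>2 \<le> 2 * x\<^sup>2 + 2 * (y::real)\<^sup>2"
  by (smt (verit, ccfv_SIG) sum_squares_bound power2_sum)

lemma prob_space_integrable_square:
  assumes "prob_space P" "f \<in> borel_measurable P" "\<And>x. \<bar>f x\<bar> \<le> (T::real)"
  shows "integrable P (\<lambda>x. (f x)\<^sup>2)"
proof -
  interpret prob_space P by fact
  note [measurable] = assms(2)
  have "\<bar>f x\<bar>\<^sup>2 \<le> T\<^sup>2" for x using assms(3)[of x] by (intro power_mono) auto
  then show ?thesis by (intro integrable_const_bound[of _ "T\<^sup>2"]) auto
qed

text \<open>Sets determined by finitely many coordinates form an algebra that generates the product
  sigma-algebra, so \<open>algebra_approx\<close> applies, with \<open>P\<close> in both places. The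
  squared L2 distance of two indicators is the measure of the symmetric difference.\<close>

lemma window_fun_approx_indicator:
  assumes "prob_space P" and sP: "sets P = sets seqs" and E: "E \<in> sets seqs" and e: "e > 0"
  shows "\<exists>w. window_fun w \<and> (\<integral>x. (indicator E x - w x)\<^sup>2 \<partial>P) < e"
proof -
  interpret prob_space P by fact
  note [measurable_cong] = sP
  define \<A> where "\<A> = {A \<in> sets seqs. \<exists>m::nat. \<forall>e e'. (\<forall>i. \<bar>i\<bar> \<le> int m \<longrightarrow> e i = e' i) \<longrightarrow> (e \<in> A \<longleftrightarrow> e' \<in> A)}"
  have \<A>_Int: "sets seqs \<supseteq> \<A>" by (auto simp: \<A>_def)
  have alg: "Sigma_Algebra.algebra UNIV \<A>"
    unfolding Sigma_Algebra.algebra_iff_Un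
  proof (intro conjI ballI)
    show "{} \<in> \<A>" by (auto simp: \<A>_def)
    show "UNIV - A \<in> \<A>" if A: "A \<in> \<A>" for A
    proof -
      have "A \<in> sets seqs" using A by (simp add: \<A>_def)
      then have "UNIV - A \<in> sets seqs" using sets.compl_sets[of A seqs] by simp
      then show ?thesis using A unfolding \<A>_def by auto
    qed
    show "A \<union> B \<in> \<A>" if A: "A \<in> \<A>" and B: "B \<in> \<A>" for A B
    proof -
      obtain m where m: "\<And>e e'. (\<forall>i. \<bar>i\<bar> \<le> int m \<longrightarrow> e i = e' i) \<Longrightarrow> (e \<in> A \<longleftrightarrow> e' \<in> A)"
        using A unfolding \<A>_def by blast
      obtain m' where m': "\<And>e e'. (\<forall>i. \<bar>i\<bar> \<le> int m' \<longrightarrow> e i = e' i) \<Longrightarrow> (e \<in> B \<longleftrightarrow> e' \<in> B)"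
        using B unfolding \<A>_def by blast
      have "(e \<in> A \<union> B \<longleftrightarrow> e' \<in> A \<union> B)" if "\<forall>i. \<bar>i\<bar> \<le> int (max m m') \<longrightarrow> e i = e' i" for e e'
        using m[of e e'] m'[of e e'] that by auto
      then show ?thesis using A B unfolding \<A>_def by blast
    qed
  qed auto
  have gen: "sets seqs = sigma_sets UNIV \<A>"
  proof
    have "{{f \<in> Pi\<^sub>E UNIV (\<lambda>i. space borel). f i \<in> A} |i A. i \<in> UNIV \<and> A \<in> sets borel} \<subseteq> \<A>"
    proof safe
      fix i :: int and A :: "real set" assume [measurable]: "A \<in> sets borel"
      have "{f \<in> space seqs. f i \<in> A} \<in> sets seqs" by measurable
      then have "{f. f i \<in> A} \<in> sets seqs" by simp
      moreover have "\<forall>e e'. (\<forall>j. \<bar>j\<bar> \<le> int (nat \<bar>i\<bar>) \<longrightarrow> e j = e' j) \<longrightarrow> (e \<in> {f. f i \<in> A}) = (e' \<in> {f. f i \<in> A})"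
        by auto
      ultimately have "{f. f i \<in> A} \<in> \<A>" unfolding \<A>_def by (intro CollectI conjI exI[of _ "nat \<bar>i\<bar>"])
      then show "{f \<in> UNIV \<rightarrow>\<^sub>E space borel. f i \<in> A} \<in> \<A>" by (simp add: PiE_def)
    qed
    moreover have "(Pi\<^sub>E UNIV (\<lambda>i::int. space (borel :: real measure))) = UNIV" by auto
    ultimately show "sets seqs \<subseteq> sigma_sets UNIV \<A>"
      unfolding sets_PiM_single by (simp add: sigma_sets_mono')
    show "sigma_sets UNIV \<A> \<subseteq> sets seqs"
      using sets.sigma_sets_subset[OF \<A>_Int] by simp
  qed
  obtain A where A: "A \<in> \<A>" "measure P (sym_diff E A) < e"
    using algebra_approx[OF alg finite_measure_axioms finite_measure_axioms, of E e] gen sP E e by auto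
  have [measurable]: "A \<in> sets seqs" "E \<in> sets seqs" using A E by (auto simp: \<A>_def)
  have "window_fun (indicator A)" unfolding window_fun_def
  proof (intro conjI)
    show "\<exists>T. \<forall>e. \<bar>indicator A e :: real\<bar> \<le> T" by (rule exI[of _ 1]) (simp add: indicator_def)
    obtain m where m: "\<And>e e'. (\<forall>i. \<bar>i\<bar> \<le> int m \<longrightarrow> e i = e' i) \<Longrightarrow> (e \<in> A \<longleftrightarrow> e' \<in> A)"
      using A(1) unfolding \<A>_def by blast
    show "\<exists>m::nat. \<forall>e e'. (\<forall>i. \<bar>i\<bar> \<le> int m \<longrightarrow> e i = e' i) \<longrightarrow> indicator A e = (indicator A e' :: real)"
      by (intro exI[of _ m] allI impI, drule m) (simp add: indicator_def)
  qed simp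
  moreover have "(\<integral>x. (indicator E x - indicator A x :: real)\<^sup>2 \<partial>P) = measure P (sym_diff E A)"
  proof -
    have "(\<integral>x. (indicator E x - indicator A x :: real)\<^sup>2 \<partial>P) = (\<integral>x. indicator (sym_diff E A) x \<partial>P)"
      by (intro Bochner_Integration.integral_cong) (auto simp: indicator_def)
    also have "\<dots> = measure P (sym_diff E A)"
      by (subst Bochner_Integration.integral_indicator)
        (auto simp: sP sets_eq_imp_space_eq[OF sP])
    finally show ?thesis .
  qed
  ultimately show ?thesis using A(2) by (metis (no_types))
qed

lemma window_fun_approx_sum:
  assumes "prob_space P" and sP: "sets P = sets seqs" and F: "finite F" and E: "\<And>y. y \<in> F \<Longrightarrow> E y \<in> sets seqs" and e: "e > 0"
  shows "\<exists>w. window_fun w \<and> (\<integral>x. ((\<Sum>y\<in>F. c y * indicator (E y) x) - w x)\<^sup>2 \<partial>P) < e"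
  using F E e
proof (induction arbitrary: e rule: finite_induct)
  case empty
  show ?case using empty by (intro exI[of _ "\<lambda>_. 0"]) (auto simp: window_fun_def)
next
  case (insert y F)
  interpret prob_space P by fact
  note [measurable_cong] = sP
  have [measurable]: "\<And>z. z \<in> F \<Longrightarrow> E z \<in> sets seqs" "E y \<in> sets seqs" using insert.prems by auto
  obtain u where u: "window_fun u" "(\<integral>x. ((\<Sum>y\<in>F. c y * indicator (E y) x) - u x)\<^sup>2 \<partial>P) < e/4"
    using insert.IH[of "e/4"] insert.prems by auto
  \<comment> \<open>Chosen so that \<open>(c y)\<^sup>2 * d\<close> is at most \<open>e / 4\<close>;
    the \<open>1 +\<close> covers \<open>c y = 0\<close>. With the factors \<open>2\<close> of
    \<open>square_add_le\<close> the two errors add up to less than \<open>e\<close>.\<close>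
  define d where "d = (e / 4) / (1 + (c y)\<^sup>2)"
  have d: "d > 0" using insert.prems by (simp add: d_def add_pos_nonneg)
  obtain w where w: "window_fun w" "(\<integral>x. (indicator (E y) x - w x)\<^sup>2 \<partial>P) < d"
    using window_fun_approx_indicator[OF \<open>prob_space P\<close> sP, of "E y" d] d insert.prems by auto
  have cw: "window_fun (\<lambda>x. c y * w x)"
    by (rule window_fun_compose[OF w(1), where B="\<bar>c y\<bar>" and D=0]) (auto simp: abs_mult)
  obtain Tu where [measurable]: "u \<in> borel_measurable seqs" and Tu: "\<And>x. \<bar>u x\<bar> \<le> Tu"
    using u(1) unfolding window_fun_def by auto
  obtain Tw where [measurable]: "w \<in> borel_measurable seqs" and Tw: "\<And>x. \<bar>w x\<bar> \<le> Tw"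
    using w(1) unfolding window_fun_def by auto
  have i1: "integrable P (\<lambda>x. ((\<Sum>y\<in>F. c y * indicator (E y) x) - u x)\<^sup>2)"
  proof (rule prob_space_integrable_square[OF \<open>prob_space P\<close>, where T="(\<Sum>y\<in>F. \<bar>c y\<bar>) + Tu"])
    show "\<bar>(\<Sum>y\<in>F. c y * indicator (E y) x) - u x\<bar> \<le> (\<Sum>y\<in>F. \<bar>c y\<bar>) + Tu" for x
    proof -
      have "\<bar>\<Sum>y\<in>F. c y * indicator (E y) x\<bar> \<le> (\<Sum>y\<in>F. \<bar>c y * indicator (E y) x\<bar>)" by (rule sum_abs)
      also have "\<dots> \<le> (\<Sum>y\<in>F. \<bar>c y\<bar>)" by (intro sum_mono) (auto simp: indicator_def)
      finally show ?thesis using Tu[of x] by linarith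
    qed
  qed measurable
  have i2: "integrable P (\<lambda>x. (indicator (E y) x - w x)\<^sup>2)"
  proof (rule prob_space_integrable_square[OF \<open>prob_space P\<close>, where T="1 + Tw"])
    show "\<bar>indicator (E y) x - w x\<bar> \<le> 1 + Tw" for x
    proof -
      have "\<bar>indicator (E y) x :: real\<bar> \<le> 1" by (simp add: indicator_def)
      then show ?thesis using Tw[of x] by linarith
    qed
  qed measurable
  have "(\<integral>x. ((\<Sum>y\<in>insert y F. c y * indicator (E y) x) - (u x + c y * w x))\<^sup>2 \<partial>P)
     \<le> (\<integral>x. 2 * ((\<Sum>y\<in>F. c y * indicator (E y) x) - u x)\<^sup>2 + 2 * ((c y)\<^sup>2 * (indicator (E y) x - w x)\<^sup>2) \<partial>P)"
  proof (rule integral_mono')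
    show "integrable P (\<lambda>x. 2 * ((\<Sum>y\<in>F. c y * indicator (E y) x) - u x)\<^sup>2 + 2 * ((c y)\<^sup>2 * (indicator (E y) x - w x)\<^sup>2))"
      using i1 i2 by auto
    fix x
    have eq: "(\<Sum>y\<in>insert y F. c y * indicator (E y) x) - (u x + c y * w x)
       = ((\<Sum>y\<in>F. c y * indicator (E y) x) - u x) + c y * (indicator (E y) x - w x)"
      unfolding sum.insert[OF insert.hyps(1,2)] right_diff_distrib by linarith
    show "((\<Sum>y\<in>insert y F. c y * indicator (E y) x) - (u x + c y * w x))\<^sup>2 \<le>
      2 * ((\<Sum>y\<in>F. c y * indicator (E y) x) - u x)\<^sup>2 + 2 * ((c y)\<^sup>2 * (indicator (E y) x - w x)\<^sup>2)"
      unfolding eq using square_add_le by (simp only: power_mult_distrib[symmetric])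
    show "0 \<le> 2 * ((\<Sum>y\<in>F. c y * indicator (E y) x) - u x)\<^sup>2 + 2 * ((c y)\<^sup>2 * (indicator (E y) x - w x)\<^sup>2)"
      by simp
  qed
  also have "\<dots> = 2 * (\<integral>x. ((\<Sum>y\<in>F. c y * indicator (E y) x) - u x)\<^sup>2 \<partial>P) + 2 * ((c y)\<^sup>2 * (\<integral>x. (indicator (E y) x - w x)\<^sup>2 \<partial>P))"
    using i1 i2 by simp
  also have "\<dots> < e"
  proof -
    have "(c y)\<^sup>2 * (\<integral>x. (indicator (E y) x - w x)\<^sup>2 \<partial>P) \<le> (c y)\<^sup>2 * d" using w(2) by (intro mult_left_mono) auto
    also have "\<dots> \<le> e / 4"
    proof -
      have "(c y)\<^sup>2 * d \<le> (1 + (c y)\<^sup>2) * d" using d by (intro mult_right_mono) auto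
      also have "\<dots> = e / 4" unfolding d_def
        by (rule mult_divide_self) (use add_pos_nonneg[of 1 "(c y)\<^sup>2"] in auto)
      finally show ?thesis .
    qed
    finally show ?thesis using u(2) by linarith
  qed
  finally show ?case using window_fun_add[OF u(1) cw] by (intro exI[of _ "\<lambda>x. u x + c y * w x"]) auto
qed

text \<open>Simple functions dominated by \<open>2 * \<bar>g x\<bar>\<close> converge to
  \<open>g\<close> in L2 by dominated convergence, and they are combinations of indicators.\<close>

lemma window_fun_approx:
  assumes "prob_space P" and sP: "sets P = sets seqs" and g[measurable]: "g \<in> borel_measurable seqs"
    and g2: "integrable P (\<lambda>x. (g x)\<^sup>2)" and e: "e > 0"
  shows "\<exists>w. window_fun w \<and> (\<integral>x. (g x - w x :: real)\<^sup>2 \<partial>P) < e"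
proof -
  interpret prob_space P by fact
  note [measurable_cong] = sP
  have spP: "space P = UNIV" using sets_eq_imp_space_eq[OF sP] by simp
  obtain F where F: "\<And>i. simple_function P (F i)" "\<And>x. (\<lambda>i. F i x) \<longlonglongrightarrow> g x" "\<And>i x. \<bar>F i x\<bar> \<le> 2 * \<bar>g x\<bar>"
    using borel_measurable_implies_sequence_metric[of g P 0] spP by (auto simp: dist_real_def)
  have [measurable]: "F i \<in> borel_measurable seqs" for i
    using borel_measurable_simple_function[OF F(1)[of i]] by simp
  have dom: "(g x - F i x)\<^sup>2 \<le> 9 * (g x)\<^sup>2" for i x
  proof -
    have "\<bar>g x - F i x\<bar> \<le> \<bar>3 * g x\<bar>" using F(3)[of i x] by linarith
    then have "(g x - F i x)\<^sup>2 \<le> (3 * g x)\<^sup>2" by (simp only: abs_le_square_iff)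
    then show ?thesis by (simp add: power_mult_distrib)
  qed
  have "(\<lambda>i. \<integral>x. (g x - F i x)\<^sup>2 \<partial>P) \<longlonglongrightarrow> (\<integral>x. 0 \<partial>P)"
  proof (rule integral_dominated_convergence[where w="\<lambda>x. 9 * (g x)\<^sup>2"])
    show "AE x in P. (\<lambda>i. (g x - F i x)\<^sup>2) \<longlonglongrightarrow> 0"
      using F(2) by (intro AE_I2) (auto intro!: tendsto_eq_intros)
    show "AE x in P. norm ((g x - F i x)\<^sup>2) \<le> 9 * (g x)\<^sup>2" for i using dom by (intro AE_I2) auto
  qed (use g2 in auto)
  then have "eventually (\<lambda>i. (\<integral>x. (g x - F i x)\<^sup>2 \<partial>P) < e/4) sequentially"
    using e by (intro order_tendstoD(2)[where y=0]) auto
  then obtain i where i: "(\<integral>x. (g x - F i x)\<^sup>2 \<partial>P) < e/4" by (auto simp: eventually_sequentially)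
  have fin: "finite (range (F i))" using F(1)[of i] spP by (simp add: simple_function_def)
  have Frep: "F i x = (\<Sum>y\<in>range (F i). y * indicator (F i -` {y}) x)" for x
  proof -
    have "(\<Sum>y\<in>range (F i). y * indicator (F i -` {y}) x) = (\<Sum>y\<in>{F i x}. y * indicator (F i -` {y}) x)"
      using fin by (intro sum.mono_neutral_right) (auto simp: indicator_def)
    then show ?thesis by simp
  qed
  have mE: "F i -` {y} \<in> sets seqs" for y using measurable_sets[of "F i" seqs borel "{y}"] by simp
  have "\<exists>w. window_fun w \<and> (\<integral>x. ((\<Sum>y\<in>range (F i). y * indicator (F i -` {y}) x) - w x)\<^sup>2 \<partial>P) < e/4"
    by (rule window_fun_approx_sum[OF \<open>prob_space P\<close> sP fin mE]) (use e in simp)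
  then obtain w where w: "window_fun w" "(\<integral>x. (F i x - w x)\<^sup>2 \<partial>P) < e/4"
    unfolding Frep[symmetric] by (elim exE conjE) (rule that)
  obtain Tw where [measurable]: "w \<in> borel_measurable seqs" and Tw: "\<And>x. \<bar>w x\<bar> \<le> Tw"
    using w(1) unfolding window_fun_def by auto
  have i1: "integrable P (\<lambda>x. (g x - F i x)\<^sup>2)"
    by (rule Bochner_Integration.integrable_bound[of _ "\<lambda>x. 9 * (g x)\<^sup>2"]) (use g2 dom in auto)
  have TF: "\<bar>F i x\<bar> \<le> (\<Sum>y\<in>range (F i). \<bar>y\<bar>)" for x
    by (rule member_le_sum[of "F i x" "range (F i)" abs]) (use fin in auto)
  have i2: "integrable P (\<lambda>x. (F i x - w x)\<^sup>2)"
  proof (rule prob_space_integrable_square[OF \<open>prob_space P\<close>, where T="(\<Sum>y\<in>range (F i). \<bar>y\<bar>) + Tw"])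
    show "\<bar>F i x - w x\<bar> \<le> (\<Sum>y\<in>range (F i). \<bar>y\<bar>) + Tw" for x using TF[of x] Tw[of x] by linarith
  qed measurable
  have "(\<integral>x. (g x - w x)\<^sup>2 \<partial>P) \<le> (\<integral>x. 2 * (g x - F i x)\<^sup>2 + 2 * (F i x - w x)\<^sup>2 \<partial>P)"
  proof (rule integral_mono')
    show "(g x - w x)\<^sup>2 \<le> 2 * (g x - F i x)\<^sup>2 + 2 * (F i x - w x)\<^sup>2" for x
      using square_add_le[of "g x - F i x" "F i x - w x"] by simp
  qed (use i1 i2 in auto)
  also have "\<dots> = 2 * (\<integral>x. (g x - F i x)\<^sup>2 \<partial>P) + 2 * (\<integral>x. (F i x - w x)\<^sup>2 \<partial>P)" using i1 i2 by simp
  also have "\<dots> < e" using i w(2) by linarith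
  finally have "(\<integral>x. (g x - w x)\<^sup>2 \<partial>P) < e" .
  with w(1) show ?thesis by (intro exI[of _ w] conjI)
qed

text \<open>Subtracting its mean \<open>\<mu>\<close> improves an approximant: since
  \<open>g\<close> is centered, the squared error drops by \<open>\<mu>\<^sup>2\<close>.\<close>

lemma window_fun_approx_centered:
  assumes "prob_space P" and sP: "sets P = sets seqs" and g[measurable]: "g \<in> borel_measurable seqs"
    and g1: "integrable P g" and g0: "(\<integral>x. g x \<partial>P) = 0"
    and g2: "integrable P (\<lambda>x. (g x)\<^sup>2)" and e: "e > 0"
  shows "\<exists>w. window_fun w \<and> (\<integral>x. w x \<partial>P) = 0 \<and> (\<integral>x. (g x - w x :: real)\<^sup>2 \<partial>P) < e"
proof -
  interpret prob_space P by fact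
  note [measurable_cong] = sP
  obtain w where w: "window_fun w" "(\<integral>x. (g x - w x)\<^sup>2 \<partial>P) < e"
    using window_fun_approx[OF assms(1) sP g g2 e] by (elim exE conjE) (rule that)
  obtain Tw where [measurable]: "w \<in> borel_measurable seqs" and Tw: "\<And>x. \<bar>w x\<bar> \<le> Tw"
    using w(1) unfolding window_fun_def by auto
  have iw: "integrable P w" by (rule integrable_const_bound[of _ Tw]) (use Tw in auto)
  have iw2: "integrable P (\<lambda>x. (w x)\<^sup>2)" by (rule prob_space_integrable_square[OF assms(1) _ Tw]) measurable
  have i2: "integrable P (\<lambda>x. (g x - w x)\<^sup>2)"
  proof (rule Bochner_Integration.integrable_bound[of _ "\<lambda>x. 2 * (g x)\<^sup>2 + 2 * (w x)\<^sup>2"])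
    show "AE x in P. norm ((g x - w x)\<^sup>2) \<le> norm (2 * (g x)\<^sup>2 + 2 * (w x)\<^sup>2)"
      using square_add_le[of "g x" "- w x" for x] by (intro AE_I2) simp
  qed (use g2 iw2 in auto)
  define \<mu> where "\<mu> = (\<integral>x. w x \<partial>P)"
  have wf: "window_fun (\<lambda>x. w x - \<mu>)"
    by (rule window_fun_compose[OF w(1), where B=1 and D="\<bar>\<mu>\<bar>" and f="\<lambda>x. x - \<mu>"]) auto
  have "(\<integral>x. (g x - (w x - \<mu>))\<^sup>2 \<partial>P) = (\<integral>x. (g x - w x)\<^sup>2 + 2 * \<mu> * (g x - w x) + \<mu>\<^sup>2 \<partial>P)"
    by (intro Bochner_Integration.integral_cong) (auto simp: power2_eq_square algebra_simps)
  also have "\<dots> = (\<integral>x. (g x - w x)\<^sup>2 \<partial>P) - \<mu>\<^sup>2"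
    using i2 g1 iw g0 by (simp add: prob_space \<mu>_def power2_eq_square)
  also have "\<dots> < e" using w(2) by (smt (verit) zero_le_power2)
  finally have "(\<integral>x. (g x - (w x - \<mu>))\<^sup>2 \<partial>P) < e" .
  moreover have "(\<integral>x. w x - \<mu> \<partial>P) = 0" using iw by (simp add: \<mu>_def prob_space)
  ultimately show ?thesis using wf by (intro exI[of _ "\<lambda>x. w x - \<mu>"] conjI)
qed

subsection \<open>Resolvents and rank-one perturbations\<close>

definition cmat :: "nat \<Rightarrow> (nat \<Rightarrow> nat \<Rightarrow> real) \<Rightarrow> complex mat" where
  "cmat N H = mat N N (\<lambda>(a, b). complex_of_real (H a b))"

text \<open>Entries instead of a matrix, so that the later algebra consists of finite sums.
  \<open>the\<close> is harmless for symmetric \<open>H\<close> and \<open>Im z > 0\<close>, where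
  the inverse exists by \<open>det_cmat_shift\<close>.\<close>

definition resolvent :: "nat \<Rightarrow> (nat \<Rightarrow> nat \<Rightarrow> real) \<Rightarrow> complex \<Rightarrow> nat \<Rightarrow> nat \<Rightarrow> complex" where
  "resolvent N H z i j = the (mat_inverse (cmat N H - z \<cdot>\<^sub>m 1\<^sub>m N)) $$ (i, j)"

definition symmetric_on :: "nat \<Rightarrow> (nat \<Rightarrow> nat \<Rightarrow> real) \<Rightarrow> bool" where
  "symmetric_on N H \<longleftrightarrow> (\<forall>i<N. \<forall>j<N. H i j = H j i)"

definition herm_form :: "nat \<Rightarrow> (nat \<Rightarrow> nat \<Rightarrow> real) \<Rightarrow> (nat \<Rightarrow> complex) \<Rightarrow> complex" where
  "herm_form N H x = (\<Sum>i<N. \<Sum>k<N. cnj (x i) * of_real (H i k) * x k)"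

text \<open>Tested on complex vectors, because the vector that matters is the complex image
  \<open>w\<close> of a real column under the resolvent in \<open>rank_one_update\<close>.\<close>

definition psd_on :: "nat \<Rightarrow> (nat \<Rightarrow> nat \<Rightarrow> real) \<Rightarrow> bool" where
  "psd_on N H \<longleftrightarrow> (\<forall>x. 0 \<le> Re (herm_form N H x))"

lemma stieltjes_cmat: "stieltjes (cmat N H) z = (\<Sum>i<N. resolvent N H z i i) / of_nat N"
  by (simp add: stieltjes_def resolvent_def cmat_def)

lemma cnj_mult_self: "cnj w * w = of_real ((cmod w)\<^sup>2)"
  unfolding complex_norm_square by (rule mult.commute)

lemma Im_le_cmod: "Im w \<le> cmod w"
  using abs_Im_le_cmod[of w] by linarith

lemma Im_herm_form:
  assumes "symmetric_on N H" shows "Im (herm_form N H x) = 0"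
proof -
  have "cnj (herm_form N H x) = (\<Sum>i<N. \<Sum>k<N. x i * of_real (H i k) * cnj (x k))"
    by (simp add: herm_form_def)
  also have "\<dots> = (\<Sum>k<N. \<Sum>i<N. x i * of_real (H i k) * cnj (x k))" by (rule sum.swap)
  also have "\<dots> = herm_form N H x" unfolding herm_form_def
    using assms by (intro sum.cong refl) (auto simp: symmetric_on_def)
  finally show ?thesis by (simp add: complex_eq_iff)
qed

text \<open>The pairing of \<open>x\<close> with \<open>(H - z) x\<close>. For symmetric
  \<open>H\<close> its imaginary part is free of \<open>H\<close>, which bounds the resolvent;
  applied to the image of a column it also controls \<open>1 + b\<close> in
  \<open>rank_one_update\<close>.\<close>

lemma energy_identity:
  assumes "\<And>i. i < N \<Longrightarrow> y i = (\<Sum>k<N. of_real (H i k) * x k) - z * x i"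
  shows "(\<Sum>i<N. cnj (x i) * y i) = herm_form N H x - z * of_real (\<Sum>i<N. (cmod (x i))\<^sup>2)"
proof -
  have "(\<Sum>i<N. cnj (x i) * y i) = (\<Sum>i<N. cnj (x i) * (\<Sum>k<N. of_real (H i k) * x k) - z * (cnj (x i) * x i))"
    by (intro sum.cong refl) (simp add: assms algebra_simps)
  also have "\<dots> = herm_form N H x - z * of_real (\<Sum>i<N. (cmod (x i))\<^sup>2)"
    by (simp add: sum_subtractf herm_form_def sum_distrib_left mult.assoc cnj_mult_self)
  finally show ?thesis .
qed

text \<open>The imaginary part of the energy identity bounds \<open>Im z * X\<close> by the modulus
  of the pairing, and Cauchy-Schwarz bounds the latter. Squaring avoids roots; then a factor
  \<open>X\<close> is cancelled.\<close>

lemma resolvent_norm_bound: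
  assumes sym: "symmetric_on N H" and z: "Im z > 0"
    and y: "\<And>i. i < N \<Longrightarrow> y i = (\<Sum>k<N. of_real (H i k) * x k) - z * x i"
  shows "(Im z)\<^sup>2 * (\<Sum>i<N. (cmod (x i))\<^sup>2) \<le> (\<Sum>i<N. (cmod (y i))\<^sup>2)"
proof -
  define X where "X = (\<Sum>i<N. (cmod (x i))\<^sup>2)"
  define Y where "Y = (\<Sum>i<N. (cmod (y i))\<^sup>2)"
  have X0: "X \<ge> 0" "Y \<ge> 0" by (simp_all add: X_def Y_def sum_nonneg)
  have "Im (\<Sum>i<N. cnj (x i) * y i) = - Im z * X"
  proof -
    have "Im (\<Sum>i<N. cnj (x i) * y i) = Im (herm_form N H x - z * of_real X)"
      by (simp only: energy_identity[OF y] X_def)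
    also have "\<dots> = - Im z * X" by (simp add: Im_herm_form[OF sym])
    finally show ?thesis .
  qed
  then have "Im z * X \<le> cmod (\<Sum>i<N. cnj (x i) * y i)"
    using abs_Im_le_cmod[of "\<Sum>i<N. cnj (x i) * y i"] by linarith
  also have "\<dots> \<le> (\<Sum>i<N. cmod (x i) * cmod (y i))"
    by (rule order_trans[OF norm_sum]) (simp add: norm_mult)
  finally have "(Im z * X)\<^sup>2 \<le> (\<Sum>i<N. cmod (x i) * cmod (y i))\<^sup>2"
    using z X0 by (intro power_mono) auto
  also have "\<dots> \<le> X * Y" unfolding X_def Y_def by (rule Cauchy_Schwarz_ineq_sum)
  finally have *: "X * ((Im z)\<^sup>2 * X) \<le> X * Y" by (simp add: power2_eq_square mult_ac)
  show ?thesis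
  proof (cases "X = 0")
    case True then show ?thesis using X0 by (simp add: X_def Y_def)
  next
    case False then show ?thesis using * X0 by (simp add: X_def Y_def)
  qed
qed

lemma resolvent_kernel:
  assumes sym: "symmetric_on N H" and z: "Im z > 0"
    and y: "\<And>i. i < N \<Longrightarrow> (\<Sum>k<N. of_real (H i k) * x k) - z * x i = 0" and i: "i < N"
  shows "x i = 0"
proof -
  have "(Im z)\<^sup>2 * (\<Sum>i<N. (cmod (x i))\<^sup>2) \<le> (\<Sum>i<N. (cmod ((\<lambda>_. 0) i))\<^sup>2)"
    by (rule resolvent_norm_bound[OF sym z]) (simp add: y)
  then have "(\<Sum>i<N. (cmod (x i))\<^sup>2) \<le> 0" using z by (simp add: mult_le_0_iff)
  then have "(\<Sum>i<N. (cmod (x i))\<^sup>2) = 0" by (intro antisym sum_nonneg) auto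
  then show ?thesis using i by (simp add: sum_nonneg_eq_0_iff)
qed

lemma cmat_shift_index:
  assumes "i < N" "j < N"
  shows "(cmat N H - z \<cdot>\<^sub>m 1\<^sub>m N) $$ (i, j) = of_real (H i j) - z * of_bool (i = j)"
  using assms by (simp add: cmat_def)

lemma cmat_shift_carrier: "cmat N H - z \<cdot>\<^sub>m 1\<^sub>m N \<in> carrier_mat N N"
  unfolding cmat_def by auto

lemma sum_delta_mult:
  fixes N :: nat
  assumes "i < N"
  shows "(\<Sum>k<N. (f k - z * of_bool (i = k)) * x k) = (\<Sum>k<N. f k * x k) - z * (x i :: complex)"
proof -
  have "(\<Sum>k<N. (f k - z * of_bool (i = k)) * x k) = (\<Sum>k<N. f k * x k - (if i = k then z * x k else 0))"
    by (intro sum.cong) (auto simp: left_diff_distrib)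
  also have "\<dots> = (\<Sum>k<N. f k * x k) - z * x i" unfolding sum_subtractf by (subst sum.delta') (use assms in auto)
  finally show ?thesis .
qed

lemma sum_of_bool_mult:
  fixes N :: nat
  assumes "i < N"
  shows "(\<Sum>l<N. of_bool (i = l) * y l) = (y i :: complex)" "(\<Sum>l<N. y l * of_bool (l = i)) = (y i :: complex)"
    "(\<Sum>l<N. of_bool (l = i)) = (1 :: real)"
proof -
  have "(\<Sum>l<N. of_bool (i = l) * y l) = (\<Sum>l<N. if i = l then y l else 0)" by (intro sum.cong) auto
  also have "\<dots> = y i" by (subst sum.delta') (use assms in auto)
  finally show "(\<Sum>l<N. of_bool (i = l) * y l) = y i" .
  have "(\<Sum>l<N. y l * of_bool (l = i)) = (\<Sum>l<N. if l = i then y l else 0)" by (intro sum.cong) auto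
  also have "\<dots> = y i" by (subst sum.delta) (use assms in auto)
  finally show "(\<Sum>l<N. y l * of_bool (l = i)) = y i" .
  have "(\<Sum>l<N. of_bool (l = i)) = (\<Sum>l<N. if l = i then 1 else (0::real))" by (intro sum.cong) auto
  also have "\<dots> = 1" by (subst sum.delta) (use assms in auto)
  finally show "(\<Sum>l<N. of_bool (l = i)) = (1 :: real)" .
qed

lemma mult_mat_vec_entry:
  assumes "A \<in> carrier_mat n m" "v \<in> carrier_vec m" "i < n"
  shows "(A *\<^sub>v v) $ i = (\<Sum>k<m. A $$ (i, k) * v $ k)"
  using assms by (simp add: scalar_prod_def lessThan_atLeast0)

lemma mult_mat_entry:
  assumes "A \<in> carrier_mat n m" "B \<in> carrier_mat m l" "i < n" "j < l"
  shows "(A * B) $$ (i, j) = (\<Sum>k<m. A $$ (i, k) * B $$ (k, j))"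
  using assms by (simp add: scalar_prod_def lessThan_atLeast0)

lemma det_cmat_shift:
  assumes sym: "symmetric_on N H" and z: "Im z > 0"
  shows "Determinant.det (cmat N H - z \<cdot>\<^sub>m 1\<^sub>m N) \<noteq> 0"
proof
  let ?A = "cmat N H - z \<cdot>\<^sub>m 1\<^sub>m N"
  assume d0: "Determinant.det ?A = 0"
  from iffD1[OF det_0_iff_vec_prod_zero_field[OF cmat_shift_carrier] d0]
  obtain v where v: "v \<in> carrier_vec N" "v \<noteq> 0\<^sub>v N" "?A *\<^sub>v v = 0\<^sub>v N"
    by (elim exE conjE) (rule that)
  have dv: "dim_vec v = N" using v by simp
  have ker: "(\<Sum>k<N. of_real (H i k) * v $ k) - z * v $ i = 0" if i: "i < N" for i
  proof -
    have "(?A *\<^sub>v v) $ i = (\<Sum>k<N. ?A $$ (i, k) * v $ k)"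
      by (rule mult_mat_vec_entry[OF cmat_shift_carrier v(1) i])
    also have "\<dots> = (\<Sum>k<N. (of_real (H i k) - z * of_bool (i = k)) * v $ k)"
      using i by (intro sum.cong refl) (simp only: cmat_shift_index lessThan_iff)
    also have "\<dots> = (\<Sum>k<N. of_real (H i k) * v $ k) - z * v $ i" by (rule sum_delta_mult[OF i])
    finally have e: "(?A *\<^sub>v v) $ i = (\<Sum>k<N. of_real (H i k) * v $ k) - z * v $ i" .
    have "(?A *\<^sub>v v) $ i = 0" unfolding v(3) using i by simp
    from trans[OF e[symmetric] this] show ?thesis .
  qed
  have "v $ i = 0" if "i < N" for i by (rule resolvent_kernel[OF sym z ker that])
  then have "v = 0\<^sub>v N" using dv by (intro eq_vecI) auto
  with v(2) show False by simp
qed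

text \<open>The second form serves measurability: cofactors and determinants are polynomials in the
  entries.\<close>

lemma resolvent_inverse:
  assumes sym: "symmetric_on N H" and z: "Im z > 0" and ij: "i < N" "j < N"
  shows "(\<Sum>k<N. of_real (H i k) * resolvent N H z k j) - z * resolvent N H z i j = of_bool (i = j)"
    and "resolvent N H z i j = cofactor (cmat N H - z \<cdot>\<^sub>m 1\<^sub>m N) j i / Determinant.det (cmat N H - z \<cdot>\<^sub>m 1\<^sub>m N)"
proof -
  let ?A = "cmat N H - z \<cdot>\<^sub>m 1\<^sub>m N"
  have A: "?A \<in> carrier_mat N N" by (rule cmat_shift_carrier)
  have "?A \<in> Units (ring_mat TYPE(complex) N ())"
    by (rule det_non_zero_imp_unit[OF A det_cmat_shift[OF sym z]])
  then obtain B where B: "mat_inverse ?A = Some B" using mat_inverse(1)[OF A] by fastforce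
  then have AB: "?A * B = 1\<^sub>m N" "B * ?A = 1\<^sub>m N" and Bc: "B \<in> carrier_mat N N"
    using mat_inverse(2)[OF A] by auto
  have RB: "resolvent N H z i j = B $$ (i, j)" for i j by (simp add: resolvent_def B)
  have "(?A * B) $$ (i, j) = (\<Sum>k<N. ?A $$ (i, k) * B $$ (k, j))"
    by (rule mult_mat_entry[OF A Bc ij])
  also have "\<dots> = (\<Sum>k<N. (of_real (H i k) - z * of_bool (i = k)) * resolvent N H z k j)"
    using ij by (intro sum.cong refl) (simp only: cmat_shift_index lessThan_iff RB)
  also have "\<dots> = (\<Sum>k<N. of_real (H i k) * resolvent N H z k j) - z * resolvent N H z i j"
    by (rule sum_delta_mult[OF ij(1)])
  finally have e: "(?A * B) $$ (i, j) = (\<Sum>k<N. of_real (H i k) * resolvent N H z k j) - z * resolvent N H z i j" .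
  have "(?A * B) $$ (i, j) = of_bool (i = j)" unfolding AB(1) using ij by simp
  from trans[OF e[symmetric] this]
  show "(\<Sum>k<N. of_real (H i k) * resolvent N H z k j) - z * resolvent N H z i j = of_bool (i = j)" .
  have "adj_mat ?A = adj_mat ?A * (?A * B)" using AB adj_mat(1)[OF A] by simp
  also have "\<dots> = (adj_mat ?A * ?A) * B" using adj_mat(1)[OF A] A Bc by (metis assoc_mult_mat)
  also have "\<dots> = Determinant.det ?A \<cdot>\<^sub>m B" unfolding adj_mat(3)[OF A] mult_smult_assoc_mat[OF one_carrier_mat Bc] using Bc by simp
  finally have "adj_mat ?A $$ (i, j) = Determinant.det ?A * B $$ (i, j)" using Bc ij by simp
  moreover have "adj_mat ?A $$ (i, j) = cofactor ?A j i" unfolding adj_mat_def using ij A by auto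
  ultimately show "resolvent N H z i j = cofactor ?A j i / Determinant.det ?A"
    using det_cmat_shift[OF sym z] by (simp add: RB field_simps)
qed

text \<open>Reduces a formula for the resolvent to plugging a candidate column into the linear
  system.\<close>

lemma resolvent_unique:
  assumes sym: "symmetric_on N H" and z: "Im z > 0" and j: "j < N"
    and x: "\<And>i. i < N \<Longrightarrow> (\<Sum>k<N. of_real (H i k) * x k) - z * x i = of_bool (i = j)" and i: "i < N"
  shows "resolvent N H z i j = x i"
proof -
  have "resolvent N H z i j - x i = 0"
  proof (rule resolvent_kernel[OF sym z _ i, of "\<lambda>i. resolvent N H z i j - x i"])
    fix i assume i: "i < N"
    have "(\<Sum>k<N. of_real (H i k) * (resolvent N H z k j - x k)) - z * (resolvent N H z i j - x i)
      = ((\<Sum>k<N. of_real (H i k) * resolvent N H z k j) - z * resolvent N H z i j) - ((\<Sum>k<N. of_real (H i k) * x k) - z * x i)"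
      by (simp add: algebra_simps sum_subtractf)
    then show "(\<Sum>k<N. of_real (H i k) * (resolvent N H z k j - x k)) - z * (resolvent N H z i j - x i) = 0"
      using resolvent_inverse(1)[OF sym z i j] x[OF i] by simp
  qed
  then show ?thesis by simp
qed

lemma resolvent_apply:
  assumes sym: "symmetric_on N H" and z: "Im z > 0" and i: "i < N"
  shows "(\<Sum>k<N. of_real (H i k) * (\<Sum>l<N. resolvent N H z k l * y l)) - z * (\<Sum>l<N. resolvent N H z i l * y l) = y i"
proof -
  have "(\<Sum>k<N. of_real (H i k) * (\<Sum>l<N. resolvent N H z k l * y l)) = (\<Sum>k<N. \<Sum>l<N. of_real (H i k) * resolvent N H z k l * y l)"
    by (simp add: sum_distrib_left mult.assoc)
  also have "\<dots> = (\<Sum>l<N. \<Sum>k<N. of_real (H i k) * resolvent N H z k l * y l)" by (rule sum.swap)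
  finally have "(\<Sum>k<N. of_real (H i k) * (\<Sum>l<N. resolvent N H z k l * y l)) - z * (\<Sum>l<N. resolvent N H z i l * y l)
     = (\<Sum>l<N. ((\<Sum>k<N. of_real (H i k) * resolvent N H z k l) - z * resolvent N H z i l) * y l)"
    by (simp add: sum_subtractf sum_distrib_left sum_distrib_right left_diff_distrib mult.assoc)
  also have "\<dots> = (\<Sum>l<N. of_bool (i = l) * y l)"
    by (intro sum.cong refl) (simp add: resolvent_inverse(1)[OF sym z i])
  also have "\<dots> = y i" by (rule sum_of_bool_mult(1)[OF i])
  finally show ?thesis .
qed

lemma resolvent_apply_bound:
  assumes sym: "symmetric_on N H" and z: "Im z > 0"
  shows "(\<Sum>i<N. (cmod (\<Sum>l<N. resolvent N H z i l * y l))\<^sup>2) \<le> (\<Sum>i<N. (cmod (y i))\<^sup>2) / (Im z)\<^sup>2"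
proof -
  have "(Im z)\<^sup>2 * (\<Sum>i<N. (cmod (\<Sum>l<N. resolvent N H z i l * y l))\<^sup>2) \<le> (\<Sum>i<N. (cmod (y i))\<^sup>2)"
    by (rule resolvent_norm_bound[OF sym z]) (rule resolvent_apply[OF sym z, symmetric])
  then show ?thesis using z by (simp add: pos_le_divide_eq mult.commute)
qed

lemma resolvent_symmetric:
  assumes sym: "symmetric_on N H" and z: "Im z > 0" and ij: "i < N" "j < N"
  shows "resolvent N H z i j = resolvent N H z j i"
proof -
  let ?R = "resolvent N H z"
  \<comment> \<open>Evaluate \<open>R\<^sub>i\<^sup>T (H - z) R\<^sub>j\<close>, which is symmetric in \<open>i, j\<close>, in two ways.\<close>
  have "(\<Sum>k<N. ?R k i * ((\<Sum>l<N. of_real (H k l) * ?R l j) - z * ?R k j)) = ?R j i"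
    if "i < N" "j < N" for i j
  proof -
    have "(\<Sum>k<N. ?R k i * ((\<Sum>l<N. of_real (H k l) * ?R l j) - z * ?R k j)) = (\<Sum>k<N. ?R k i * of_bool (k = j))"
      by (intro sum.cong refl) (simp add: resolvent_inverse(1)[OF sym z _ that(2)])
    also have "\<dots> = ?R j i" by (rule sum_of_bool_mult(2)[OF that(2)])
    finally show ?thesis .
  qed
  note 1 = this
  have "(\<Sum>k<N. ?R k i * ((\<Sum>l<N. of_real (H k l) * ?R l j) - z * ?R k j))
     = (\<Sum>k<N. \<Sum>l<N. ?R k i * of_real (H k l) * ?R l j) - z * (\<Sum>k<N. ?R k i * ?R k j)" for i j
    by (simp add: right_diff_distrib sum_subtractf sum_distrib_left mult_ac)
  note 2 = this
  have "(\<Sum>k<N. \<Sum>l<N. ?R k i * of_real (H k l) * ?R l j) = (\<Sum>l<N. \<Sum>k<N. ?R k i * of_real (H k l) * ?R l j)"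
    by (rule sum.swap)
  also have "\<dots> = (\<Sum>k<N. \<Sum>l<N. ?R k j * of_real (H k l) * ?R l i)"
    using sym by (intro sum.cong refl) (auto simp: symmetric_on_def)
  finally show ?thesis using 1[OF ij] 1[OF ij(2,1)] 2[of i j] 2[of j i] by (simp add: mult.commute)
qed

lemma resolvent_diag_bound:
  assumes sym: "symmetric_on N H" and z: "Im z > 0" and i: "i < N"
  shows "cmod (resolvent N H z i i) \<le> 1 / Im z"
proof -
  let ?y = "\<lambda>l. of_bool (l = i) :: complex"
  have e: "(\<Sum>l<N. resolvent N H z k l * ?y l) = resolvent N H z k i" for k
    by (rule sum_of_bool_mult(2)[OF i])
  have "(cmod (resolvent N H z i i))\<^sup>2 \<le> (\<Sum>k<N. (cmod (resolvent N H z k i))\<^sup>2)"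
    using i by (intro member_le_sum[of i "{..<N}" "\<lambda>k. (cmod (resolvent N H z k i))\<^sup>2"]) auto
  also have "\<dots> \<le> (\<Sum>k<N. (cmod (?y k))\<^sup>2) / (Im z)\<^sup>2"
    using resolvent_apply_bound[OF sym z, of ?y] unfolding e .
  also have "(\<Sum>k<N. (cmod (?y k))\<^sup>2) = (\<Sum>k<N. of_bool (k = i))"
    by (intro sum.cong) auto
  also have "\<dots> = 1" by (rule sum_of_bool_mult(3)[OF i])
  finally have "(cmod (resolvent N H z i i))\<^sup>2 \<le> (1 / Im z)\<^sup>2" by (simp add: power_divide)
  then show ?thesis by (rule power2_le_imp_le) (use z in auto)
qed

lemma stieltjes_bound:
  assumes sym: "symmetric_on N H" and z: "Im z > 0"
  shows "cmod (stieltjes (cmat N H) z) \<le> 1 / Im z"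
proof (cases "N = 0")
  case True then show ?thesis using z by (simp add: stieltjes_cmat)
next
  case False
  have "cmod (\<Sum>i<N. resolvent N H z i i) \<le> (\<Sum>i<N. 1 / Im z)"
    by (rule order_trans[OF norm_sum]) (intro sum_mono, use resolvent_diag_bound[OF sym z] in auto)
  then have "cmod (\<Sum>i<N. resolvent N H z i i) / N \<le> 1 / Im z"
    using False by (simp add: pos_divide_le_eq mult.commute)
  then show ?thesis by (simp add: stieltjes_cmat norm_divide)
qed

text \<open>The two lower bounds on \<open>|1 + b|\<close> come from \<open>Im (z (1 + b)) \<ge> Im z\<close> and from \<open>Im b = Im z |w|\<^sup>2 / r\<close>.\<close>

lemma rank_one_update:
  fixes p :: "nat \<Rightarrow> real" and r :: real
  assumes sym: "symmetric_on N H" and psd: "psd_on N H" and z: "Im z > 0" and r: "r > 0"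
  defines "w \<equiv> \<lambda>i. \<Sum>k<N. resolvent N H z i k * of_real (p k)"
  defines "b \<equiv> (\<Sum>i<N. of_real (p i) * w i) / of_real r" and "a \<equiv> (\<Sum>i<N. (w i)\<^sup>2) / of_real r"
  shows "Im z / cmod z \<le> cmod (1 + b)" "cmod a \<le> cmod (1 + b) / Im z"
    "(\<Sum>i<N. resolvent N (\<lambda>i k. H i k + p i * p k / r) z i i) = (\<Sum>i<N. resolvent N H z i i) - a / (1 + b)"
proof -
  define W where "W = (\<Sum>i<N. (cmod (w i))\<^sup>2)"
  define q where "q = Re (herm_form N H w)"
  have hq: "herm_form N H w = of_real q"
    using Im_herm_form[OF sym, of w] by (simp add: q_def complex_eq_iff)
  have q0: "q \<ge> 0" using psd by (simp add: psd_on_def q_def)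
  have zc: "cmod z > 0" using z Im_le_cmod[of z] by linarith
  have ap: "(\<Sum>k<N. of_real (H i k) * w k) - z * w i = of_real (p i)" if "i < N" for i
    unfolding w_def by (rule resolvent_apply[OF sym z that])
  have "(\<Sum>i<N. cnj (w i) * of_real (p i)) = of_real q - z * of_real W"
    unfolding hq[symmetric] W_def by (rule energy_identity) (simp add: ap)
  then have "cnj (\<Sum>i<N. cnj (w i) * of_real (p i)) = of_real q - cnj z * of_real W" by simp
  \<comment> \<open>\<open>p\<close> is real, so \<open>r * b\<close> is the conjugate of the
    pairing of \<open>w\<close> with \<open>p\<close>; hence \<open>cnj z\<close> in place of
    \<open>z\<close>.\<close>
  then have rb: "of_real r * b = of_real q - cnj z * of_real W"
    using r by (simp add: b_def mult.commute)
  have "Im (of_real r * (z * (1 + b))) = r * Im z + Im (z * (of_real r * b))"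
    by (simp add: algebra_simps)
  also have "Im (z * (of_real r * b)) = Im z * q"
    unfolding rb by (simp add: algebra_simps)
  finally have "r * Im (z * (1 + b)) = r * Im z + Im z * q" by simp
  then have "r * Im (z * (1 + b)) \<ge> r * Im z" using z q0 by simp
  then have "Im z \<le> Im (z * (1 + b))" using r by simp
  also have "\<dots> \<le> cmod z * cmod (1 + b)" using Im_le_cmod[of "z * (1 + b)"] by (simp only: norm_mult)
  finally show b1: "Im z / cmod z \<le> cmod (1 + b)"
    using zc by (simp add: pos_divide_le_eq mult.commute)
  have "Im (of_real r * b) = Im z * W" unfolding rb by simp
  then have "r * Im (1 + b) = Im z * W" by simp
  moreover have "Im (1 + b) \<le> cmod (1 + b)" by (rule Im_le_cmod)
  ultimately have 1: "Im z * W \<le> r * cmod (1 + b)" using r by (metis mult_left_mono less_imp_le)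
  have "cmod (\<Sum>i<N. (w i)\<^sup>2) \<le> W" unfolding W_def
    by (rule order_trans[OF norm_sum]) (simp add: norm_power)
  then have "cmod a \<le> W / r" using r by (simp add: a_def norm_divide divide_right_mono)
  also have "\<dots> \<le> cmod (1 + b) / Im z" using 1 r z by (simp add: divide_simps mult_ac)
  finally show "cmod a \<le> cmod (1 + b) / Im z" .
  have nz: "1 + b \<noteq> 0"
  proof
    assume "1 + b = 0"
    then have "Im z / cmod z \<le> 0" using b1 by simp
    then show False using z zc by (simp add: divide_le_0_iff)
  qed
  have sym': "symmetric_on N (\<lambda>i k. H i k + p i * p k / r)" using sym by (simp add: symmetric_on_def mult.commute)
  \<comment> \<open>The Sherman-Morrison formula, verified column by column through
    \<open>resolvent_unique\<close>.\<close>
  have upd: "resolvent N (\<lambda>i k. H i k + p i * p k / r) z i j = resolvent N H z i j - w i * w j / (of_real r * (1 + b))"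
    if i: "i < N" and j: "j < N" for i j
  proof (rule resolvent_unique[OF sym' z j _ i])
    fix i assume i: "i < N"
    let ?R = "resolvent N H z" let ?d = "of_real r * (1 + b)"
    have pR: "(\<Sum>k<N. of_real (p k) * ?R k j) = w j"
      unfolding w_def using j by (intro sum.cong refl) (simp add: resolvent_symmetric[OF sym z, of _ j] mult.commute)
    have pw: "(\<Sum>k<N. of_real (p k) * w k) = of_real r * b" using r by (simp add: b_def)
    define c where "c = w j / ?d"
    have rz: "complex_of_real r \<noteq> 0" using r by simp
    have c1: "c * (1 + b) = w j / of_real r" using nz rz by (simp add: c_def)
    have wc: "w k * w j / ?d = w k * c" for k by (simp add: c_def)
    have "of_real (H i k + p i * p k / r) * (?R k j - w k * c)
       = of_real (H i k) * ?R k j - of_real (H i k) * w k * c + of_real (p i) / of_real r * (of_real (p k) * ?R k j)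
         - of_real (p i) / of_real r * (of_real (p k) * w k) * c" for k
      by (simp add: algebra_simps)
    then have "(\<Sum>k<N. of_real (H i k + p i * p k / r) * (?R k j - w k * c))
       = (\<Sum>k<N. of_real (H i k) * ?R k j) - (\<Sum>k<N. of_real (H i k) * w k) * c
         + of_real (p i) / of_real r * (\<Sum>k<N. of_real (p k) * ?R k j)
         - of_real (p i) / of_real r * (\<Sum>k<N. of_real (p k) * w k) * c"
      by (simp only: sum.distrib sum_subtractf sum_distrib_left[symmetric] sum_distrib_right[symmetric])
    then have "(\<Sum>k<N. of_real (H i k + p i * p k / r) * (?R k j - w k * c)) - z * (?R i j - w i * c)
       = ((\<Sum>k<N. of_real (H i k) * ?R k j) - z * ?R i j) - ((\<Sum>k<N. of_real (H i k) * w k) - z * w i) * c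
         + of_real (p i) / of_real r * (\<Sum>k<N. of_real (p k) * ?R k j)
         - of_real (p i) / of_real r * (\<Sum>k<N. of_real (p k) * w k) * c"
      by (simp only: right_diff_distrib left_diff_distrib mult.assoc) simp
    also have "\<dots> = of_bool (i = j) - of_real (p i) * c + of_real (p i) / of_real r * w j - of_real (p i) / of_real r * (of_real r * b) * c"
      unfolding pR pw resolvent_inverse(1)[OF sym z i j] ap[OF i] ..
    also have "\<dots> = of_bool (i = j) - of_real (p i) * (c * (1 + b)) + of_real (p i) * (w j / of_real r)"
      using rz by (simp add: algebra_simps)
    also have "\<dots> = of_bool (i = j)" unfolding c1 by simp
    finally have "(\<Sum>k<N. of_real (H i k + p i * p k / r) * (?R k j - w k * c)) - z * (?R i j - w i * c) = of_bool (i = j)" .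
    then show "(\<Sum>k<N. of_real (H i k + p i * p k / r) * (?R k j - w k * w j / ?d)) - z * (?R i j - w i * w j / ?d) = of_bool (i = j)"
      unfolding wc .
  qed
  have "(\<Sum>i<N. resolvent N (\<lambda>i k. H i k + p i * p k / r) z i i) = (\<Sum>i<N. resolvent N H z i i - (w i)\<^sup>2 / (of_real r * (1 + b)))"
    by (intro sum.cong refl) (simp add: upd power2_eq_square)
  also have "\<dots> = (\<Sum>i<N. resolvent N H z i i) - a / (1 + b)"
    by (simp add: sum_subtractf sum_divide_distrib[symmetric] a_def)
  finally show "(\<Sum>i<N. resolvent N (\<lambda>i k. H i k + p i * p k / r) z i i) = (\<Sum>i<N. resolvent N H z i i) - a / (1 + b)" .
qed

text \<open>The difference equals \<open>(a - a') / (1 + b)\<close> plus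
  \<open>a' / (1 + b')\<close> times \<open>(b' - b) / (1 + b)\<close>. Only the quotient with
  primes is left as a factor, which is why the bound by \<open>1 / v\<close> is asked of
  \<open>a'\<close> alone.\<close>

lemma fraction_lipschitz:
  fixes a b a' b' :: complex
  assumes m: "m > 0" "m \<le> cmod (1 + b)" "m \<le> cmod (1 + b')" and a': "cmod a' \<le> cmod (1 + b') / v" and v: "v > 0"
  shows "cmod (a / (1 + b) - a' / (1 + b')) \<le> (cmod (a - a') + cmod (b - b') / v) / m"
proof -
  have nz: "1 + b \<noteq> 0" "1 + b' \<noteq> 0" using m by auto
  have gen: "x / c - y / d = (x - y) / c + (y / d) * ((d - c) / c)" if "c \<noteq> 0" "d \<noteq> 0" for x y c d :: complex
    using that by (simp add: field_simps)
  have cp: "cmod (1 + b) * m > 0" "0 < m * cmod (1 + b)" using m by (auto intro!: mult_pos_pos)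
  have "a / (1 + b) - a' / (1 + b') = (a - a') / (1 + b) + (a' / (1 + b')) * ((b' - b) / (1 + b))"
    using gen[OF nz, of a a'] by simp
  then have "cmod (a / (1 + b) - a' / (1 + b')) \<le> cmod ((a - a') / (1 + b)) + cmod (a' / (1 + b')) * cmod ((b' - b) / (1 + b))"
    by (metis norm_mult norm_triangle_ineq)
  also have "cmod ((a - a') / (1 + b)) \<le> cmod (a - a') / m"
    unfolding norm_divide using m cp by (intro divide_left_mono) auto
  also have "cmod (a' / (1 + b')) * cmod ((b' - b) / (1 + b)) \<le> (1 / v) * (cmod (b - b') / m)"
  proof (rule mult_mono)
    show "cmod (a' / (1 + b')) \<le> 1 / v" using a' nz v unfolding norm_divide by (simp add: divide_simps mult.commute)
    show "cmod ((b' - b) / (1 + b)) \<le> cmod (b - b') / m"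
      unfolding norm_divide norm_minus_commute[of b'] using m cp by (intro divide_left_mono) auto
  qed (use v in auto)
  finally show ?thesis by (simp add: add_divide_distrib mult.commute)
qed

section \<open>Quadratic forms in the resolvent and the exchange of one column\<close>

definition quad_form :: "nat \<Rightarrow> (nat \<Rightarrow> nat \<Rightarrow> real) \<Rightarrow> (nat \<Rightarrow> real) \<Rightarrow> real" where
  "quad_form N A p = (\<Sum>i<N. \<Sum>k<N. p i * A i k * p k)"

text \<open>Stated with squares so that no roots occur. The two halves bound the action on columns
  and on rows; both are used, and the notion is invariant under transposition.\<close>

definition op_bound :: "nat \<Rightarrow> real \<Rightarrow> (nat \<Rightarrow> nat \<Rightarrow> real) \<Rightarrow> bool" where
  "op_bound N K A \<longleftrightarrow> (\<forall>w. (\<Sum>i<N. (\<Sum>j<N. A i j * w j)\<^sup>2) \<le> K\<^sup>2 * (\<Sum>j<N. (w j)\<^sup>2) \<and>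
     (\<Sum>j<N. (\<Sum>i<N. A i j * w i)\<^sup>2) \<le> K\<^sup>2 * (\<Sum>i<N. (w i)\<^sup>2))"

text \<open>The real and imaginary parts of the resolvent (\<open>t = 0, 1\<close>) and of its square (\<open>t \<ge> 2\<close>).\<close>

definition res_part :: "nat \<Rightarrow> (nat \<Rightarrow> nat \<Rightarrow> real) \<Rightarrow> complex \<Rightarrow> nat \<Rightarrow> nat \<Rightarrow> nat \<Rightarrow> real" where
  "res_part N H z t i k =
    (let R = resolvent N H z; R2 = (\<Sum>l<N. R i l * R l k)
     in if t = 0 then Re (R i k) else if t = 1 then Im (R i k) else if t = 2 then Re R2 else Im R2)"

lemma op_bound_symI:
  assumes "\<And>w. (\<Sum>i<N. (\<Sum>j<N. A i j * w j)\<^sup>2) \<le> K\<^sup>2 * (\<Sum>j<N. (w j)\<^sup>2)"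
    and "\<And>i j. i < N \<Longrightarrow> j < N \<Longrightarrow> A i j = A j i"
  shows "op_bound N K A"
proof -
  have "(\<Sum>j<N. (\<Sum>i<N. A i j * w i)\<^sup>2) = (\<Sum>i<N. (\<Sum>j<N. A i j * w j)\<^sup>2)" for w
    by (intro sum.cong refl arg_cong[where f="\<lambda>x. x\<^sup>2"]) (auto simp: assms(2))
  then show ?thesis using assms(1) unfolding op_bound_def by simp
qed

text \<open>The resolvent has norm at most \<open>1 / Im z\<close> and its square at most
  \<open>1 / (Im z)\<^sup>2\<close>; on real vectors the real and imaginary parts of a matrix
  produce the parts of the image. A single constant serves all \<open>t\<close>.\<close>

lemma op_bound_res_part:
  assumes sym: "symmetric_on N H" and z: "Im z > 0"
  shows "op_bound N (1 / Im z + 1 / (Im z)\<^sup>2) (res_part N H z t)"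
proof (rule op_bound_symI)
  let ?R = "resolvent N H z" let ?K = "1 / Im z + 1 / (Im z)\<^sup>2"
  fix w :: "nat \<Rightarrow> real"
  define x where "x i = (\<Sum>l<N. ?R i l * of_real (w l))" for i
  define y where "y i = (\<Sum>l<N. ?R i l * x l)" for i
  have "(\<Sum>i<N. (cmod (x i))\<^sup>2) \<le> (\<Sum>i<N. (cmod (of_real (w i)))\<^sup>2) / (Im z)\<^sup>2"
    unfolding x_def by (rule resolvent_apply_bound[OF sym z])
  then have x1: "(\<Sum>i<N. (cmod (x i))\<^sup>2) \<le> (1 / Im z)\<^sup>2 * (\<Sum>i<N. (w i)\<^sup>2)" by (simp add: power_divide)
  have "(\<Sum>i<N. (cmod (y i))\<^sup>2) \<le> (\<Sum>i<N. (cmod (x i))\<^sup>2) / (Im z)\<^sup>2"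
    unfolding y_def by (rule resolvent_apply_bound[OF sym z])
  also have "\<dots> \<le> ((1 / Im z)\<^sup>2 * (\<Sum>i<N. (w i)\<^sup>2)) / (Im z)\<^sup>2" using x1 by (rule divide_right_mono) simp
  finally have y1: "(\<Sum>i<N. (cmod (y i))\<^sup>2) \<le> (1 / (Im z)\<^sup>2)\<^sup>2 * (\<Sum>i<N. (w i)\<^sup>2)"
    by (simp add: power_divide power2_eq_square)
  have w0: "(\<Sum>i<N. (w i)\<^sup>2) \<ge> 0" by (simp add: sum_nonneg)
  have yR: "(\<Sum>k<N. (\<Sum>l<N. ?R i l * ?R l k) * of_real (w k)) = y i" for i
  proof -
    have "(\<Sum>k<N. (\<Sum>l<N. ?R i l * ?R l k) * of_real (w k)) = (\<Sum>k<N. \<Sum>l<N. ?R i l * (?R l k * of_real (w k)))"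
      by (simp add: sum_distrib_right mult.assoc)
    also have "\<dots> = (\<Sum>l<N. \<Sum>k<N. ?R i l * (?R l k * of_real (w k)))" by (rule sum.swap)
    also have "\<dots> = y i" by (simp add: y_def x_def sum_distrib_left)
    finally show ?thesis .
  qed
  have sq: "(Re u)\<^sup>2 \<le> (cmod u)\<^sup>2" "(Im u)\<^sup>2 \<le> (cmod u)\<^sup>2" for u by (simp_all add: cmod_power2)
  have Rr: "(\<Sum>j<N. Re (F j) * w j) = Re (\<Sum>j<N. F j * of_real (w j))" "(\<Sum>j<N. Im (F j) * w j) = Im (\<Sum>j<N. F j * of_real (w j))" for F
    by simp_all
  have p: "(\<Sum>j<N. Re (?R i j) * w j)\<^sup>2 \<le> (cmod (x i))\<^sup>2" "(\<Sum>j<N. Im (?R i j) * w j)\<^sup>2 \<le> (cmod (x i))\<^sup>2"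
    "(\<Sum>j<N. Re (\<Sum>l<N. ?R i l * ?R l j) * w j)\<^sup>2 \<le> (cmod (y i))\<^sup>2"
    "(\<Sum>j<N. Im (\<Sum>l<N. ?R i l * ?R l j) * w j)\<^sup>2 \<le> (cmod (y i))\<^sup>2" for i
    unfolding Rr yR x_def[symmetric] by (rule sq)+
  have "(\<Sum>j<N. res_part N H z t i j * w j)\<^sup>2 \<le> (cmod (x i))\<^sup>2 + (cmod (y i))\<^sup>2" for i
  proof -
    consider "t = 0" | "t = 1" | "t = 2" | "t \<noteq> 0" "t \<noteq> 1" "t \<noteq> 2" by blast
    then show ?thesis
    proof cases
      case 1
      then have "res_part N H z t i j = Re (?R i j)" for j by (simp add: res_part_def Let_def)
      then show ?thesis using p(1)[of i] by (simp add: add_increasing2)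
    next
      case 2
      then have "res_part N H z t i j = Im (?R i j)" for j by (simp add: res_part_def Let_def)
      then show ?thesis using p(2)[of i] by (simp add: add_increasing2)
    next
      case 3
      then have "res_part N H z t i j = Re (\<Sum>l<N. ?R i l * ?R l j)" for j by (simp add: res_part_def Let_def)
      then show ?thesis using p(3)[of i] by (simp only: add_increasing zero_le_power2)
    next
      case 4
      then have "res_part N H z t i j = Im (\<Sum>l<N. ?R i l * ?R l j)" for j by (simp add: res_part_def Let_def)
      then show ?thesis using p(4)[of i] by (simp only: add_increasing zero_le_power2)
    qed
  qed
  then have "(\<Sum>i<N. (\<Sum>j<N. res_part N H z t i j * w j)\<^sup>2) \<le> (\<Sum>i<N. (cmod (x i))\<^sup>2 + (cmod (y i))\<^sup>2)"
    by (intro sum_mono)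
  also have "\<dots> \<le> ((1 / Im z)\<^sup>2 + (1 / (Im z)\<^sup>2)\<^sup>2) * (\<Sum>j<N. (w j)\<^sup>2)"
    using x1 y1 by (simp add: sum.distrib distrib_right)
  also have "\<dots> \<le> ?K\<^sup>2 * (\<Sum>j<N. (w j)\<^sup>2)"
  proof (rule mult_right_mono[OF _ w0])
    have "0 \<le> 2 * (1 / Im z) * (1 / (Im z)\<^sup>2)" using z by simp
    then show "(1 / Im z)\<^sup>2 + (1 / (Im z)\<^sup>2)\<^sup>2 \<le> ?K\<^sup>2" unfolding power2_sum by linarith
  qed
  finally show "(\<Sum>i<N. (\<Sum>j<N. res_part N H z t i j * w j)\<^sup>2) \<le> ?K\<^sup>2 * (\<Sum>j<N. (w j)\<^sup>2)" .
next
  fix i j assume ij: "i < N" "j < N"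
  have "(\<Sum>l<N. resolvent N H z i l * resolvent N H z l j) = (\<Sum>l<N. resolvent N H z j l * resolvent N H z l i)"
    using ij by (intro sum.cong refl) (simp add: resolvent_symmetric[OF sym z, of _ j] resolvent_symmetric[OF sym z, of i] mult.commute)
  then show "res_part N H z t i j = res_part N H z t j i"
    unfolding res_part_def Let_def by (simp add: resolvent_symmetric[OF sym z ij])
qed

definition gram :: "nat \<Rightarrow> (nat \<Rightarrow> nat \<Rightarrow> real) \<Rightarrow> nat \<Rightarrow> nat \<Rightarrow> real" where
  "gram n u a b = (1 / real n) * (\<Sum>j<n. u j a * u j b)"

lemma symmetric_gram: "symmetric_on N (gram n u)"
  by (simp add: symmetric_on_def gram_def mult.commute)

text \<open>The form is \<open>1 / n\<close> times the sum, over the columns, of the squared modulus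
  of their product with \<open>x\<close>.\<close>

lemma psd_gram: "psd_on N (gram n u)"
  unfolding psd_on_def
proof
  fix x :: "nat \<Rightarrow> complex"
  define c where "c = complex_of_real (1 / real n)"
  define A where "A j i = cnj (x i) * of_real (u j i)" for j i
  define B where "B j k = of_real (u j k) * x k" for j k
  have t: "cnj (x i) * of_real (gram n u i k) * x k = (\<Sum>j<n. c * (A j i * B j k))" for i k
    unfolding gram_def of_real_mult of_real_sum sum_distrib_left sum_distrib_right A_def B_def c_def
    by (intro sum.cong refl) (simp only: mult_ac)
  have AB: "(\<Sum>i<N. A j i) = cnj (\<Sum>i<N. B j i)" for j
    by (simp add: A_def B_def mult.commute)
  have "herm_form N (gram n u) x = (\<Sum>i<N. \<Sum>k<N. \<Sum>j<n. c * (A j i * B j k))"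
    unfolding herm_form_def t ..
  also have "\<dots> = (\<Sum>i<N. \<Sum>j<n. \<Sum>k<N. c * (A j i * B j k))"
    by (intro sum.cong refl sum.swap)
  also have "\<dots> = (\<Sum>j<n. \<Sum>i<N. \<Sum>k<N. c * (A j i * B j k))"
    by (rule sum.swap)
  also have "\<dots> = (\<Sum>j<n. c * ((\<Sum>i<N. A j i) * (\<Sum>k<N. B j k)))"
  proof (intro sum.cong refl)
    fix j
    show "(\<Sum>i<N. \<Sum>k<N. c * (A j i * B j k)) = c * ((\<Sum>i<N. A j i) * (\<Sum>k<N. B j k))"
      by (subst sum_product) (simp only: sum_distrib_left)
  qed
  also have "\<dots> = of_real (\<Sum>j<n. (1 / real n) * (cmod (\<Sum>k<N. B j k))\<^sup>2)"
    unfolding AB cnj_mult_self c_def by (simp only: of_real_mult of_real_sum)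
  finally have "herm_form N (gram n u) x = of_real (\<Sum>j<n. (1 / real n) * (cmod (\<Sum>k<N. B j k))\<^sup>2)" .
  then have "Re (herm_form N (gram n u) x) = (\<Sum>j<n. (1 / real n) * (cmod (\<Sum>k<N. B j k))\<^sup>2)"
    by (metis Re_complex_of_real)
  then show "0 \<le> Re (herm_form N (gram n u) x)" by (simp add: sum_nonneg)
qed

text \<open>Zeroing column \<open>j\<close>, instead of deleting it, keeps \<open>n\<close> and the
  normalisation \<open>1 / n\<close> unchanged.\<close>

lemma gram_update:
  assumes "j < n"
  shows "gram n (u(j := p)) = (\<lambda>i k. gram n (u(j := \<lambda>_. 0)) i k + p i * p k / real n)"
proof (intro ext)
  fix i k
  have f: "(\<Sum>l<n. (u(j := q)) l i * (u(j := q)) l k) = q i * q k + (\<Sum>l\<in>{..<n} - {j}. u l i * u l k)" for q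
    using assms by (subst sum.remove[of _ j]) auto
  show "gram n (u(j := p)) i k = gram n (u(j := \<lambda>_. 0)) i k + p i * p k / real n"
    unfolding gram_def f by (simp add: distrib_left)
qed

text \<open>\<open>cmod z / Im z\<close> stems from the lower bound on \<open>1 + b\<close>, and
  \<open>1 + 1 / Im z\<close> dominates the weights of the errors of \<open>a\<close> and
  \<open>b\<close> in \<open>fraction_lipschitz\<close>.\<close>

definition swap_const :: "complex \<Rightarrow> real" where
  "swap_const z = (1 + 1 / Im z) * (cmod z / Im z)"

text \<open>Both matrices are rank-one perturbations of the one with column \<open>j\<close> zeroed;
  the trace of its resolvent cancels, and a difference of two quotients \<open>a / (1 + b)\<close>
  remains. The four forms are the real and imaginary parts of \<open>n * b\<close> and
  \<open>n * a\<close>.\<close>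

lemma stieltjes_swap:
  assumes z: "Im z > 0" and j: "j < n"
  shows "real N * cmod (stieltjes (cmat N (gram n (u(j := p)))) z - stieltjes (cmat N (gram n (u(j := s)))) z)
    \<le> swap_const z / real n * (\<Sum>t<4. \<bar>quad_form N (res_part N (gram n (u(j := \<lambda>_. 0))) z t) p
         - quad_form N (res_part N (gram n (u(j := \<lambda>_. 0))) z t) s\<bar>)"
proof (cases "N = 0")
  case True then show ?thesis by (simp add: quad_form_def)
next
  case False
  define H where "H = gram n (u(j := \<lambda>_. 0))"
  have sym: "symmetric_on N H" and psd: "psd_on N H" unfolding H_def by (rule symmetric_gram psd_gram)+
  have n: "real n > 0" using j by simp
  define R where "R = resolvent N H z"
  define w where "w = (\<lambda>p i. \<Sum>k<N. R i k * complex_of_real (p k))"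
  define b where "b = (\<lambda>p. (\<Sum>i<N. complex_of_real (p i) * w p i) / of_real (real n))"
  define a where "a = (\<lambda>p. (\<Sum>i<N. (w p i)\<^sup>2) / of_real (real n))"
  have ro: "Im z / cmod z \<le> cmod (1 + b p)" "cmod (a p) \<le> cmod (1 + b p) / Im z"
    "(\<Sum>i<N. resolvent N (\<lambda>i k. H i k + p i * p k / real n) z i i) = (\<Sum>i<N. R i i) - a p / (1 + b p)" for p
    unfolding b_def a_def w_def R_def
    by (rule rank_one_update(1)[OF sym psd z n] rank_one_update(2)[OF sym psd z n] rank_one_update(3)[OF sym psd z n])+
  have zc: "cmod z > 0" using z Im_le_cmod[of z] by linarith
  then have m: "Im z / cmod z > 0" using z by simp
  have Sp: "(\<Sum>i<N. resolvent N (gram n (u(j := p))) z i i) = (\<Sum>i<N. R i i) - a p / (1 + b p)" for p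
    unfolding gram_update[OF j, of u p] H_def[symmetric] by (rule ro(3))
  have bq: "of_real (real n) * b p = Complex (quad_form N (res_part N H z 0) p) (quad_form N (res_part N H z 1) p)" for p
  proof -
    have "of_real (real n) * b p = (\<Sum>i<N. of_real (p i) * w p i)"
      using n by (simp add: b_def)
    also have "\<dots> = (\<Sum>i<N. \<Sum>k<N. of_real (p i) * R i k * of_real (p k))"
      by (simp add: w_def sum_distrib_left mult.assoc)
    finally show ?thesis by (simp add: complex_eq_iff quad_form_def res_part_def R_def[symmetric] Let_def)
  qed
  \<comment> \<open>\<open>n * a\<close> is a sum of squares without conjugation; the symmetry of
    \<open>R\<close> turns \<open>R\<^sup>T R\<close> into \<open>R\<^sup>2\<close>.\<close>
  have aq: "of_real (real n) * a p = Complex (quad_form N (res_part N H z 2) p) (quad_form N (res_part N H z 3) p)" for p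
  proof -
    have "of_real (real n) * a p = (\<Sum>l<N. (\<Sum>i<N. R l i * of_real (p i)) * (\<Sum>k<N. R l k * of_real (p k)))"
      using n by (simp add: a_def w_def power2_eq_square)
    also have "\<dots> = (\<Sum>l<N. \<Sum>i<N. \<Sum>k<N. of_real (p i) * (R i l * R l k) * of_real (p k))"
      unfolding sum_product
    proof (intro sum.cong refl)
      fix l i k assume "l \<in> {..<N}" "i \<in> {..<N}"
      then have "R l i = R i l" unfolding R_def by (intro resolvent_symmetric[OF sym z]) auto
      then show "R l i * of_real (p i) * (R l k * of_real (p k)) = of_real (p i) * (R i l * R l k) * of_real (p k)"
        by (simp add: mult_ac)
    qed
    also have "\<dots> = (\<Sum>i<N. \<Sum>l<N. \<Sum>k<N. of_real (p i) * (R i l * R l k) * of_real (p k))" by (rule sum.swap)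
    also have "\<dots> = (\<Sum>i<N. \<Sum>k<N. \<Sum>l<N. of_real (p i) * (R i l * R l k) * of_real (p k))" by (intro sum.cong refl sum.swap)
    also have "\<dots> = (\<Sum>i<N. \<Sum>k<N. of_real (p i) * (\<Sum>l<N. R i l * R l k) * of_real (p k))"
      by (simp add: sum_distrib_left sum_distrib_right)
    finally show ?thesis by (simp add: complex_eq_iff quad_form_def res_part_def R_def[symmetric] Let_def)
  qed
  define d where "d t = \<bar>quad_form N (res_part N H z t) p - quad_form N (res_part N H z t) s\<bar>" for t
  have b2: "real n * cmod (b p - b s) \<le> d 0 + d 1"
  proof -
    have "real n * cmod (b p - b s) = cmod (of_real (real n) * b p - of_real (real n) * b s)"
      by (simp add: right_diff_distrib[symmetric] norm_mult)
    also have "\<dots> \<le> d 0 + d 1" unfolding bq d_def by (rule order_trans[OF cmod_le]) simp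
    finally show ?thesis .
  qed
  have a2: "real n * cmod (a p - a s) \<le> d 2 + d 3"
  proof -
    have "real n * cmod (a p - a s) = cmod (of_real (real n) * a p - of_real (real n) * a s)"
      by (simp add: right_diff_distrib[symmetric] norm_mult)
    also have "\<dots> \<le> d 2 + d 3" unfolding aq d_def by (rule order_trans[OF cmod_le]) simp
    finally show ?thesis .
  qed
  have "real N * cmod (stieltjes (cmat N (gram n (u(j := p)))) z - stieltjes (cmat N (gram n (u(j := s)))) z)
     = cmod ((\<Sum>i<N. resolvent N (gram n (u(j := p))) z i i) - (\<Sum>i<N. resolvent N (gram n (u(j := s))) z i i))"
    using False by (simp add: stieltjes_cmat diff_divide_distrib[symmetric] norm_divide)
  also have "\<dots> = cmod (a p / (1 + b p) - a s / (1 + b s))" unfolding Sp by (simp add: norm_minus_commute)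
  also have "\<dots> \<le> (cmod (a p - a s) + cmod (b p - b s) / Im z) / (Im z / cmod z)"
    by (rule fraction_lipschitz[OF m _ _ _ z]) (use ro(1,2) in \<open>auto simp: w_def b_def a_def\<close>)
  also have "\<dots> = (real n * cmod (a p - a s) + real n * cmod (b p - b s) / Im z) / real n * (cmod z / Im z)"
  proof -
    have e: "(real n * x + real n * y / Im z) / real n = x + y / Im z" for x y
      using n by (simp add: add_divide_distrib)
    show ?thesis unfolding e by simp
  qed
  also have "\<dots> \<le> ((d 2 + d 3) + (d 0 + d 1) / Im z) / real n * (cmod z / Im z)"
    using a2 b2 z by (intro mult_right_mono divide_right_mono add_mono) auto
  also have "\<dots> \<le> ((1 + 1 / Im z) * (d 0 + d 1 + d 2 + d 3)) / real n * (cmod z / Im z)"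
  proof (intro mult_right_mono divide_right_mono)
    have d0: "d t \<ge> 0" for t by (simp add: d_def)
    have "0 \<le> (d 2 + d 3) / Im z" using d0[of 2] d0[of 3] z by (intro divide_nonneg_nonneg) auto
    then show "(d 2 + d 3) + (d 0 + d 1) / Im z \<le> (1 + 1 / Im z) * (d 0 + d 1 + d 2 + d 3)"
      using d0[of 0] d0[of 1] by (simp add: algebra_simps add_divide_distrib)
  qed (use z in auto)
  also have "\<dots> = swap_const z / real n * (\<Sum>t<4. d t)"
  proof -
    have "(\<Sum>t<4. d t) = d 0 + d 1 + d 2 + d 3" by (simp add: eval_nat_numeral)
    then show ?thesis by (simp add: swap_const_def mult_ac)
  qed
  finally show ?thesis unfolding d_def H_def .
qed

section \<open>Measurability of resolvents and Stieltjes transforms\<close>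

lemma measurable_det_mat:
  fixes f :: "'b \<Rightarrow> nat \<Rightarrow> nat \<Rightarrow> complex"
  assumes "\<And>i j. i < N \<Longrightarrow> j < N \<Longrightarrow> (\<lambda>x. f x i j) \<in> borel_measurable M"
  shows "(\<lambda>x. Determinant.det (mat N N (\<lambda>(i, j). f x i j))) \<in> borel_measurable M"
proof -
  have "(\<lambda>x. Determinant.det (mat N N (\<lambda>(i, j). f x i j)))
     = (\<lambda>x. \<Sum>p\<in>{p. p permutes {0..<N}}. signof p * (\<Prod>i=0..<N. f x i (p i)))"
  proof
    fix x
    have "Determinant.det (mat N N (\<lambda>(i, j). f x i j)) = (\<Sum>p\<in>{p. p permutes {0..<N}}. signof p * (\<Prod>i=0..<N. mat N N (\<lambda>(i, j). f x i j) $$ (i, p i)))"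
      by (rule det_def') simp
    also have "\<dots> = (\<Sum>p\<in>{p. p permutes {0..<N}}. signof p * (\<Prod>i=0..<N. f x i (p i)))"
      by (intro sum.cong refl arg_cong2[where f="(*)"] prod.cong) (auto dest: permutes_in_image)
    finally show "Determinant.det (mat N N (\<lambda>(i, j). f x i j)) = \<dots>" .
  qed
  moreover have "(\<lambda>x. f x i (p i)) \<in> borel_measurable M" if "p permutes {0..<N}" "i \<in> {0..<N}" for p i
    using that permutes_in_image[OF that(1), of i] by (intro assms) auto
  ultimately show ?thesis by (auto intro!: borel_measurable_sum borel_measurable_times borel_measurable_prod)
qed

text \<open>\<open>mat_inverse\<close> is defined by an elimination algorithm, so measurability is
  read off the cofactor formula instead.\<close>

lemma measurable_resolvent:
  assumes H: "\<And>i j. i < N \<Longrightarrow> j < N \<Longrightarrow> (\<lambda>x. H x i j) \<in> borel_measurable M"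
    and sym: "\<And>x. symmetric_on N (H x)" and z: "Im z > 0" and ij: "i < N" "j < N"
  shows "(\<lambda>x. resolvent N (H x) z i j) \<in> borel_measurable M"
proof -
  define F where "F x i j = of_real (H x i j) - z * of_bool (i = j)" for x i j
  have F: "(\<lambda>x. F x i j) \<in> borel_measurable M" if "i < N" "j < N" for i j
    unfolding F_def using H[OF that] by measurable
  have A: "cmat N (H x) - z \<cdot>\<^sub>m 1\<^sub>m N = mat N N (\<lambda>(i, j). F x i j)" for x
    by (rule eq_matI) (auto simp: cmat_def F_def)
  \<comment> \<open>The enumeration of the indices other than \<open>i\<close>, which describes the
    entries of \<open>mat_delete\<close>.\<close>
  define g :: "nat \<Rightarrow> nat \<Rightarrow> nat" where "g i k = (if k < i then k else Suc k)" for i k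
  have cof: "cofactor (mat N N (\<lambda>(i, j). F x i j)) j i
      = (-1) ^ (j + i) * Determinant.det (mat (N - 1) (N - 1) (\<lambda>(k, l). F x (g j k) (g i l)))" for x
  proof -
    have "mat_delete (mat N N (\<lambda>(i, j). F x i j)) j i = mat (N - 1) (N - 1) (\<lambda>(k, l). F x (g j k) (g i l))"
      unfolding mat_delete_def by (rule eq_matI) (auto simp: g_def)
    then show ?thesis by (simp add: cofactor_def)
  qed
  have m1: "(\<lambda>x. Determinant.det (mat (N - 1) (N - 1) (\<lambda>(k, l). F x (g j k) (g i l)))) \<in> borel_measurable M"
    by (rule measurable_det_mat, rule F) (auto simp: g_def)
  have m2: "(\<lambda>x. Determinant.det (mat N N (\<lambda>(i, j). F x i j))) \<in> borel_measurable M"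
    by (rule measurable_det_mat, rule F)
  have "(\<lambda>x. resolvent N (H x) z i j) = (\<lambda>x. (-1) ^ (j + i) *
      Determinant.det (mat (N - 1) (N - 1) (\<lambda>(k, l). F x (g j k) (g i l))) / Determinant.det (mat N N (\<lambda>(i, j). F x i j)))"
    by (rule ext) (simp only: resolvent_inverse(2)[OF sym z ij] A cof)
  then show ?thesis
    by (simp only:) (intro borel_measurable_divide borel_measurable_times borel_measurable_const m1 m2)
qed

lemma measurable_res_part:
  assumes H: "\<And>i j. i < N \<Longrightarrow> j < N \<Longrightarrow> (\<lambda>x. H x i j) \<in> borel_measurable M"
    and sym: "\<And>x. symmetric_on N (H x)" and z: "Im z > 0" and ij: "i < N" "j < N"
  shows "(\<lambda>x. res_part N (H x) z t i j) \<in> borel_measurable M"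
proof -
  have R: "(\<lambda>x. resolvent N (H x) z i j) \<in> borel_measurable M" if "i < N" "j < N" for i j
    by (rule measurable_resolvent[OF H sym z that])
  have [measurable]: "(\<lambda>x. \<Sum>l<N. resolvent N (H x) z i l * resolvent N (H x) z l j) \<in> borel_measurable M"
    using ij by (intro borel_measurable_sum borel_measurable_times R) auto
  note [measurable] = R[OF ij]
  show ?thesis unfolding res_part_def Let_def by measurable
qed

lemma measurable_stieltjes:
  assumes H: "\<And>i j. i < N \<Longrightarrow> j < N \<Longrightarrow> (\<lambda>x. H x i j) \<in> borel_measurable M"
    and sym: "\<And>x. symmetric_on N (H x)" and z: "Im z > 0"
  shows "(\<lambda>x. stieltjes (cmat N (H x)) z) \<in> borel_measurable M"
  unfolding stieltjes_cmat
  by (intro borel_measurable_divide borel_measurable_sum measurable_resolvent[OF H sym z] borel_measurable_const) auto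

subsection \<open>Quadratic forms of mixing processes\<close>

definition bilin_form :: "nat \<Rightarrow> (nat \<Rightarrow> nat \<Rightarrow> real) \<Rightarrow> (nat \<Rightarrow> real) \<Rightarrow> (nat \<Rightarrow> real) \<Rightarrow> real" where
  "bilin_form N A p r = (\<Sum>i<N. \<Sum>j<N. p i * A i j * r j)"

lemma quad_form_bilin: "quad_form N A p = bilin_form N A p p"
  by (simp add: quad_form_def bilin_form_def)

lemma bilin_form_rows: "bilin_form N A p r = (\<Sum>i<N. p i * (\<Sum>j<N. A i j * r j))"
  by (simp add: bilin_form_def sum_distrib_left mult.assoc)

lemma bilin_form_cols: "bilin_form N A p r = (\<Sum>j<N. (\<Sum>i<N. A i j * p i) * r j)"
proof -
  have "bilin_form N A p r = (\<Sum>j<N. \<Sum>i<N. p i * A i j * r j)"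
    unfolding bilin_form_def by (rule sum.swap)
  then show ?thesis unfolding sum_distrib_right
    by (rule trans) (intro sum.cong refl, simp only: mult_ac)
qed

lemma bilin_form_transpose: "bilin_form N A p r = bilin_form N (\<lambda>i j. A j i) r p"
  unfolding bilin_form_cols[of N A] bilin_form_rows[of N "\<lambda>i j. A j i"] by (simp add: mult.commute)

lemma op_bound_transpose: "op_bound N K A \<Longrightarrow> op_bound N K (\<lambda>i j. A j i)"
  by (simp add: op_bound_def)

lemma bilin_form_sum_left: "bilin_form N A (\<lambda>i. \<Sum>a\<in>S. p a i) r = (\<Sum>a\<in>S. bilin_form N A (p a) r)"
proof -
  have "bilin_form N A (\<lambda>i. \<Sum>a\<in>S. p a i) r = (\<Sum>i<N. \<Sum>a\<in>S. p a i * (\<Sum>j<N. A i j * r j))"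
    by (simp add: bilin_form_rows sum_distrib_right)
  also have "\<dots> = (\<Sum>a\<in>S. \<Sum>i<N. p a i * (\<Sum>j<N. A i j * r j))" by (rule sum.swap)
  finally show ?thesis by (simp add: bilin_form_rows)
qed

lemma bilin_form_sum_right: "bilin_form N A p (\<lambda>i. \<Sum>a\<in>S. r a i) = (\<Sum>a\<in>S. bilin_form N A p (r a))"
  by (subst bilin_form_transpose) (simp add: bilin_form_sum_left bilin_form_transpose[of N A])

lemma bilin_form_bound:
  assumes "op_bound N K A"
  shows "(bilin_form N A p r)\<^sup>2 \<le> K\<^sup>2 * (\<Sum>i<N. (p i)\<^sup>2) * (\<Sum>i<N. (r i)\<^sup>2)"
proof -
  have "(bilin_form N A p r)\<^sup>2 \<le> (\<Sum>i<N. (p i)\<^sup>2) * (\<Sum>i<N. (\<Sum>j<N. A i j * r j)\<^sup>2)"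
    unfolding bilin_form_rows by (rule Cauchy_Schwarz_ineq_sum)
  also have "\<dots> \<le> (\<Sum>i<N. (p i)\<^sup>2) * (K\<^sup>2 * (\<Sum>i<N. (r i)\<^sup>2))"
    using assms by (intro mult_left_mono sum_nonneg) (auto simp: op_bound_def)
  finally show ?thesis by (simp add: mult_ac)
qed

text \<open>With \<open>d = p - r\<close> the difference is
  \<open>d\<^sup>T A p + r\<^sup>T A d\<close>.\<close>

lemma quad_form_diff_bound:
  assumes "op_bound N K A"
  shows "(quad_form N A p - quad_form N A r)\<^sup>2
    \<le> 2 * K\<^sup>2 * (\<Sum>i<N. (p i - r i)\<^sup>2) * ((\<Sum>i<N. (p i)\<^sup>2) + (\<Sum>i<N. (r i)\<^sup>2))"
proof -
  let ?d = "\<lambda>i. p i - r i"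
  have e: "quad_form N A p - quad_form N A r = bilin_form N A ?d p + bilin_form N A r ?d"
    by (simp add: quad_form_bilin bilin_form_def sum_subtractf[symmetric] sum.distrib[symmetric] algebra_simps)
  have "(quad_form N A p - quad_form N A r)\<^sup>2 \<le> 2 * (bilin_form N A ?d p)\<^sup>2 + 2 * (bilin_form N A r ?d)\<^sup>2"
    unfolding e by (rule square_add_le)
  also have "\<dots> \<le> 2 * (K\<^sup>2 * (\<Sum>i<N. (?d i)\<^sup>2) * (\<Sum>i<N. (p i)\<^sup>2)) + 2 * (K\<^sup>2 * (\<Sum>i<N. (r i)\<^sup>2) * (\<Sum>i<N. (?d i)\<^sup>2))"
    using bilin_form_bound[OF assms, of ?d p] bilin_form_bound[OF assms, of r ?d] by linarith
  finally show ?thesis by (simp add: algebra_simps)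
qed

text \<open>The operator norm is at most the Hilbert-Schmidt norm, by Cauchy-Schwarz over the pairs
  \<open>(i, k)\<close>.\<close>

lemma weighted_gram_bound:
  fixes \<gamma> :: "nat \<Rightarrow> nat \<Rightarrow> real"
  assumes "(\<Sum>i<N. \<Sum>k<N. (\<gamma> i k)\<^sup>2) \<le> F\<^sup>2" "F \<ge> 0"
  shows "(\<Sum>i<N. \<Sum>k<N. w i * w k * \<gamma> i k) \<le> (\<Sum>i<N. (w i)\<^sup>2) * F"
proof -
  define W where "W = (\<Sum>i<N. (w i)\<^sup>2)"
  have W0: "W \<ge> 0" by (simp add: W_def sum_nonneg)
  let ?S = "{..<N} \<times> {..<N}"
  have 1: "(\<Sum>x\<in>?S. (w (fst x) * w (snd x))\<^sup>2) = W\<^sup>2"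
    by (simp add: W_def power2_eq_square[of "sum _ _"] sum_product sum.cartesian_product case_prod_unfold power_mult_distrib)
  have 2: "(\<Sum>x\<in>?S. (\<gamma> (fst x) (snd x))\<^sup>2) = (\<Sum>i<N. \<Sum>k<N. (\<gamma> i k)\<^sup>2)"
    by (simp add: sum.cartesian_product case_prod_unfold)
  have 3: "(\<Sum>i<N. \<Sum>k<N. w i * w k * \<gamma> i k) = (\<Sum>x\<in>?S. (w (fst x) * w (snd x)) * \<gamma> (fst x) (snd x))"
    by (simp add: sum.cartesian_product case_prod_unfold)
  have "(\<Sum>i<N. \<Sum>k<N. w i * w k * \<gamma> i k)\<^sup>2 \<le> W\<^sup>2 * (\<Sum>i<N. \<Sum>k<N. (\<gamma> i k)\<^sup>2)"
    unfolding 3 1[symmetric] 2[symmetric] by (rule Cauchy_Schwarz_ineq_sum)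
  also have "\<dots> \<le> W\<^sup>2 * F\<^sup>2" using assms by (intro mult_left_mono) auto
  also have "\<dots> = (W * F)\<^sup>2" by (simp add: power_mult_distrib)
  finally show ?thesis unfolding W_def[symmetric] by (rule power2_le_imp_le) (use W0 assms in simp)
qed

text \<open>At most \<open>2 * D\<close> entries of a row lie in the band around the diagonal and
  cost \<open>C\<^sup>2\<close> each; every other entry costs \<open>\<eta>\<^sup>2\<close>.\<close>

lemma sum_sq_off_diagonal_bound:
  fixes \<gamma> :: "nat \<Rightarrow> nat \<Rightarrow> real"
  assumes C: "\<And>i k. \<bar>\<gamma> i k\<bar> \<le> C" and far: "\<And>i k. i + D \<le> k \<or> k + D \<le> i \<Longrightarrow> \<bar>\<gamma> i k\<bar> \<le> \<eta>"
  shows "(\<Sum>i<N. \<Sum>k<N. (\<gamma> i k)\<^sup>2) \<le> (real N)\<^sup>2 * \<eta>\<^sup>2 + 2 * real N * real D * C\<^sup>2"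
proof -
  have row: "(\<Sum>k<N. (\<gamma> i k)\<^sup>2) \<le> real N * \<eta>\<^sup>2 + 2 * real D * C\<^sup>2" for i
  proof -
    define S where "S = {k. k < i + D \<and> i < k + D}"
    have "S \<subseteq> {i - D..<i + D}" by (auto simp: S_def)
    then have cS: "finite S" "card S \<le> 2 * D"
      using card_mono[of "{i - D..<i + D}" S] by (auto intro: finite_subset)
    have "(\<gamma> i k)\<^sup>2 \<le> \<eta>\<^sup>2 + (if k \<in> S then C\<^sup>2 else 0)" for k
    proof (cases "k \<in> S")
      case True
      have "\<bar>\<gamma> i k\<bar>\<^sup>2 \<le> C\<^sup>2" by (rule power_mono[OF C]) simp
      then show ?thesis using True by (simp add: add_increasing)
    next
      case False
      then have "\<bar>\<gamma> i k\<bar> \<le> \<eta>" by (intro far) (auto simp: S_def)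
      then have "\<bar>\<gamma> i k\<bar>\<^sup>2 \<le> \<eta>\<^sup>2" by (rule power_mono) simp
      then show ?thesis using False by simp
    qed
    then have "(\<Sum>k<N. (\<gamma> i k)\<^sup>2) \<le> (\<Sum>k<N. \<eta>\<^sup>2 + (if k \<in> S then C\<^sup>2 else 0))" by (rule sum_mono)
    also have "\<dots> = real N * \<eta>\<^sup>2 + real (card ({..<N} \<inter> S)) * C\<^sup>2"
      by (simp add: sum.distrib sum.If_cases)
    also have "\<dots> \<le> real N * \<eta>\<^sup>2 + 2 * real D * C\<^sup>2"
    proof -
      have "card ({..<N} \<inter> S) \<le> 2 * D" using cS card_mono[of S "{..<N} \<inter> S"] by auto
      then have "real (card ({..<N} \<inter> S)) \<le> 2 * real D" by linarith
      then show ?thesis by (simp add: mult_right_mono)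
    qed
    finally show ?thesis .
  qed
  have "(\<Sum>i<N. \<Sum>k<N. (\<gamma> i k)\<^sup>2) \<le> (\<Sum>i<N. real N * \<eta>\<^sup>2 + 2 * real D * C\<^sup>2)"
    by (intro sum_mono row)
  then show ?thesis by (simp add: power2_eq_square algebra_simps)
qed

text \<open>The band contributes a term linear in \<open>N\<close>, which the quadratic right-hand
  side absorbs for large \<open>N\<close>. The parameter \<open>s\<close> will be the starting time
  of a column, and the threshold must be uniform in it.\<close>

lemma sum_sq_small:
  fixes \<gamma> :: "'s \<Rightarrow> nat \<Rightarrow> nat \<Rightarrow> real"
  assumes C: "\<And>s i k. \<bar>\<gamma> s i k\<bar> \<le> C"
    and far: "\<And>\<eta>. \<eta> > 0 \<Longrightarrow> \<exists>D. \<forall>s i k. i + D \<le> k \<or> k + D \<le> i \<longrightarrow> \<bar>\<gamma> s i k\<bar> \<le> \<eta>"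
    and \<phi>: "\<phi> > 0"
  shows "\<exists>N0. \<forall>N\<ge>N0. \<forall>s. (\<Sum>i<N. \<Sum>k<N. (\<gamma> s i k)\<^sup>2) \<le> (\<phi> * real N)\<^sup>2"
proof -
  obtain D where D: "\<And>s i k. i + D \<le> k \<or> k + D \<le> i \<Longrightarrow> \<bar>\<gamma> s i k\<bar> \<le> \<phi> / 2"
    using far[of "\<phi> / 2"] \<phi> by auto
  obtain N0 :: nat where N0: "4 * real D * C\<^sup>2 / \<phi>\<^sup>2 \<le> real N0" using real_arch_simple by blast
  show ?thesis
  proof (intro exI[of _ N0] allI impI)
    fix N s assume "N0 \<le> N"
    then have N: "4 * real D * C\<^sup>2 / \<phi>\<^sup>2 \<le> real N" using N0 by linarith
    then have "4 * real D * C\<^sup>2 \<le> real N * \<phi>\<^sup>2" using \<phi> by (simp add: divide_le_eq)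
    then have "real N * (4 * real D * C\<^sup>2) \<le> real N * (real N * \<phi>\<^sup>2)" by (rule mult_left_mono) simp
    then have 1: "2 * real N * real D * C\<^sup>2 \<le> (real N)\<^sup>2 * \<phi>\<^sup>2 / 2" by (simp add: power2_eq_square mult_ac)
    have "(\<Sum>i<N. \<Sum>k<N. (\<gamma> s i k)\<^sup>2) \<le> (real N)\<^sup>2 * (\<phi> / 2)\<^sup>2 + 2 * real N * real D * C\<^sup>2"
      by (rule sum_sq_off_diagonal_bound[OF C D])
    also have "(real N)\<^sup>2 * (\<phi> / 2)\<^sup>2 = (real N)\<^sup>2 * \<phi>\<^sup>2 / 4" by (simp add: power_divide)
    finally have "(\<Sum>i<N. \<Sum>k<N. (\<gamma> s i k)\<^sup>2) \<le> (real N)\<^sup>2 * \<phi>\<^sup>2 / 4 + (real N)\<^sup>2 * \<phi>\<^sup>2 / 2" using 1 by linarith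
    also have "\<dots> \<le> (real N)\<^sup>2 * \<phi>\<^sup>2" by simp
    finally show "(\<Sum>i<N. \<Sum>k<N. (\<gamma> s i k)\<^sup>2) \<le> (\<phi> * real N)\<^sup>2" by (simp add: power_mult_distrib mult.commute)
  qed
qed

section \<open>Variances of bounded variables\<close>

context prob_space begin

lemma second_moment_linear_comb:
  fixes X :: "nat \<Rightarrow> 'a \<Rightarrow> real"
  assumes int: "\<And>i k. integrable M (\<lambda>x. X i x * X k x)"
    and F: "(\<Sum>i<N. \<Sum>k<N. (\<integral>x. X i x * X k x \<partial>M)\<^sup>2) \<le> F\<^sup>2" "F \<ge> 0"
  shows "(\<integral>x. (\<Sum>i<N. w i * X i x)\<^sup>2 \<partial>M) \<le> (\<Sum>i<N. (w i)\<^sup>2) * F"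
proof -
  have "(\<integral>x. (\<Sum>i<N. w i * X i x)\<^sup>2 \<partial>M) = (\<integral>x. (\<Sum>i<N. \<Sum>k<N. w i * w k * (X i x * X k x)) \<partial>M)"
    by (intro Bochner_Integration.integral_cong refl) (simp add: power2_eq_square sum_product mult_ac)
  also have "\<dots> = (\<Sum>i<N. \<Sum>k<N. w i * w k * (\<integral>x. X i x * X k x \<partial>M))"
    using int by (simp add: Bochner_Integration.integral_sum)
  also have "\<dots> \<le> (\<Sum>i<N. (w i)\<^sup>2) * F" by (rule weighted_gram_bound[OF F])
  finally show ?thesis .
qed

definition var :: "('a \<Rightarrow> real) \<Rightarrow> real" where
  "var f = (\<integral>x. (f x - (\<integral>y. f y \<partial>M))\<^sup>2 \<partial>M)"

lemma bounded_integrable: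
  "f \<in> borel_measurable M \<Longrightarrow> (\<And>x. \<bar>f x\<bar> \<le> C) \<Longrightarrow> integrable M (f :: 'a \<Rightarrow> real)"
  by (rule integrable_const_bound[of _ C]) auto

lemma square_bound: "\<bar>f\<bar> \<le> (C::real) \<Longrightarrow> \<bar>f\<^sup>2\<bar> \<le> C\<^sup>2"
  using power_mono[of "\<bar>f\<bar>" C 2] by simp

text \<open>The crude factor \<open>2\<close> avoids any covariance between \<open>f\<close> and
  \<open>g\<close>.\<close>

lemma var_add_le:
  assumes f: "f \<in> borel_measurable M" "\<And>x. \<bar>f x\<bar> \<le> C" and g: "g \<in> borel_measurable M" "\<And>x. \<bar>g x\<bar> \<le> D"
  shows "var (\<lambda>x. f x + g x) \<le> 2 * var f + 2 * var g"
proof -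
  note [measurable] = f(1) g(1)
  have fi: "integrable M f" "integrable M g" by (rule bounded_integrable[OF f] bounded_integrable[OF g])+
  define u where "u = (\<integral>x. f x \<partial>M)" define v where "v = (\<integral>x. g x \<partial>M)"
  have "integrable M (\<lambda>x. (f x - u)\<^sup>2)"
  proof (rule bounded_integrable[where C="(C + \<bar>u\<bar>)\<^sup>2"])
    show "\<bar>(f x - u)\<^sup>2\<bar> \<le> (C + \<bar>u\<bar>)\<^sup>2" for x using f(2)[of x] by (intro square_bound) linarith
  qed measurable
  moreover have "integrable M (\<lambda>x. (g x - v)\<^sup>2)"
  proof (rule bounded_integrable[where C="(D + \<bar>v\<bar>)\<^sup>2"])
    show "\<bar>(g x - v)\<^sup>2\<bar> \<le> (D + \<bar>v\<bar>)\<^sup>2" for x using g(2)[of x] by (intro square_bound) linarith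
  qed measurable
  ultimately have i: "integrable M (\<lambda>x. (f x - u)\<^sup>2)" "integrable M (\<lambda>x. (g x - v)\<^sup>2)" .
  have "var (\<lambda>x. f x + g x) = (\<integral>x. ((f x - u) + (g x - v))\<^sup>2 \<partial>M)"
    unfolding var_def using fi by (simp add: u_def v_def algebra_simps)
  also have "\<dots> \<le> (\<integral>x. 2 * (f x - u)\<^sup>2 + 2 * (g x - v)\<^sup>2 \<partial>M)"
    by (rule integral_mono') (use i square_add_le in auto)
  also have "\<dots> = 2 * var f + 2 * var g" using i by (simp add: var_def u_def v_def)
  finally show ?thesis .
qed

lemma var_le_second_moment:
  assumes f: "f \<in> borel_measurable M" "\<And>x. \<bar>f x\<bar> \<le> C"
  shows "var f \<le> (\<integral>x. (f x)\<^sup>2 \<partial>M)"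
proof -
  note [measurable] = f(1)
  have fi: "integrable M f" by (rule bounded_integrable[OF f])
  have f2: "integrable M (\<lambda>x. (f x)\<^sup>2)" using f square_bound by (auto intro!: bounded_integrable[where C="C\<^sup>2"])
  define u where "u = (\<integral>x. f x \<partial>M)"
  have "var f = (\<integral>x. (f x)\<^sup>2 - 2 * u * f x + u\<^sup>2 \<partial>M)"
    unfolding var_def u_def[symmetric] by (intro Bochner_Integration.integral_cong refl) (simp add: power2_diff algebra_simps)
  also have "\<dots> = (\<integral>x. (f x)\<^sup>2 \<partial>M) - u\<^sup>2"
    using fi f2 by (simp add: prob_space u_def[symmetric] power2_eq_square)
  finally show ?thesis by simp
qed

lemma var_le_bound:
  assumes f: "f \<in> borel_measurable M" "\<And>x. \<bar>f x\<bar> \<le> C"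
  shows "var f \<le> C\<^sup>2"
proof -
  note [measurable] = f(1)
  have "(\<integral>x. (f x)\<^sup>2 \<partial>M) \<le> (\<integral>x. C\<^sup>2 \<partial>M)"
    using f square_bound[of "f _" C] by (intro integral_mono bounded_integrable[where C="C\<^sup>2"]) (auto simp: abs_le_iff)
  then show ?thesis using var_le_second_moment[OF f] by (simp add: prob_space)
qed

text \<open>Expansion of the square of the centered sum: \<open>d1\<close> is paid on the diagonal
  and, to keep the count simple, \<open>d2\<close> on all \<open>B\<^sup>2\<close> pairs.\<close>

lemma var_sum_le:
  fixes U :: "nat \<Rightarrow> 'a \<Rightarrow> real"
  assumes U: "\<And>a. a < B \<Longrightarrow> U a \<in> borel_measurable M" "\<And>a x. a < B \<Longrightarrow> \<bar>U a x\<bar> \<le> C"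
    and diag: "\<And>a. a < B \<Longrightarrow> var (U a) \<le> d1"
    and off: "\<And>a c. a < c \<Longrightarrow> c < B \<Longrightarrow> (\<integral>x. U a x * U c x \<partial>M) - (\<integral>x. U a x \<partial>M) * (\<integral>x. U c x \<partial>M) \<le> d2"
    and d: "d1 \<ge> 0" "d2 \<ge> 0"
  shows "var (\<lambda>x. \<Sum>a<B. U a x) \<le> real B * d1 + (real B)\<^sup>2 * d2"
proof -
  have Ui: "integrable M (U a)" if "a < B" for a using U that by (intro bounded_integrable) auto
  define V where "V a x = U a x - (\<integral>y. U a y \<partial>M)" for a x
  have UU: "integrable M (\<lambda>x. U a x * U c x)" if "a < B" "c < B" for a c
  proof (rule bounded_integrable[where C="C * C"])
    show "\<bar>U a x * U c x\<bar> \<le> C * C" for x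
      unfolding abs_mult using U(2)[OF that(1), of x] U(2)[OF that(2), of x] by (intro mult_mono) auto
    show "(\<lambda>x. U a x * U c x) \<in> borel_measurable M" using U(1) that by (intro borel_measurable_times) auto
  qed
  have VV: "integrable M (\<lambda>x. V a x * V c x)"
    and EV: "(\<integral>x. V a x * V c x \<partial>M) = (\<integral>x. U a x * U c x \<partial>M) - (\<integral>x. U a x \<partial>M) * (\<integral>x. U c x \<partial>M)"
    if "a < B" "c < B" for a c
  proof -
    have e: "V a x * V c x = U a x * U c x - (\<integral>y. U a y \<partial>M) * U c x - (\<integral>y. U c y \<partial>M) * U a x + (\<integral>y. U a y \<partial>M) * (\<integral>y. U c y \<partial>M)" for x
      by (simp add: V_def algebra_simps)
    show "integrable M (\<lambda>x. V a x * V c x)" unfolding e using UU[OF that] Ui[OF that(1)] Ui[OF that(2)] by simp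
    show "(\<integral>x. V a x * V c x \<partial>M) = (\<integral>x. U a x * U c x \<partial>M) - (\<integral>x. U a x \<partial>M) * (\<integral>x. U c x \<partial>M)"
      unfolding e using UU[OF that] Ui[OF that(1)] Ui[OF that(2)] by (simp add: prob_space)
  qed
  have "var (\<lambda>x. \<Sum>a<B. U a x) = (\<integral>x. (\<Sum>a<B. V a x)\<^sup>2 \<partial>M)"
    unfolding var_def V_def using Ui by (simp add: Bochner_Integration.integral_sum sum_subtractf)
  also have "\<dots> = (\<integral>x. (\<Sum>a<B. \<Sum>c<B. V a x * V c x) \<partial>M)"
    by (simp add: power2_eq_square sum_product)
  also have "\<dots> = (\<Sum>a<B. \<Sum>c<B. \<integral>x. V a x * V c x \<partial>M)"
    using VV by (subst Bochner_Integration.integral_sum) (auto intro!: sum.cong Bochner_Integration.integral_sum Bochner_Integration.integrable_sum)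
  also have "\<dots> \<le> (\<Sum>a<B. \<Sum>c<B. (if c = a then d1 else 0) + d2)"
  proof (intro sum_mono)
    fix a c assume "a \<in> {..<B}" "c \<in> {..<B}"
    then have ac: "a < B" "c < B" by auto
    consider "a = c" | "a < c" | "c < a" by linarith
    then show "(\<integral>x. V a x * V c x \<partial>M) \<le> (if c = a then d1 else 0) + d2"
    proof cases
      case 1
      then show ?thesis using diag[OF ac(1)] d by (simp add: var_def V_def power2_eq_square)
    next
      case 2
      then show ?thesis using off[OF 2 ac(2)] d by (simp add: EV[OF ac])
    next
      case 3
      then show ?thesis using off[OF 3 ac(1)] d by (simp add: EV[OF ac] mult.commute)
    qed
  qed
  also have "\<dots> = real B * d1 + (real B)\<^sup>2 * d2"
    by (simp add: sum.distrib sum.delta power2_eq_square algebra_simps)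
  finally show ?thesis .
qed

end

section \<open>Bounded functions of a moving finite window\<close>

locale window_process = mixing_law P b for P b +
  fixes Y :: "int \<Rightarrow> (int \<Rightarrow> real) \<Rightarrow> real" and m :: nat and T :: real
  assumes Y_meas [measurable]: "Y k \<in> borel_measurable seqs"
    and Y_bound: "\<bar>Y k e\<bar> \<le> T"
    and Y_win: "(\<And>i. \<bar>i - k\<bar> \<le> int m \<Longrightarrow> e i = e' i) \<Longrightarrow> Y k e = Y k e'"
    and Y_mean: "(\<integral>e. Y k e \<partial>P) = 0"
begin

lemma T_nonneg: "T \<ge> 0"
  using Y_bound[of 0 undefined] by linarith

lemma Y_sq: "(Y k e)\<^sup>2 \<le> T\<^sup>2"
  using square_bound[OF Y_bound[of k e]] by simp

lemma Y_mult_bound: "\<bar>Y i e * Y k e'\<bar> \<le> T\<^sup>2"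
  unfolding abs_mult power2_eq_square using Y_bound T_nonneg by (intro mult_mono) auto

text \<open>The windows of \<open>Y i\<close> and \<open>Y k\<close> are \<open>q\<close> apart.
  Cutting at the right end \<open>i + m\<close> of the first one, \<open>decouple\<close> compares
  the covariance with a product of means, which is \<open>0\<close>.\<close>

lemma cov_bound:
  assumes "q \<ge> 1" "k - i \<ge> 2 * int m + int q"
  shows "\<bar>\<integral>e. Y i e * Y k e \<partial>P\<bar> \<le> T\<^sup>2 * b q"
proof -
  have "\<bar>(\<integral>e. (\<lambda>(e1, e2). Y i e1 * Y k e2) (e, e) \<partial>P) - (\<integral>e1. \<integral>e2. (\<lambda>(e1, e2). Y i e1 * Y k e2) (e1, e2) \<partial>P \<partial>P)\<bar> \<le> T\<^sup>2 * b q"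
  proof (rule decouple[OF assms(1), where k="i + int m"])
    show "(\<lambda>(e1, e2). Y i e1 * Y k e2) \<in> borel_measurable (seqs \<Otimes>\<^sub>M seqs)" by measurable
    show "\<bar>(\<lambda>(e1, e2). Y i e1 * Y k e2) e\<bar> \<le> T\<^sup>2" for e by (cases e) (simp add: Y_mult_bound)
    show "(\<lambda>(e1, e2). Y i e1 * Y k e2) (e1, e2) = (\<lambda>(e1, e2). Y i e1 * Y k e2) (e1', e2')"
      if "\<And>j. j \<le> i + int m \<Longrightarrow> e1 j = e1' j" "\<And>j. j \<ge> i + int m + int q \<Longrightarrow> e2 j = e2' j" for e1 e1' e2 e2'
    proof -
      have "Y i e1 = Y i e1'" by (rule Y_win, rule that) linarith
      moreover have "Y k e2 = Y k e2'" by (rule Y_win, rule that) (use assms in linarith)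
      ultimately show ?thesis by simp
    qed
  qed
  then show ?thesis by (simp add: Y_mean)
qed

lemma cov_far:
  assumes "\<eta> > 0"
  shows "\<exists>D. \<forall>s i k. i + D \<le> k \<or> k + D \<le> i \<longrightarrow> \<bar>\<integral>e. Y (s + int i) e * Y (s + int k) e \<partial>P\<bar> \<le> \<eta>"
proof -
  have "(\<lambda>q. T\<^sup>2 * b q) \<longlonglongrightarrow> 0" using tendsto_mult[OF tendsto_const[of "T\<^sup>2"] b_lim] by simp
  then have "eventually (\<lambda>q. T\<^sup>2 * b q < \<eta>) sequentially" using assms by (rule order_tendstoD)
  then obtain q0 where "\<And>q. q \<ge> q0 \<Longrightarrow> T\<^sup>2 * b q < \<eta>" by (auto simp: eventually_sequentially)
  then have q: "T\<^sup>2 * b (Suc q0) < \<eta>" by simp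
  have 1: "\<bar>\<integral>e. Y i e * Y k e \<partial>P\<bar> \<le> \<eta>" if "k - i \<ge> int (2 * m + Suc q0)" for i k
  proof -
    have "\<bar>\<integral>e. Y i e * Y k e \<partial>P\<bar> \<le> T\<^sup>2 * b (Suc q0)" by (rule cov_bound) (use that in auto)
    then show ?thesis using q by linarith
  qed
  have "\<bar>\<integral>e. Y (s + int i) e * Y (s + int k) e \<partial>P\<bar> \<le> \<eta>" if "i + (2 * m + Suc q0) \<le> k \<or> k + (2 * m + Suc q0) \<le> i" for s i k
    using that
  proof
    assume "i + (2 * m + Suc q0) \<le> k"
    then show ?thesis by (intro 1) linarith
  next
    assume "k + (2 * m + Suc q0) \<le> i"
    then have "\<bar>\<integral>e. Y (s + int k) e * Y (s + int i) e \<partial>P\<bar> \<le> \<eta>" by (intro 1) linarith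
    then show ?thesis by (simp only: mult.commute)
  qed
  then show ?thesis by blast
qed

lemma cov_gram_small:
  assumes "\<phi> > 0"
  shows "\<exists>N0. \<forall>N\<ge>N0. \<forall>s. (\<Sum>i<N. \<Sum>k<N. (\<integral>e. Y (s + int i) e * Y (s + int k) e \<partial>P)\<^sup>2) \<le> (\<phi> * real N)\<^sup>2"
proof (rule sum_sq_small[OF _ _ assms])
  show "\<bar>\<integral>e. Y (s + int i) e * Y (s + int k) e \<partial>P\<bar> \<le> T\<^sup>2" for s i k
  proof -
    have "\<bar>\<integral>e. Y (s + int i) e * Y (s + int k) e \<partial>P\<bar> \<le> (\<integral>e. \<bar>Y (s + int i) e * Y (s + int k) e\<bar> \<partial>P)"
      by (rule integral_abs_bound)
    also have "\<dots> \<le> (\<integral>e. T\<^sup>2 \<partial>P)"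
      using Y_mult_bound by (intro integral_mono bounded_integrable[where C="T\<^sup>2"]) auto
    finally show ?thesis by (simp add: prob_space)
  qed
qed (rule cov_far)

text \<open>Filling with \<open>0\<close> outside \<open>I\<close> keeps all vectors at the same
  length: blocks, columns with a gap and full columns enter forms with one and the same
  matrix.\<close>

definition yv :: "nat set \<Rightarrow> int \<Rightarrow> (int \<Rightarrow> real) \<Rightarrow> nat \<Rightarrow> real" where
  "yv I s e i = (if i \<in> I then Y (s + int i) e else 0)"

lemma yv_meas [measurable]: "(\<lambda>e. yv I s e i) \<in> borel_measurable seqs"
  unfolding yv_def by (cases "i \<in> I") simp_all

lemma yv_sq: "(yv I s e i)\<^sup>2 \<le> T\<^sup>2"
  using Y_sq by (simp add: yv_def)

lemma yv_sum_sq: "(\<Sum>i<N. (yv I s e i)\<^sup>2) \<le> real N * T\<^sup>2"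
  using sum_mono[of "{..<N}" "\<lambda>i. (yv I s e i)\<^sup>2" "\<lambda>_. T\<^sup>2"] yv_sq by simp

lemma yv_sum_sq_card:
  assumes "finite I" shows "(\<Sum>i<N. (yv I s e i)\<^sup>2) \<le> real (card I) * T\<^sup>2"
proof -
  have "(\<Sum>i<N. (yv I s e i)\<^sup>2) \<le> (\<Sum>i<N. if i \<in> I then T\<^sup>2 else 0)"
    using Y_sq by (intro sum_mono) (auto simp: yv_def)
  also have "\<dots> = real (card ({..<N} \<inter> I)) * T\<^sup>2" by (simp add: sum.If_cases)
  also have "\<dots> \<le> real (card I) * T\<^sup>2"
    using card_mono[OF assms, of "{..<N} \<inter> I"] by (intro mult_right_mono) auto
  finally show ?thesis .
qed

lemma bilin_yv_bound:
  assumes "op_bound N K A"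
  shows "(bilin_form N A (yv I s e) (yv J s e'))\<^sup>2 \<le> (K * T\<^sup>2 * real N)\<^sup>2"
proof -
  have "(bilin_form N A (yv I s e) (yv J s e'))\<^sup>2 \<le> K\<^sup>2 * (\<Sum>i<N. (yv I s e i)\<^sup>2) * (\<Sum>i<N. (yv J s e' i)\<^sup>2)"
    by (rule bilin_form_bound[OF assms])
  also have "\<dots> \<le> K\<^sup>2 * (real N * T\<^sup>2) * (real N * T\<^sup>2)"
    using yv_sum_sq by (intro mult_mono mult_nonneg_nonneg sum_nonneg) auto
  finally show ?thesis by (simp add: power2_eq_square mult_ac)
qed

lemma bilin_yv_abs_bound:
  assumes "op_bound N K A" "K \<ge> 0"
  shows "\<bar>bilin_form N A (yv I s e) (yv J s e')\<bar> \<le> K * T\<^sup>2 * real N"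
proof -
  have "\<bar>bilin_form N A (yv I s e) (yv J s e')\<bar> \<le> \<bar>K * T\<^sup>2 * real N\<bar>"
    unfolding abs_le_square_iff by (rule bilin_yv_bound[OF assms(1)])
  also have "\<bar>K * T\<^sup>2 * real N\<bar> = K * T\<^sup>2 * real N" using assms(2) by (intro abs_of_nonneg mult_nonneg_nonneg) auto
  finally show ?thesis .
qed

lemma measurable_bilin_yv [measurable]:
  "(\<lambda>(e1, e2). bilin_form N A (yv I s e1) (yv J s e2)) \<in> borel_measurable (seqs \<Otimes>\<^sub>M seqs)"
  unfolding bilin_form_def by measurable

lemma measurable_bilin_yv_diag [measurable]:
  "(\<lambda>e. bilin_form N A (yv I s e) (yv J s e)) \<in> borel_measurable seqs"
  unfolding bilin_form_def by measurable

lemma yv_cong_le: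
  assumes "\<And>i. i \<in> I \<Longrightarrow> s + int i + int m \<le> c" "\<And>i. i \<le> c \<Longrightarrow> e i = e' i"
  shows "yv I s e = yv I s e'"
proof
  fix i show "yv I s e i = yv I s e' i"
  proof (cases "i \<in> I")
    case True
    then have "Y (s + int i) e = Y (s + int i) e'" using assms(1)[OF True] by (intro Y_win assms(2)) linarith
    then show ?thesis by (simp add: yv_def)
  qed (simp add: yv_def)
qed

lemma yv_cong_ge:
  assumes "\<And>i. i \<in> I \<Longrightarrow> c \<le> s + int i - int m" "\<And>i. i \<ge> c \<Longrightarrow> e i = e' i"
  shows "yv I s e = yv I s e'"
proof
  fix i show "yv I s e i = yv I s e' i"
  proof (cases "i \<in> I")
    case True
    then have "Y (s + int i) e = Y (s + int i) e'" using assms(1)[OF True] by (intro Y_win assms(2)) linarith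
    then show ?thesis by (simp add: yv_def)
  qed (simp add: yv_def)
qed

text \<open>After decoupling, the block \<open>I\<close> is frozen and the form is linear in the
  block \<open>J\<close>, with a coefficient vector \<open>w\<close> of squared norm at most
  \<open>K\<^sup>2 * (real N * T\<^sup>2)\<close>. Its second moment is then governed by the
  Hilbert-Schmidt bound \<open>F\<close> on the covariance matrix; this is where decaying
  covariances beat the size of the form.\<close>

lemma offdiag_second_moment:
  assumes A: "op_bound N K A" and q: "q \<ge> 1"
    and I: "\<And>i. i \<in> I \<Longrightarrow> s + int i + int m \<le> c" and J: "\<And>i. i \<in> J \<Longrightarrow> c + int q \<le> s + int i - int m"
    and F: "(\<Sum>i<N. \<Sum>k<N. (\<integral>e. Y (s + int i) e * Y (s + int k) e \<partial>P)\<^sup>2) \<le> F\<^sup>2" "F \<ge> 0"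
  shows "(\<integral>e. (bilin_form N A (yv I s e) (yv J s e))\<^sup>2 \<partial>P) \<le> K\<^sup>2 * T\<^sup>2 * real N * F + (K * T\<^sup>2 * real N)\<^sup>2 * b q"
proof -
  let ?h = "\<lambda>(e1, e2). (bilin_form N A (yv I s e1) (yv J s e2))\<^sup>2"
  have hm: "?h \<in> borel_measurable (seqs \<Otimes>\<^sub>M seqs)" by measurable
  have "\<bar>(\<integral>e. ?h (e, e) \<partial>P) - (\<integral>e1. \<integral>e2. ?h (e1, e2) \<partial>P \<partial>P)\<bar> \<le> (K * T\<^sup>2 * real N)\<^sup>2 * b q"
  proof (rule decouple[OF q hm, where k=c])
    show "\<bar>?h e\<bar> \<le> (K * T\<^sup>2 * real N)\<^sup>2" for e
      using bilin_yv_bound[OF A] by (cases e) simp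
    show "?h (e1, e2) = ?h (e1', e2')"
      if "\<And>j. j \<le> c \<Longrightarrow> e1 j = e1' j" "\<And>j. j \<ge> c + int q \<Longrightarrow> e2 j = e2' j" for e1 e1' e2 e2'
    proof -
      have "yv I s e1 = yv I s e1'" by (rule yv_cong_le[OF I that(1)])
      moreover have "yv J s e2 = yv J s e2'" by (rule yv_cong_ge[OF J that(2)])
      ultimately show ?thesis by simp
    qed
  qed
  moreover have "(\<integral>e1. \<integral>e2. ?h (e1, e2) \<partial>P \<partial>P) \<le> (\<integral>e1. K\<^sup>2 * T\<^sup>2 * real N * F \<partial>P)"
  proof (rule integral_mono')
    fix e1
    define w where "w j = (\<Sum>i<N. A i j * yv I s e1 i)" for j
    have W: "(\<Sum>j<N. (w j)\<^sup>2) \<le> K\<^sup>2 * (real N * T\<^sup>2)"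
    proof -
      have "(\<Sum>j<N. (w j)\<^sup>2) \<le> K\<^sup>2 * (\<Sum>i<N. (yv I s e1 i)\<^sup>2)" unfolding w_def using A by (simp add: op_bound_def)
      also have "\<dots> \<le> K\<^sup>2 * (real N * T\<^sup>2)" by (intro mult_left_mono yv_sum_sq) simp
      finally show ?thesis .
    qed
    have "(\<integral>e2. ?h (e1, e2) \<partial>P) = (\<integral>e2. (\<Sum>j<N. w j * yv J s e2 j)\<^sup>2 \<partial>P)"
      by (simp add: bilin_form_cols w_def)
    also have "\<dots> \<le> (\<Sum>j<N. (w j)\<^sup>2) * F"
    proof (rule second_moment_linear_comb[OF _ _ F(2)])
      show "integrable P (\<lambda>x. yv J s x i * yv J s x k)" for i k
      proof (rule bounded_integrable[where C="T\<^sup>2"])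
        show "\<bar>yv J s x i * yv J s x k\<bar> \<le> T\<^sup>2" for x using Y_mult_bound by (simp add: yv_def)
      qed measurable
      \<comment> \<open>Restriction to \<open>J\<close> either keeps a covariance or replaces it by
        \<open>0\<close>.\<close>
      have "(\<integral>x. yv J s x i * yv J s x k \<partial>P)\<^sup>2 \<le> (\<integral>e. Y (s + int i) e * Y (s + int k) e \<partial>P)\<^sup>2" for i k
        by (cases "i \<in> J"; cases "k \<in> J") (simp_all add: yv_def)
      then have "(\<Sum>i<N. \<Sum>k<N. (\<integral>x. yv J s x i * yv J s x k \<partial>P)\<^sup>2) \<le> (\<Sum>i<N. \<Sum>k<N. (\<integral>e. Y (s + int i) e * Y (s + int k) e \<partial>P)\<^sup>2)"
        by (intro sum_mono)
      then show "(\<Sum>i<N. \<Sum>k<N. (\<integral>x. yv J s x i * yv J s x k \<partial>P)\<^sup>2) \<le> F\<^sup>2" using F(1) by linarith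
    qed
    also have "\<dots> \<le> (K\<^sup>2 * (real N * T\<^sup>2)) * F" by (intro mult_right_mono W F(2))
    finally show "(\<integral>e2. ?h (e1, e2) \<partial>P) \<le> K\<^sup>2 * T\<^sup>2 * real N * F" by (simp add: mult_ac)
    show "0 \<le> K\<^sup>2 * T\<^sup>2 * real N * F" using F(2) by simp
  qed simp
  ultimately show ?thesis by (simp add: prob_space)
qed

text \<open>Under the product law the expectation of the product factorises, so the decoupling error
  bounds the covariance.\<close>

lemma diag_covariance:
  assumes A: "op_bound N K A" and q: "q \<ge> 1" and K: "K \<ge> 0"
    and I: "\<And>i. i \<in> I \<Longrightarrow> s + int i + int m \<le> c" and J: "\<And>i. i \<in> J \<Longrightarrow> c + int q \<le> s + int i - int m"
  shows "(\<integral>e. bilin_form N A (yv I s e) (yv I s e) * bilin_form N A (yv J s e) (yv J s e) \<partial>P)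
     - (\<integral>e. bilin_form N A (yv I s e) (yv I s e) \<partial>P) * (\<integral>e. bilin_form N A (yv J s e) (yv J s e) \<partial>P)
     \<le> (K * T\<^sup>2 * real N)\<^sup>2 * b q"
proof -
  let ?U = "\<lambda>I e. bilin_form N A (yv I s e) (yv I s e)"
  let ?h = "\<lambda>(e1, e2). ?U I e1 * ?U J e2"
  have Ub: "\<bar>?U I e\<bar> \<le> K * T\<^sup>2 * real N" for I e
    by (rule bilin_yv_abs_bound[OF A K])
  have "\<bar>(\<integral>e. ?h (e, e) \<partial>P) - (\<integral>e1. \<integral>e2. ?h (e1, e2) \<partial>P \<partial>P)\<bar> \<le> (K * T\<^sup>2 * real N)\<^sup>2 * b q"
  proof (rule decouple[OF q, where k=c])
    have "(\<lambda>x. ?U I (fst x) * ?U J (snd x)) \<in> borel_measurable (seqs \<Otimes>\<^sub>M seqs)"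
      by (intro borel_measurable_times measurable_compose[OF measurable_fst measurable_bilin_yv_diag]
          measurable_compose[OF measurable_snd measurable_bilin_yv_diag])
    then show "?h \<in> borel_measurable (seqs \<Otimes>\<^sub>M seqs)" by (simp only: case_prod_unfold)
    show "\<bar>?h e\<bar> \<le> (K * T\<^sup>2 * real N)\<^sup>2" for e
    proof -
      have "\<bar>?U I (fst e)\<bar> * \<bar>?U J (snd e)\<bar> \<le> (K * T\<^sup>2 * real N) * (K * T\<^sup>2 * real N)"
        by (intro mult_mono Ub) (use K in auto)
      then show ?thesis by (simp add: case_prod_unfold abs_mult power2_eq_square[of "K * T\<^sup>2 * real N"])
    qed
    show "?h (e1, e2) = ?h (e1', e2')"
      if "\<And>j. j \<le> c \<Longrightarrow> e1 j = e1' j" "\<And>j. j \<ge> c + int q \<Longrightarrow> e2 j = e2' j" for e1 e1' e2 e2'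
    proof -
      have "yv I s e1 = yv I s e1'" by (rule yv_cong_le[OF I that(1)])
      moreover have "yv J s e2 = yv J s e2'" by (rule yv_cong_ge[OF J that(2)])
      ultimately show ?thesis by simp
    qed
  qed
  then show ?thesis by simp
qed

text \<open>The \<open>a\<close>-th block of length \<open>p\<close> without its first \<open>g\<close> indices: these gaps make different blocks almost independent.\<close>

definition blk :: "nat \<Rightarrow> nat \<Rightarrow> nat \<Rightarrow> nat set" where
  "blk p g a = {a * p + g..<a * p + p}"

lemma blk_before: "a < c \<Longrightarrow> i \<in> blk p g a \<Longrightarrow> int i \<le> int (c * p) - 1"
proof -
  assume "a < c" "i \<in> blk p g a"
  then have "i < a * p + p" "Suc a * p \<le> c * p"
    using mult_le_mono1[of "Suc a" c p] by (auto simp: blk_def)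
  then have "i < c * p" by (simp add: add.commute)
  then show "int i \<le> int (c * p) - 1" by linarith
qed

lemma blk_disjoint:
  assumes "a \<noteq> c" shows "blk p g a \<inter> blk p g c = {}"
proof -
  have d: False if "a < c" "i \<in> blk p g a" "i \<in> blk p g c" for a c i
  proof -
    have "c * p \<le> i" using that(3) by (simp add: blk_def)
    then have "int (c * p) \<le> int i" by (simp only: of_nat_le_iff)
    then show False using blk_before[OF that(1,2)] by linarith
  qed
  have "i \<notin> blk p g a \<inter> blk p g c" for i
    using d[of a c i] d[of c a i] assms by (cases "a < c") auto
  then show ?thesis by blast
qed

text \<open>Missing are at most \<open>g\<close> indices in each of the \<open>B\<close> blocks, and
  fewer than \<open>B\<close> indices left over by the division of \<open>N\<close> by
  \<open>B\<close>. If \<open>p < g\<close>, truncated subtraction makes the blocks empty and the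
  count remains valid.\<close>

lemma blocked_vector_error:
  assumes B: "B \<ge> 1" and p: "p = N div B"
  shows "(\<Sum>i<N. (yv UNIV s e i - yv (\<Union>a<B. blk p g a) s e i)\<^sup>2) \<le> real (B * (g + 1)) * T\<^sup>2"
proof -
  define S where "S = (\<Union>a<B. blk p g a)"
  have pB: "p * B \<le> N" by (simp add: p div_times_less_eq_dividend)
  have pB2: "N < p * B + B"
  proof -
    have "N mod B < B" using B by simp
    then show ?thesis using div_mult_mod_eq[of N B] unfolding p by linarith
  qed
  have sub: "S \<subseteq> {..<N}"
  proof
    fix i assume "i \<in> S"
    then obtain a where "a < B" "i \<in> blk p g a" by (auto simp: S_def)
    then have "int i \<le> int (B * p) - 1" by (rule blk_before)
    then have "i < B * p" by linarith
    then show "i \<in> {..<N}" using pB by (simp add: mult.commute)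
  qed
  have "card S = (\<Sum>a<B. card (blk p g a))" unfolding S_def
    by (rule card_UN_disjoint) (use blk_disjoint in \<open>auto simp: blk_def\<close>)
  also have "\<dots> = B * (p - g)" by (simp add: blk_def)
  finally have cS: "card S = B * (p - g)" .
  have "card ({..<N} - S) = N - B * (p - g)"
    using sub cS by (subst card_Diff_subset) (auto intro: finite_subset)
  also have "\<dots> \<le> B * (g + 1)"
  proof -
    have "B * p \<le> B * (p - g + g)" by (rule mult_le_mono2) linarith
    then have "p * B \<le> B * (p - g) + B * g" unfolding add_mult_distrib2 by (simp only: mult.commute[of p B])
    then have "N \<le> B * (p - g) + B * g + B" using pB2 by linarith
    then show ?thesis by (simp add: algebra_simps)
  qed
  finally have c: "card ({..<N} - S) \<le> B * (g + 1)" .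
  have "yv UNIV s e i - yv S s e i = yv (- S) s e i" for i by (simp add: yv_def)
  then have "(\<Sum>i<N. (yv UNIV s e i - yv S s e i)\<^sup>2) = (\<Sum>i<N. (yv ({..<N} - S) s e i)\<^sup>2)"
    by (intro sum.cong) (auto simp: yv_def)
  also have "\<dots> \<le> real (card ({..<N} - S)) * T\<^sup>2" by (rule yv_sum_sq_card) simp
  also have "\<dots> \<le> real (B * (g + 1)) * T\<^sup>2" using c by (intro mult_right_mono) (auto simp del: of_nat_mult of_nat_add)
  finally show ?thesis unfolding S_def .
qed

lemma quad_form_blocks:
  "quad_form N A (yv (\<Union>a<B. blk p g a) s e)
    = (\<Sum>a<B. bilin_form N A (yv (blk p g a) s e) (yv (blk p g a) s e))
      + (\<Sum>x\<in>{(a, c). a < B \<and> c < B \<and> a \<noteq> c}. bilin_form N A (yv (blk p g (fst x)) s e) (yv (blk p g (snd x)) s e))"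
proof -
  let ?y = "\<lambda>a. yv (blk p g a) s e"
  let ?f = "\<lambda>a c. bilin_form N A (?y a) (?y c)"
  have y: "yv (\<Union>a<B. blk p g a) s e = (\<lambda>i. \<Sum>a<B. ?y a i)"
  proof
    fix i
    show "yv (\<Union>a<B. blk p g a) s e i = (\<Sum>a<B. ?y a i)"
    proof (cases "\<exists>a<B. i \<in> blk p g a")
      case True
      then obtain a where a: "a < B" "i \<in> blk p g a" by blast
      have u: "c = a" if "i \<in> blk p g c" for c using blk_disjoint[of a c p g] that a by blast
      have "(\<Sum>c<B. ?y c i) = (\<Sum>c\<in>{a}. ?y c i)"
        using a(1) by (intro sum.mono_neutral_right) (auto simp: yv_def dest: u)
      then show ?thesis using a by (auto simp: yv_def)
    qed (auto simp: yv_def)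
  qed
  have "quad_form N A (yv (\<Union>a<B. blk p g a) s e) = (\<Sum>a<B. \<Sum>c<B. ?f a c)"
    unfolding quad_form_bilin y by (subst bilin_form_sum_left) (simp only: bilin_form_sum_right)
  also have "\<dots> = (\<Sum>x\<in>{..<B} \<times> {..<B}. ?f (fst x) (snd x))"
    by (simp add: sum.cartesian_product case_prod_unfold)
  also have "{..<B} \<times> {..<B} = (\<lambda>a. (a, a)) ` {..<B} \<union> {(a, c). a < B \<and> c < B \<and> a \<noteq> c}" by auto
  also have "(\<Sum>x\<in>\<dots>. ?f (fst x) (snd x)) = (\<Sum>x\<in>(\<lambda>a. (a, a)) ` {..<B}. ?f (fst x) (snd x))
     + (\<Sum>x\<in>{(a, c). a < B \<and> c < B \<and> a \<noteq> c}. ?f (fst x) (snd x))"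
    by (rule sum.union_disjoint) (auto intro: finite_subset[of _ "{..<B} \<times> {..<B}"])
  also have "(\<Sum>x\<in>(\<lambda>a. (a, a)) ` {..<B}. ?f (fst x) (snd x)) = (\<Sum>a<B. ?f a a)"
    by (subst sum.reindex) (auto simp: inj_on_def)
  finally show ?thesis .
qed

text \<open>The form splits into the diagonal blocks \<open>Dg\<close>, the off-diagonal blocks
  \<open>Of\<close> and the error \<open>R\<close> of leaving out the gaps. \<open>Dg\<close> is a
  sum of \<open>B\<close> nearly uncorrelated terms of order \<open>N / B\<close>, so its variance
  is of order \<open>N\<^sup>2 / B\<close>; \<open>Of\<close> has fewer than
  \<open>B\<^sup>2\<close> terms with small second moments; \<open>R\<^sup>2\<close> is of order
  \<open>N\<close>. The weights \<open>4\<close>, \<open>4\<close> and \<open>2\<close> come from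
  using \<open>var_add_le\<close> twice.\<close>

lemma quad_form_variance_bound:
  assumes A: "op_bound N K A" and K: "K \<ge> 0" and q: "q \<ge> 1" and B: "B \<ge> 1"
    and F: "(\<Sum>i<N. \<Sum>k<N. (\<integral>e. Y (s + int i) e * Y (s + int k) e \<partial>P)\<^sup>2) \<le> (\<phi> * real N)\<^sup>2" "\<phi> \<ge> 0"
  shows "var (\<lambda>e. quad_form N A (yv UNIV s e))
    \<le> (4 * K\<^sup>2 * T^4 / real B + 8 * (real B)^4 * K\<^sup>2 * T^4 * b q + 4 * (real B)^4 * K\<^sup>2 * T\<^sup>2 * \<phi>) * (real N)\<^sup>2
      + 8 * K\<^sup>2 * T^4 * real (B * (2 * m + q + 1)) * real N"
proof -
  define p where "p = N div B"
  \<comment> \<open>A window radius on either side plus the mixing gap \<open>q\<close>.\<close>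
  define g where "g = 2 * m + q"
  define y where "y a e = yv (blk p g a) s e" for a e
  define S where "S = (\<Union>a<B. blk p g a)"
  define L where "L = K * T\<^sup>2 * real N"
  define pairs where "pairs = {(a, c). a < B \<and> c < B \<and> a \<noteq> c}"
  define U where "U a e = bilin_form N A (y a e) (y a e)" for a e
  define V where "V x e = bilin_form N A (y (fst x) e) (y (snd x) e)" for x e
  define Dg where "Dg e = (\<Sum>a<B. U a e)" for e
  define Of where "Of e = (\<Sum>x\<in>pairs. V x e)" for e
  define R where "R e = quad_form N A (yv UNIV s e) - quad_form N A (yv S s e)" for e
  have ab: "\<bar>bilin_form N A (yv I s e) (yv J s e)\<bar> \<le> L" for I J e
    unfolding L_def by (rule bilin_yv_abs_bound[OF A K])
  have [measurable]: "U a \<in> borel_measurable seqs" for a unfolding U_def[abs_def] y_def by measurable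
  have [measurable]: "V x \<in> borel_measurable seqs" for x unfolding V_def[abs_def] y_def by measurable
  have [measurable]: "Dg \<in> borel_measurable seqs" "Of \<in> borel_measurable seqs" unfolding Dg_def[abs_def] Of_def[abs_def] by measurable
  have [measurable]: "R \<in> borel_measurable seqs" unfolding R_def[abs_def] quad_form_bilin by measurable
  have Ub: "\<bar>U a e\<bar> \<le> L" for a e unfolding U_def y_def by (rule ab)
  have Vb: "\<bar>V x e\<bar> \<le> L" for x e unfolding V_def y_def by (rule ab)
  have Db: "\<bar>Dg e\<bar> \<le> real B * L" for e
  proof -
    have "(\<Sum>a<B. \<bar>U a e\<bar>) \<le> (\<Sum>a<B. L)" by (intro sum_mono Ub)
    moreover have "(\<Sum>a<B. L) = real B * L" by simp
    ultimately show ?thesis unfolding Dg_def using sum_abs[of "\<lambda>a. U a e" "{..<B}"] by linarith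
  qed
  have Ob: "\<bar>Of e\<bar> \<le> real (card pairs) * L" for e
  proof -
    have "(\<Sum>x\<in>pairs. \<bar>V x e\<bar>) \<le> (\<Sum>x\<in>pairs. L)" by (intro sum_mono Vb)
    moreover have "(\<Sum>x\<in>pairs. L) = real (card pairs) * L" by simp
    ultimately show ?thesis unfolding Of_def using sum_abs[of "\<lambda>x. V x e" pairs] by linarith
  qed
  have Rb: "\<bar>R e\<bar> \<le> 2 * L" for e
    unfolding R_def quad_form_bilin using ab[of UNIV e UNIV] ab[of S e S] by linarith
  \<comment> \<open>\<open>sep\<close> and \<open>sep'\<close> use the same cut, \<open>m\<close>
    after the last time before block \<open>c\<close>: the windows of earlier blocks end there,
    those of block \<open>c\<close> begin at least \<open>q\<close> later.\<close>
  have sep: "s + int i + int m \<le> s + int (c * p) - 1 + int m" if "a < c" "i \<in> blk p g a" for a c i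
    using blk_before[OF that] by linarith
  have sep': "s + int (c * p) - 1 + int m + int q \<le> s + int i - int m" if "i \<in> blk p g c" for c i
  proof -
    have "c * p + (2 * m + q) \<le> i" using that by (simp add: blk_def g_def)
    then show ?thesis by linarith
  qed
  have fin: "finite pairs" "real (card pairs) \<le> (real B)\<^sup>2"
  proof -
    have sub: "pairs \<subseteq> {..<B} \<times> {..<B}" by (auto simp: pairs_def)
    then show "finite pairs" by (rule finite_subset) simp
    have "card pairs \<le> B * B" using card_mono[OF _ sub] by simp
    then have "real (card pairs) \<le> real (B * B)" by (rule of_nat_mono)
    then show "real (card pairs) \<le> (real B)\<^sup>2" by (simp add: power2_eq_square)
  qed
  have V2: "(\<integral>e. (V x e)\<^sup>2 \<partial>P) \<le> K\<^sup>2 * T\<^sup>2 * real N * (\<phi> * real N) + L\<^sup>2 * b q" if x: "x \<in> pairs" for x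
  proof -
    obtain a c where ac: "x = (a, c)" "a \<noteq> c" using x by (auto simp: pairs_def)
    have f0: "\<phi> * real N \<ge> 0" using F by simp
    show ?thesis
    proof (cases "a < c")
      case True
      show ?thesis unfolding V_def y_def ac fst_conv snd_conv L_def
        by (rule offdiag_second_moment[OF A q sep[OF True] sep' F(1) f0])
    next
      case False
      then have ca: "c < a" using ac by simp
      show ?thesis unfolding V_def y_def ac fst_conv snd_conv L_def
        by (subst bilin_form_transpose) (rule offdiag_second_moment[OF op_bound_transpose[OF A] q sep[OF ca] sep' F(1) f0])
    qed
  qed
  have V2i: "integrable P (\<lambda>e. (V x e)\<^sup>2)" for x
    by (rule bounded_integrable[where C="L\<^sup>2"]) (use Vb square_bound in auto)
  have "var Of \<le> (\<integral>e. (Of e)\<^sup>2 \<partial>P)" by (rule var_le_second_moment[OF _ Ob]) measurable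
  also have "\<dots> \<le> (\<integral>e. (\<Sum>x\<in>pairs. (V x e)\<^sup>2) * real (card pairs) \<partial>P)"
    by (rule integral_mono') (use V2i in \<open>auto simp: Of_def intro!: sum_squared_le_sum_of_squares mult_nonneg_nonneg sum_nonneg Bochner_Integration.integrable_sum\<close>)
  also have "\<dots> = (\<Sum>x\<in>pairs. (\<integral>e. (V x e)\<^sup>2 \<partial>P)) * real (card pairs)"
    using V2i by (simp add: Bochner_Integration.integral_sum)
  also have "\<dots> \<le> (real (card pairs) * (K\<^sup>2 * T\<^sup>2 * real N * (\<phi> * real N) + L\<^sup>2 * b q)) * real (card pairs)"
    using sum_mono[of pairs "\<lambda>x. (\<integral>e. (V x e)\<^sup>2 \<partial>P)", OF V2] by (intro mult_right_mono) auto
  also have "\<dots> = (real (card pairs))\<^sup>2 * (K\<^sup>2 * T\<^sup>2 * real N * (\<phi> * real N) + L\<^sup>2 * b q)"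
    by (simp add: power2_eq_square mult_ac)
  also have "\<dots> \<le> ((real B)\<^sup>2)\<^sup>2 * (K\<^sup>2 * T\<^sup>2 * real N * (\<phi> * real N) + L\<^sup>2 * b q)"
    using fin F b_nonneg by (intro mult_right_mono power_mono add_nonneg_nonneg mult_nonneg_nonneg) auto
  finally have vO: "var Of \<le> (real B)^4 * (K\<^sup>2 * T\<^sup>2 * real N * (\<phi> * real N) + L\<^sup>2 * b q)"
    by (simp add: power_mult[symmetric])
  have pN: "real p * real B \<le> real N"
    unfolding p_def of_nat_mult[symmetric] of_nat_le_iff by (rule div_times_less_eq_dividend)
  \<comment> \<open>The length \<open>p\<close> of a block takes the place of \<open>N\<close>; this
    produces the factor \<open>1 / B\<close> in the variance of \<open>Dg\<close>.\<close>
  have Up: "\<bar>U a e\<bar> \<le> K * T\<^sup>2 * real p" for a e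
  proof -
    have "card (blk p g a) \<le> p" by (simp add: blk_def)
    then have sq: "(\<Sum>i<N. (y a e i)\<^sup>2) \<le> real p * T\<^sup>2"
      unfolding y_def by (intro order_trans[OF yv_sum_sq_card] mult_right_mono) (auto simp: blk_def)
    have "(U a e)\<^sup>2 \<le> K\<^sup>2 * (\<Sum>i<N. (y a e i)\<^sup>2) * (\<Sum>i<N. (y a e i)\<^sup>2)"
      unfolding U_def by (rule bilin_form_bound[OF A])
    also have "\<dots> \<le> K\<^sup>2 * (real p * T\<^sup>2) * (real p * T\<^sup>2)"
      using sq by (intro mult_mono mult_nonneg_nonneg sum_nonneg) auto
    also have "\<dots> = (K * T\<^sup>2 * real p)\<^sup>2" by (simp add: power2_eq_square mult_ac)
    finally have "\<bar>U a e\<bar> \<le> \<bar>K * T\<^sup>2 * real p\<bar>" by (simp only: abs_le_square_iff)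
    then show ?thesis using K by simp
  qed
  have vD: "var Dg \<le> real B * (K * T\<^sup>2 * real p)\<^sup>2 + (real B)\<^sup>2 * (L\<^sup>2 * b q)"
    unfolding Dg_def[abs_def]
  proof (rule var_sum_le)
    show "U a \<in> borel_measurable P" for a by measurable
    show "\<bar>U a x\<bar> \<le> L" for a x by (rule Ub)
    show "var (U a) \<le> (K * T\<^sup>2 * real p)\<^sup>2" for a by (rule var_le_bound[OF _ Up]) measurable
    show "(\<integral>x. U a x * U c x \<partial>P) - (\<integral>x. U a x \<partial>P) * (\<integral>x. U c x \<partial>P) \<le> L\<^sup>2 * b q" if "a < c" for a c
      unfolding U_def y_def L_def by (rule diag_covariance[OF A q K sep[OF that] sep'])
    show "0 \<le> L\<^sup>2 * b q" using b_nonneg by simp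
  qed simp
  have "real B * (K * T\<^sup>2 * real p)\<^sup>2 \<le> K\<^sup>2 * T^4 / real B * (real N)\<^sup>2"
  proof -
    have "(real p * real B)\<^sup>2 \<le> (real N)\<^sup>2" using pN by (intro power_mono) auto
    then have "(K\<^sup>2 * T^4 / real B) * (real p * real B)\<^sup>2 \<le> (K\<^sup>2 * T^4 / real B) * (real N)\<^sup>2"
      by (intro mult_left_mono) auto
    moreover have "(K\<^sup>2 * T^4 / real B) * (real p * real B)\<^sup>2 = real B * (K * T\<^sup>2 * real p)\<^sup>2"
      using B by (simp add: power2_eq_square power4_eq_xxxx)
    ultimately show ?thesis by simp
  qed
  with vD have vD': "var Dg \<le> K\<^sup>2 * T^4 / real B * (real N)\<^sup>2 + (real B)\<^sup>2 * (L\<^sup>2 * b q)" by linarith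
  have R2: "(R e)\<^sup>2 \<le> 4 * K\<^sup>2 * T^4 * real (B * (g + 1)) * real N" for e
  proof -
    have "(R e)\<^sup>2 \<le> 2 * K\<^sup>2 * (\<Sum>i<N. (yv UNIV s e i - yv S s e i)\<^sup>2) * ((\<Sum>i<N. (yv UNIV s e i)\<^sup>2) + (\<Sum>i<N. (yv S s e i)\<^sup>2))"
      unfolding R_def by (rule quad_form_diff_bound[OF A])
    also have "\<dots> \<le> 2 * K\<^sup>2 * (real (B * (g + 1)) * T\<^sup>2) * (real N * T\<^sup>2 + real N * T\<^sup>2)"
      unfolding S_def using blocked_vector_error[OF B p_def]
      by (intro mult_mono mult_nonneg_nonneg add_nonneg_nonneg sum_nonneg add_mono yv_sum_sq order_refl mult_left_mono) auto
    also have "\<dots> = 4 * K\<^sup>2 * T^4 * real (B * (g + 1)) * real N"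
      by (simp add: power2_eq_square power4_eq_xxxx)
    finally show ?thesis .
  qed
  have "var R \<le> (\<integral>e. (R e)\<^sup>2 \<partial>P)" by (rule var_le_second_moment[OF _ Rb]) measurable
  also have "\<dots> \<le> (\<integral>e. 4 * K\<^sup>2 * T^4 * real (B * (g + 1)) * real N \<partial>P)"
    by (rule integral_mono') (use R2 in auto)
  finally have vR: "var R \<le> 4 * K\<^sup>2 * T^4 * real (B * (g + 1)) * real N" by (simp add: prob_space)
  have eq: "quad_form N A (yv UNIV s e) = (Dg e + Of e) + R e" for e
    using quad_form_blocks[of N A p g B s e] unfolding Dg_def Of_def R_def S_def U_def V_def y_def pairs_def by simp
  have DO: "\<bar>Dg e + Of e\<bar> \<le> real B * L + real (card pairs) * L" for e using Db[of e] Ob[of e] by linarith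
  have "var (\<lambda>e. quad_form N A (yv UNIV s e)) \<le> 2 * var (\<lambda>e. Dg e + Of e) + 2 * var R"
    unfolding eq by (rule var_add_le[OF _ DO _ Rb]) measurable
  also have "var (\<lambda>e. Dg e + Of e) \<le> 2 * var Dg + 2 * var Of"
    by (rule var_add_le[OF _ Db _ Ob]) measurable
  finally have main: "var (\<lambda>e. quad_form N A (yv UNIV s e)) \<le> 4 * var Dg + 4 * var Of + 2 * var R" by simp
  have B24: "(real B)\<^sup>2 \<le> (real B)^4" using B by (intro power_increasing) auto
  have Lb0: "L\<^sup>2 * b q \<ge> 0" using b_nonneg by simp
  have "4 * var Dg + 4 * var Of + 2 * var R \<le> 4 * (K\<^sup>2 * T^4 / real B * (real N)\<^sup>2 + (real B)^4 * (L\<^sup>2 * b q))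
     + 4 * ((real B)^4 * (K\<^sup>2 * T\<^sup>2 * real N * (\<phi> * real N) + L\<^sup>2 * b q)) + 2 * (4 * K\<^sup>2 * T^4 * real (B * (g + 1)) * real N)"
  proof -
    \<comment> \<open>Stated for variables, so that the arithmetic does not expand the large
      terms.\<close>
    have "4 * a + 4 * o' + 2 * r \<le> 4 * (x + y) + 4 * w + 2 * u" if "a \<le> x + z" "z \<le> y" "o' \<le> w" "r \<le> u"
      for a o' r x y z w u :: real
    proof -
      have "a \<le> x + y" using that(1,2) by linarith
      then show ?thesis using that(3,4) by (intro add_mono mult_left_mono) auto
    qed
    from this[OF vD' mult_right_mono[OF B24 Lb0] vO vR] show ?thesis .
  qed
  also have "\<dots> = (4 * K\<^sup>2 * T^4 / real B + 8 * (real B)^4 * K\<^sup>2 * T^4 * b q + 4 * (real B)^4 * K\<^sup>2 * T\<^sup>2 * \<phi>) * (real N)\<^sup>2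
      + 8 * K\<^sup>2 * T^4 * real (B * (2 * m + q + 1)) * real N"
  proof -
    have "L\<^sup>2 = K\<^sup>2 * T^4 * (real N)\<^sup>2" by (simp add: L_def power_mult_distrib power_mult[symmetric])
    then show ?thesis unfolding g_def by (simp add: algebra_simps power2_eq_square[of "real N"])
  qed
  finally show ?thesis using main by linarith
qed

text \<open>Each of the four terms of \<open>quad_form_variance_bound\<close> gets a quarter of
  \<open>\<delta>\<close>: \<open>B\<close> is chosen first, \<open>q\<close> and
  \<open>\<phi>\<close> depend on it, and \<open>N\<close> is large in terms of all three. The
  threshold is uniform in \<open>s\<close> and \<open>A\<close>, as random resolvents at varying
  columns require.\<close>

lemma quad_form_concentration:
  assumes K: "K \<ge> 0" and \<delta>: "\<delta> > 0"
  shows "\<exists>N0. \<forall>N\<ge>N0. \<forall>s A. op_bound N K A \<longrightarrow> var (\<lambda>e. quad_form N A (\<lambda>i. Y (s + int i) e)) \<le> \<delta> * (real N)\<^sup>2"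
proof -
  define G where "G = K\<^sup>2 * T^4"
  obtain B' :: nat where B': "16 * G / \<delta> \<le> real B'" using real_arch_simple[of "16 * G / \<delta>"] by (elim exE) (rule that)
  define B where "B = Suc B'"
  have B: "B \<ge> 1" by (simp add: B_def)
  have 1: "4 * G / real B \<le> \<delta> / 4"
  proof -
    have "16 * G / \<delta> \<le> real B" using B' by (simp add: B_def)
    then have "16 * G \<le> real B * \<delta>" using \<delta> by (simp add: pos_divide_le_eq)
    then show ?thesis using B by (simp add: pos_divide_le_eq mult.commute)
  qed
  have "(\<lambda>q. 8 * (real B)^4 * G * b q) \<longlonglongrightarrow> 0" using tendsto_mult[OF tendsto_const b_lim, of "8 * (real B)^4 * G"] by simp
  then have "eventually (\<lambda>q. 8 * (real B)^4 * G * b q < \<delta> / 4) sequentially" by (rule order_tendstoD) (use \<delta> in simp)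
  then obtain q0 where "\<And>q. q \<ge> q0 \<Longrightarrow> 8 * (real B)^4 * G * b q < \<delta> / 4" by (auto simp: eventually_sequentially)
  then have q: "8 * (real B)^4 * G * b (Suc q0) \<le> \<delta> / 4" by (intro less_imp_le) simp
  define q where "q = Suc q0"
  define H where "H = 4 * (real B)^4 * K\<^sup>2 * T\<^sup>2"
  have H0: "H \<ge> 0" by (simp add: H_def)
  define \<phi> where "\<phi> = \<delta> / 4 / (H + 1)"
  have \<phi>: "\<phi> > 0" using \<delta> H0 by (simp add: \<phi>_def)
  have 3: "H * \<phi> \<le> \<delta> / 4"
  proof -
    have "H * \<phi> \<le> (H + 1) * \<phi>" using \<phi> by (intro mult_right_mono) auto
    also have "\<dots> = \<delta> / 4"
    proof -
      show ?thesis unfolding \<phi>_def by (rule mult_divide_self) (use H0 in simp)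
    qed
    finally show ?thesis .
  qed
  from cov_gram_small[OF \<phi>]
  obtain N1 where N1': "\<forall>N\<ge>N1. \<forall>s. (\<Sum>i<N. \<Sum>k<N. (\<integral>e. Y (s + int i) e * Y (s + int k) e \<partial>P)\<^sup>2) \<le> (\<phi> * real N)\<^sup>2" by (elim exE) (rule that)
  note N1 = N1'[rule_format]
  define E where "E = 8 * G * real (B * (2 * m + q + 1))"
  obtain N2 :: nat where N2: "4 * E / \<delta> \<le> real N2" using real_arch_simple[of "4 * E / \<delta>"] by (elim exE) (rule that)
  show ?thesis
  proof (intro exI[of _ "max N1 N2"] allI impI)
    fix N s A assume N: "max N1 N2 \<le> N" and A: "op_bound N K A"
    have q1: "q \<ge> 1" by (simp add: q_def)
    have "4 * E / \<delta> \<le> real N" using N2 N by linarith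
    then have "4 * E \<le> real N * \<delta>" using \<delta> by (simp add: pos_divide_le_eq)
    then have "E \<le> \<delta> / 4 * real N" by (simp add: mult.commute)
    then have 4: "E * real N \<le> \<delta> / 4 * real N * real N" by (rule mult_right_mono) simp
    have "var (\<lambda>e. quad_form N A (yv UNIV s e))
      \<le> (4 * K\<^sup>2 * T^4 / real B + 8 * (real B)^4 * K\<^sup>2 * T^4 * b q + 4 * (real B)^4 * K\<^sup>2 * T\<^sup>2 * \<phi>) * (real N)\<^sup>2
        + 8 * K\<^sup>2 * T^4 * real (B * (2 * m + q + 1)) * real N"
      by (rule quad_form_variance_bound[OF A K q1 B N1]) (use N \<phi> in auto)
    also have "\<dots> = (4 * G / real B + 8 * (real B)^4 * G * b q + H * \<phi>) * (real N)\<^sup>2 + E * real N"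
      by (simp only: G_def H_def E_def mult.assoc)
    also have "\<dots> \<le> (\<delta> / 4 + \<delta> / 4 + \<delta> / 4) * (real N)\<^sup>2 + \<delta> / 4 * real N * real N"
    proof -
      have "8 * (real B)^4 * G * b q \<le> \<delta> / 4" using q unfolding q_def .
      then have c: "4 * G / real B + 8 * (real B)^4 * G * b q + H * \<phi> \<le> \<delta> / 4 + \<delta> / 4 + \<delta> / 4"
        using 1 3 by linarith
      show ?thesis using mult_right_mono[OF c zero_le_power2[of "real N"]] 4 by linarith
    qed
    also have "\<dots> = \<delta> * (real N)\<^sup>2" by (simp add: power2_eq_square algebra_simps)
    finally show "var (\<lambda>e. quad_form N A (\<lambda>i. Y (s + int i) e)) \<le> \<delta> * (real N)\<^sup>2"
      by (simp add: yv_def[abs_def])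
  qed
qed

end

subsection \<open>Quadratic forms of Gaussian vectors\<close>

text \<open>The sign in front of a power is the product of the signs inside. This cancels every
  monomial that is not odd in each of \<open>b\<close>, \<open>c\<close>, \<open>d\<close>; what
  remains is \<open>a * b * c * d\<close>, with coefficient \<open>24\<close> in each of the
  \<open>8\<close> powers, up to sign.\<close>

lemma polarization_4:
  fixes a b c d :: real
  shows "192 * (a * b * c * d) =
    (a + b + c + d)^4 - (a + b + c - d)^4 - (a + b - c + d)^4 + (a + b - c - d)^4
    - (a - b + c + d)^4 + (a - b + c - d)^4 + (a - b - c + d)^4 - (a - b - c - d)^4"
proof -
  \<comment> \<open>Pairing the terms that differ in the sign of \<open>d\<close> keeps the
    polynomials small.\<close>
  have e: "(p + d)^4 - (p - d)^4 = 8 * p * d * (p\<^sup>2 + d\<^sup>2)" for p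
    by (simp add: power4_eq_xxxx power2_eq_square algebra_simps)
  have "8 * (a + b + c) * d * ((a + b + c)\<^sup>2 + d\<^sup>2) - 8 * (a + b - c) * d * ((a + b - c)\<^sup>2 + d\<^sup>2)
    - 8 * (a - b + c) * d * ((a - b + c)\<^sup>2 + d\<^sup>2) + 8 * (a - b - c) * d * ((a - b - c)\<^sup>2 + d\<^sup>2)
    = 192 * (a * b * c * d)"
    by (simp add: power2_eq_square algebra_simps)
  then show ?thesis unfolding e[symmetric] by linarith
qed

text \<open>The counterpart of \<open>polarization_4\<close> for squared variances: for signs
  \<open>r\<close>, \<open>s\<close>, \<open>t\<close>, \<open>V r s t\<close> is the variance of
  the signed combination, with \<open>S\<close> the sum of the four single variances. Complementary
  pairs of covariances survive, and \<open>3 * 64 / 192 = 1\<close> is the normalisation in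
  \<open>isserlis\<close>.\<close>

lemma polarization_cov:
  fixes S ab ac ad bc bd cd :: real
  defines "V \<equiv> \<lambda>r s t. S + 2 * (r * ab + s * ac + t * ad + r * s * bc + r * t * bd + s * t * cd)"
  shows "(V 1 1 1)\<^sup>2 - (V 1 1 (-1))\<^sup>2 - (V 1 (-1) 1)\<^sup>2 + (V 1 (-1) (-1))\<^sup>2
    - (V (-1) 1 1)\<^sup>2 + (V (-1) 1 (-1))\<^sup>2 + (V (-1) (-1) 1)\<^sup>2 - (V (-1) (-1) (-1))\<^sup>2
    = 64 * (ab * cd + ac * bd + ad * bc)"
proof -
  define p where "p r s = S + 2 * (r * ab + s * ac + r * s * bc)" for r s
  define q where "q r s = 2 * (ad + r * bd + s * cd)" for r s
  have V: "V r s 1 = p r s + q r s" "V r s (-1) = p r s - q r s" for r s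
    by (simp_all add: V_def p_def q_def algebra_simps)
  have e: "(x + y)\<^sup>2 - (x - y)\<^sup>2 = 4 * (x * y)" for x y :: real
    by (simp add: power2_eq_square algebra_simps)
  have "4 * (p 1 1 * q 1 1) - 4 * (p 1 (-1) * q 1 (-1)) - 4 * (p (-1) 1 * q (-1) 1) + 4 * (p (-1) (-1) * q (-1) (-1))
    = 64 * (ab * cd + ac * bd + ad * bc)"
    by (simp add: p_def q_def algebra_simps)
  then show ?thesis unfolding V e[symmetric] by linarith
qed

lemma double_sum_mult:
  fixes f g :: "nat \<Rightarrow> nat \<Rightarrow> real"
  shows "(\<Sum>a<N. \<Sum>b<N. f a b) * (\<Sum>c<N. \<Sum>d<N. g c d) = (\<Sum>a<N. \<Sum>b<N. \<Sum>c<N. \<Sum>d<N. f a b * g c d)"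
proof -
  define G where "G = (\<Sum>c<N. \<Sum>d<N. g c d)"
  have "(\<Sum>a<N. \<Sum>b<N. f a b) * G = (\<Sum>a<N. \<Sum>b<N. f a b * G)" by (simp only: sum_distrib_right)
  also have "\<dots> = (\<Sum>a<N. \<Sum>b<N. \<Sum>c<N. \<Sum>d<N. f a b * g c d)"
    unfolding G_def by (simp only: sum_distrib_left)
  finally show ?thesis unfolding G_def .
qed

context prob_space begin

text \<open>Written in terms of the second moment, so that the parameters \<open>\<mu>\<close> and
  \<open>v\<close>, which \<open>centered_gaussian_process\<close> only asserts to exist, disappear.
  The degenerate law \<open>v = 0\<close> has no density and is treated apart.\<close>

lemma gaussian_fourth_moment:
  assumes "gaussian_rv M L \<mu> v" and mean: "(\<integral>x. L x \<partial>M) = 0"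
  shows "integrable M (\<lambda>x. (L x)^4)" "(\<integral>x. (L x)^4 \<partial>M) = 3 * (\<integral>x. (L x)\<^sup>2 \<partial>M)\<^sup>2"
proof -
  have Lm[measurable]: "L \<in> borel_measurable M" using assms by (simp add: gaussian_rv_def)
  have "integrable M (\<lambda>x. (L x)^4) \<and> (\<integral>x. (L x)^4 \<partial>M) = 3 * (\<integral>x. (L x)\<^sup>2 \<partial>M)\<^sup>2"
  proof (cases "v = 0")
    case True
    then have ae: "AE x in M. L x = \<mu>" using assms by (simp add: gaussian_rv_def)
    have "(\<integral>x. L x \<partial>M) = (\<integral>x. \<mu> \<partial>M)" by (rule integral_cong_AE) (use ae in auto)
    then have mu: "\<mu> = 0" using mean by (simp add: prob_space)
    have z: "AE x in M. (L x)^4 = 0" "AE x in M. (L x)\<^sup>2 = 0" using ae mu by auto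
    have "integrable M (\<lambda>x. (L x)^4) \<longleftrightarrow> integrable M (\<lambda>x. 0::real)" by (rule integrable_cong_AE) (use z in auto)
    moreover have "(\<integral>x. (L x)^4 \<partial>M) = (\<integral>x. 0 \<partial>M)" by (rule integral_cong_AE) (use z in auto)
    moreover have "(\<integral>x. (L x)\<^sup>2 \<partial>M) = (\<integral>x. 0 \<partial>M)" by (rule integral_cong_AE) (use z in auto)
    ultimately show ?thesis by simp
  next
    case False
    then have v: "v > 0" and D: "distributed M lborel L (normal_density \<mu> (sqrt v))"
      using assms by (auto simp: gaussian_rv_def)
    have sv: "sqrt v > 0" using v by simp
    have mu: "\<mu> = 0" using normal_distributed_expectation[OF sv D] mean by simp
    have D0: "distributed M lborel L (\<lambda>x. ennreal (normal_density 0 (sqrt v) x))" using D unfolding mu .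
    have mom: "has_bochner_integral lborel (\<lambda>x. normal_density 0 (sqrt v) x * x^4) (3 * v\<^sup>2)"
      using normal_moment_even[OF sv, of 0 2] v by (simp add: fact_numeral power_divide power2_eq_square field_simps)
    have mom2: "has_bochner_integral lborel (\<lambda>x. normal_density 0 (sqrt v) x * x\<^sup>2) v"
      using normal_moment_even[OF sv, of 0 1] v by (simp add: fact_numeral)
    have nn: "\<And>x. x \<in> space lborel \<Longrightarrow> 0 \<le> normal_density 0 (sqrt v) x" by simp
    have "integrable M (\<lambda>x. (L x)^4)"
      using distributed_integrable[OF D0 _ nn, of "\<lambda>x. x^4"] mom by (auto simp: has_bochner_integral_iff)
    moreover have "(\<integral>x. (L x)^4 \<partial>M) = 3 * v\<^sup>2"
      using distributed_integral[OF D0 _ nn, of "\<lambda>x. x^4"] mom by (auto simp: has_bochner_integral_iff)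
    moreover have "(\<integral>x. (L x)\<^sup>2 \<partial>M) = v"
      using distributed_integral[OF D0 _ nn, of "\<lambda>x. x\<^sup>2"] mom2 by (auto simp: has_bochner_integral_iff)
    ultimately show ?thesis by simp
  qed
  then show "integrable M (\<lambda>x. (L x)^4)" "(\<integral>x. (L x)^4 \<partial>M) = 3 * (\<integral>x. (L x)\<^sup>2 \<partial>M)\<^sup>2" by auto
qed

lemma square_integrable_mult:
  fixes f g :: "'a \<Rightarrow> real"
  assumes [measurable]: "f \<in> borel_measurable M" "g \<in> borel_measurable M"
    and "integrable M (\<lambda>x. (f x)\<^sup>2)" "integrable M (\<lambda>x. (g x)\<^sup>2)"
  shows "integrable M (\<lambda>x. f x * g x)"
proof (rule Bochner_Integration.integrable_bound[of _ "\<lambda>x. (f x)\<^sup>2 + (g x)\<^sup>2"])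
  show "AE x in M. norm (f x * g x) \<le> norm ((f x)\<^sup>2 + (g x)\<^sup>2)"
  proof (intro AE_I2)
    fix x
    have "2 * (\<bar>f x\<bar> * \<bar>g x\<bar>) \<le> (f x)\<^sup>2 + (g x)\<^sup>2"
      using sum_squares_bound[of "\<bar>f x\<bar>" "\<bar>g x\<bar>"] by simp
    moreover have "0 \<le> \<bar>f x\<bar> * \<bar>g x\<bar>" by simp
    ultimately have "\<bar>f x\<bar> * \<bar>g x\<bar> \<le> (f x)\<^sup>2 + (g x)\<^sup>2" by linarith
    then show "norm (f x * g x) \<le> norm ((f x)\<^sup>2 + (g x)\<^sup>2)" by (simp add: abs_mult)
  qed
qed (use assms in auto)

lemma centered_gaussian_measurable:
  assumes "centered_gaussian_process M Z"
  shows "Z k \<in> borel_measurable M"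
proof -
  obtain \<mu> v where "gaussian_rv M (\<lambda>\<omega>. \<Sum>l\<in>{k}. (\<lambda>_. 1) l * Z l \<omega>) \<mu> v"
    using assms[unfolded centered_gaussian_process_def, THEN conjunct1, rule_format, of "{k}" "\<lambda>_. 1"] by auto
  then show ?thesis by (simp add: gaussian_rv_def)
qed

lemma centered_gaussian_comb:
  fixes i j k l :: int
  assumes G: "centered_gaussian_process M Z" and Z2: "\<And>k. integrable M (\<lambda>x. (Z k x)\<^sup>2)"
  defines "L \<equiv> \<lambda>r s t x. Z i x + r * Z j x + s * Z k x + t * Z l x"
    and "C \<equiv> \<lambda>a b. \<integral>x. Z a x * Z b x \<partial>M"
  shows "integrable M (\<lambda>x. (L r s t x)^4)"
    "(\<integral>x. (L r s t x)^4 \<partial>M) = 3 * (C i i + r\<^sup>2 * C j j + s\<^sup>2 * C k k + t\<^sup>2 * C l l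
       + 2 * (r * C i j + s * C i k + t * C i l + r * s * C j k + r * t * C j l + s * t * C k l))\<^sup>2"
proof -
  have Zm[measurable]: "Z k \<in> borel_measurable M" for k by (rule centered_gaussian_measurable[OF G])
  have ZZ: "integrable M (\<lambda>x. Z a x * Z b x)" for a b by (rule square_integrable_mult[OF Zm Zm Z2 Z2])
  have Z1: "integrable M (Z a)" "(\<integral>x. Z a x \<partial>M) = 0" for a
    using G unfolding centered_gaussian_process_def by simp_all
  let ?I = "{i, j, k, l}"
  \<comment> \<open>The four indices may coincide, while the definition of a Gaussian process speaks
    of sums over sets of indices; coefficients of equal indices are therefore added up.\<close>
  define c where "c x = of_bool (x = i) + r * of_bool (x = j) + s * of_bool (x = k) + t * of_bool (x = l)" for x
  have pick: "(\<Sum>a\<in>?I. of_bool (a = b) * Z a x) = Z b x" if "b \<in> ?I" for b x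
  proof -
    have "(\<Sum>a\<in>?I. of_bool (a = b) * Z a x) = (\<Sum>a\<in>{b}. of_bool (a = b) * Z a x)"
      using that by (intro sum.mono_neutral_right) auto
    then show ?thesis by simp
  qed
  have Lc: "L r s t x = (\<Sum>a\<in>?I. c a * Z a x)" for x
  proof -
    have "(\<Sum>a\<in>?I. c a * Z a x) = (\<Sum>a\<in>?I. of_bool (a = i) * Z a x) + r * (\<Sum>a\<in>?I. of_bool (a = j) * Z a x)
      + s * (\<Sum>a\<in>?I. of_bool (a = k) * Z a x) + t * (\<Sum>a\<in>?I. of_bool (a = l) * Z a x)"
      unfolding c_def distrib_right sum.distrib sum_distrib_left by (simp only: mult.assoc)
    then show ?thesis using pick[of i x] pick[of j x] pick[of k x] pick[of l x] by (simp only: insert_iff simp_thms L_def)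
  qed
  have fin: "finite ?I" by simp
  obtain \<mu> v where "gaussian_rv M (\<lambda>\<omega>. \<Sum>a\<in>?I. c a * Z a \<omega>) \<mu> v"
    using G[unfolded centered_gaussian_process_def, THEN conjunct1, rule_format, OF fin, of c] by (elim exE) (rule that)
  then have g: "gaussian_rv M (L r s t) \<mu> v" by (simp only: Lc[symmetric])
  have L0: "(\<integral>x. L r s t x \<partial>M) = 0" unfolding L_def using Z1 by simp
  have L2: "(\<integral>x. (L r s t x)\<^sup>2 \<partial>M) = C i i + r\<^sup>2 * C j j + s\<^sup>2 * C k k + t\<^sup>2 * C l l
       + 2 * (r * C i j + s * C i k + t * C i l + r * s * C j k + r * t * C j l + s * t * C k l)"
  proof -
    have e: "(L r s t x)\<^sup>2 = Z i x * Z i x + r\<^sup>2 * (Z j x * Z j x) + s\<^sup>2 * (Z k x * Z k x) + t\<^sup>2 * (Z l x * Z l x)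
       + 2 * (r * (Z i x * Z j x) + s * (Z i x * Z k x) + t * (Z i x * Z l x) + r * s * (Z j x * Z k x) + r * t * (Z j x * Z l x) + s * t * (Z k x * Z l x))" for x
      unfolding L_def by (simp add: power2_eq_square algebra_simps)
    show ?thesis unfolding e C_def using ZZ by simp
  qed
  show "integrable M (\<lambda>x. (L r s t x)^4)" by (rule gaussian_fourth_moment(1)[OF g L0])
  show "(\<integral>x. (L r s t x)^4 \<partial>M) = 3 * (C i i + r\<^sup>2 * C j j + s\<^sup>2 * C k k + t\<^sup>2 * C l l
       + 2 * (r * C i j + s * C i k + t * C i l + r * s * C j k + r * t * C j l + s * t * C k l))\<^sup>2"
    unfolding L2[symmetric] by (rule gaussian_fourth_moment(2)[OF g L0])
qed

text \<open>Every signed combination is Gaussian, so its fourth moment is three times its squared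
  variance; the two polarisation identities convert this into the sum over pairings.\<close>

lemma isserlis:
  assumes G: "centered_gaussian_process M Z" and Z2: "\<And>k. integrable M (\<lambda>x. (Z k x)\<^sup>2)"
  defines "C \<equiv> \<lambda>a b. \<integral>x. Z a x * Z b x \<partial>M"
  shows "integrable M (\<lambda>x. Z i x * Z j x * Z k x * Z l x)"
    "(\<integral>x. Z i x * Z j x * Z k x * Z l x \<partial>M) = C i j * C k l + C i k * C j l + C i l * C j k"
proof -
  define L where "L r s t x = (Z i x + r * Z j x + s * Z k x + t * Z l x)^4" for r s t x
  define V where "V r s t = C i i + C j j + C k k + C l l
       + 2 * (r * C i j + s * C i k + t * C i l + r * s * C j k + r * t * C j l + s * t * C k l)" for r s t
  have Li: "integrable M (L r s t)" for r s t
    unfolding L_def[abs_def] by (rule centered_gaussian_comb(1)[OF G Z2])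
  have LV: "(\<integral>x. L r s t x \<partial>M) = 3 * (V r s t)\<^sup>2" if "r\<^sup>2 = 1" "s\<^sup>2 = 1" "t\<^sup>2 = 1" for r s t
    using centered_gaussian_comb(2)[OF G Z2, of i r j s k t l] that unfolding L_def V_def C_def by simp
  have e: "Z i x * Z j x * Z k x * Z l x = (L 1 1 1 x - L 1 1 (-1) x - L 1 (-1) 1 x + L 1 (-1) (-1) x
    - L (-1) 1 1 x + L (-1) 1 (-1) x + L (-1) (-1) 1 x - L (-1) (-1) (-1) x) / 192" for x
    using polarization_4[of "Z i x" "Z j x" "Z k x" "Z l x"] by (simp add: L_def)
  show "integrable M (\<lambda>x. Z i x * Z j x * Z k x * Z l x)"
    unfolding e using Li by (intro integrable_divide Bochner_Integration.integrable_add Bochner_Integration.integrable_diff)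
  have "(\<integral>x. Z i x * Z j x * Z k x * Z l x \<partial>M) = ((\<integral>x. L 1 1 1 x \<partial>M) - (\<integral>x. L 1 1 (-1) x \<partial>M) - (\<integral>x. L 1 (-1) 1 x \<partial>M) + (\<integral>x. L 1 (-1) (-1) x \<partial>M)
    - (\<integral>x. L (-1) 1 1 x \<partial>M) + (\<integral>x. L (-1) 1 (-1) x \<partial>M) + (\<integral>x. L (-1) (-1) 1 x \<partial>M) - (\<integral>x. L (-1) (-1) (-1) x \<partial>M)) / 192"
    unfolding e using Li by simp
  also have "\<dots> = 3 * ((V 1 1 1)\<^sup>2 - (V 1 1 (-1))\<^sup>2 - (V 1 (-1) 1)\<^sup>2 + (V 1 (-1) (-1))\<^sup>2
    - (V (-1) 1 1)\<^sup>2 + (V (-1) 1 (-1))\<^sup>2 + (V (-1) (-1) 1)\<^sup>2 - (V (-1) (-1) (-1))\<^sup>2) / 192"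
    by (simp add: LV)
  also have "\<dots> = 3 * (64 * (C i j * C k l + C i k * C j l + C i l * C j k)) / 192"
    unfolding V_def by (simp only: polarization_cov)
  finally show "(\<integral>x. Z i x * Z j x * Z k x * Z l x \<partial>M) = C i j * C k l + C i k * C j l + C i l * C j k" by simp
qed

lemma isserlis_quad_form_variance:
  fixes U :: "nat \<Rightarrow> 'a \<Rightarrow> real"
  defines "C \<equiv> \<lambda>a b. \<integral>x. U a x * U b x \<partial>M"
  assumes U2: "\<And>a b. integrable M (\<lambda>x. U a x * U b x)"
    and U4: "\<And>a b c d. integrable M (\<lambda>x. U a x * U b x * U c x * U d x)"
    and E4: "\<And>a b c d. (\<integral>x. U a x * U b x * U c x * U d x \<partial>M) = C a b * C c d + C a c * C b d + C a d * C b c"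
    and A: "op_bound N K A"
  shows "var (\<lambda>x. quad_form N A (\<lambda>i. U i x)) \<le> 2 * K\<^sup>2 * (\<Sum>i<N. \<Sum>k<N. (C i k)\<^sup>2)"
    and "integrable M (\<lambda>x. (quad_form N A (\<lambda>i. U i x))\<^sup>2)"
proof -
  define q where "q x = quad_form N A (\<lambda>i. U i x)" for x
  have Csym: "C a b = C b a" for a b by (simp add: C_def mult.commute)
  have q2: "(q x)\<^sup>2 = (\<Sum>a<N. \<Sum>b<N. \<Sum>c<N. \<Sum>d<N. A a b * A c d * (U a x * U b x * U c x * U d x))" for x
    unfolding q_def quad_form_def power2_eq_square double_sum_mult
    by (intro sum.cong refl) (simp only: mult_ac)
  show q2i: "integrable M (\<lambda>x. (quad_form N A (\<lambda>i. U i x))\<^sup>2)"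
    unfolding q_def[symmetric] q2 using U4 by (intro Bochner_Integration.integrable_sum integrable_mult_right)
  have q1: "q x = (\<Sum>a<N. \<Sum>b<N. A a b * (U a x * U b x))" for x
    unfolding q_def quad_form_def by (intro sum.cong refl) (simp only: mult_ac)
  have qi: "integrable M q" unfolding q1[abs_def]
    using U2 by (intro Bochner_Integration.integrable_sum integrable_mult_right)
  have Eq: "(\<integral>x. q x \<partial>M) = (\<Sum>a<N. \<Sum>b<N. A a b * C a b)"
  proof -
    have "(\<integral>x. q x \<partial>M) = (\<integral>x. (\<Sum>a<N. \<Sum>b<N. A a b * (U a x * U b x)) \<partial>M)"
      by (simp only: q1)
    also have "\<dots> = (\<Sum>a<N. \<Sum>b<N. A a b * C a b)"
      unfolding C_def using U2 by (simp add: Bochner_Integration.integral_sum)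
    finally show ?thesis .
  qed
  have Eq2: "(\<integral>x. (q x)\<^sup>2 \<partial>M) = (\<Sum>a<N. \<Sum>b<N. \<Sum>c<N. \<Sum>d<N. A a b * A c d * (C a b * C c d + C a c * C b d + C a d * C b c))"
    unfolding q2 using U4 by (simp add: Bochner_Integration.integral_sum E4)
  define P where "P a d = (\<Sum>b<N. A a b * C b d)" for a d
  define Q where "Q a d = (\<Sum>c<N. A c d * C c a)" for a d
  have t0: "(\<Sum>a<N. \<Sum>b<N. \<Sum>c<N. \<Sum>d<N. A a b * A c d * (C a b * C c d)) = (\<integral>x. q x \<partial>M)\<^sup>2"
    unfolding Eq power2_eq_square double_sum_mult by (intro sum.cong refl) (simp only: mult_ac)
  have t1: "(\<Sum>a<N. \<Sum>b<N. \<Sum>c<N. \<Sum>d<N. A a b * A c d * (C a c * C b d)) = (\<Sum>a<N. \<Sum>d<N. P a d * Q a d)"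
  proof -
    have "(\<Sum>a<N. \<Sum>d<N. P a d * Q a d) = (\<Sum>a<N. \<Sum>d<N. \<Sum>b<N. \<Sum>c<N. A a b * A c d * (C a c * C b d))"
      unfolding P_def Q_def sum_product by (intro sum.cong refl) (simp add: Csym)
    also have "\<dots> = (\<Sum>a<N. \<Sum>b<N. \<Sum>d<N. \<Sum>c<N. A a b * A c d * (C a c * C b d))"
      by (intro sum.cong refl sum.swap)
    also have "\<dots> = (\<Sum>a<N. \<Sum>b<N. \<Sum>c<N. \<Sum>d<N. A a b * A c d * (C a c * C b d))"
      by (intro sum.cong refl sum.swap)
    finally show ?thesis by simp
  qed
  have t2: "(\<Sum>a<N. \<Sum>b<N. \<Sum>c<N. \<Sum>d<N. A a b * A c d * (C a d * C b c)) = (\<Sum>a<N. \<Sum>c<N. P a c * P c a)"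
  proof -
    have "(\<Sum>a<N. \<Sum>c<N. P a c * P c a) = (\<Sum>a<N. \<Sum>c<N. \<Sum>b<N. \<Sum>d<N. A a b * A c d * (C a d * C b c))"
      unfolding P_def sum_product by (intro sum.cong refl) (simp add: Csym)
    also have "\<dots> = (\<Sum>a<N. \<Sum>b<N. \<Sum>c<N. \<Sum>d<N. A a b * A c d * (C a d * C b c))"
      by (intro sum.cong refl sum.swap)
    finally show ?thesis by simp
  qed
  define W where "W = K\<^sup>2 * (\<Sum>i<N. \<Sum>k<N. (C i k)\<^sup>2)"
  have PW: "(\<Sum>a<N. \<Sum>d<N. (P a d)\<^sup>2) \<le> W"
  proof -
    have "(\<Sum>a<N. \<Sum>d<N. (P a d)\<^sup>2) = (\<Sum>d<N. \<Sum>a<N. (P a d)\<^sup>2)" by (rule sum.swap)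
    also have "\<dots> \<le> (\<Sum>d<N. K\<^sup>2 * (\<Sum>b<N. (C b d)\<^sup>2))"
      unfolding P_def using A by (intro sum_mono) (auto simp: op_bound_def)
    also have "\<dots> = W" unfolding W_def sum_distrib_left[symmetric] by (subst sum.swap) simp
    finally show ?thesis .
  qed
  have QW: "(\<Sum>a<N. \<Sum>d<N. (Q a d)\<^sup>2) \<le> W"
  proof -
    have "(\<Sum>a<N. \<Sum>d<N. (Q a d)\<^sup>2) \<le> (\<Sum>a<N. K\<^sup>2 * (\<Sum>c<N. (C c a)\<^sup>2))"
      unfolding Q_def using A by (intro sum_mono) (auto simp: op_bound_def)
    also have "\<dots> = W" unfolding W_def sum_distrib_left[symmetric] by (subst sum.swap) simp
    finally show ?thesis .
  qed
  have amgm: "(\<Sum>a<N. \<Sum>d<N. f a d * g a d) \<le> W"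
    if "(\<Sum>a<N. \<Sum>d<N. (f a d)\<^sup>2) \<le> W" "(\<Sum>a<N. \<Sum>d<N. (g a d)\<^sup>2) \<le> W" for f g :: "nat \<Rightarrow> nat \<Rightarrow> real"
  proof -
    have "f a d * g a d \<le> (f a d)\<^sup>2 / 2 + (g a d)\<^sup>2 / 2" for a d
      using sum_squares_bound[of "f a d" "g a d"] by simp
    then have "(\<Sum>a<N. \<Sum>d<N. f a d * g a d) \<le> (\<Sum>a<N. \<Sum>d<N. (f a d)\<^sup>2 / 2 + (g a d)\<^sup>2 / 2)"
      by (intro sum_mono)
    also have "\<dots> = (\<Sum>a<N. \<Sum>d<N. (f a d)\<^sup>2) / 2 + (\<Sum>a<N. \<Sum>d<N. (g a d)\<^sup>2) / 2"
      by (simp add: sum.distrib sum_divide_distrib)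
    finally show ?thesis using that by linarith
  qed
  have PW': "(\<Sum>a<N. \<Sum>c<N. (P c a)\<^sup>2) \<le> W" using PW by (subst sum.swap)
  have "var q = (\<integral>x. (q x)\<^sup>2 \<partial>M) - (\<integral>x. q x \<partial>M)\<^sup>2"
    unfolding var_def using variance_eq[OF qi] q2i unfolding q_def[symmetric] by simp
  also have "(\<integral>x. (q x)\<^sup>2 \<partial>M) = (\<Sum>a<N. \<Sum>b<N. \<Sum>c<N. \<Sum>d<N. A a b * A c d * (C a b * C c d))
     + (\<Sum>a<N. \<Sum>b<N. \<Sum>c<N. \<Sum>d<N. A a b * A c d * (C a c * C b d)) + (\<Sum>a<N. \<Sum>b<N. \<Sum>c<N. \<Sum>d<N. A a b * A c d * (C a d * C b c))"
    unfolding Eq2 distrib_left sum.distrib ..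
  finally have "var q = (\<Sum>a<N. \<Sum>d<N. P a d * Q a d) + (\<Sum>a<N. \<Sum>c<N. P a c * P c a)"
    unfolding t0 t1 t2 by simp
  also have "\<dots> \<le> W + W" by (intro add_mono amgm PW QW PW')
  finally show "var (\<lambda>x. quad_form N A (\<lambda>i. U i x)) \<le> 2 * K\<^sup>2 * (\<Sum>i<N. \<Sum>k<N. (C i k)\<^sup>2)"
    by (simp add: W_def q_def[abs_def])
qed

end

subsection \<open>Exchanging columns\<close>

text \<open>Young's inequality replaces the root of a product by terms linear in sums of squares, so
  that expectations need second moments only. If \<open>p - r\<close> has L2 size of order
  \<open>\<eta>\<close> per entry, both terms are of order \<open>\<eta>\<close> per entry.\<close>

lemma quad_form_diff_young:
  assumes A: "op_bound N K A" and K: "K \<ge> 0" and \<eta>: "\<eta> > 0"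
  shows "\<bar>quad_form N A p - quad_form N A r\<bar>
    \<le> K * ((\<Sum>i<N. (p i - r i)\<^sup>2) / \<eta> + \<eta> * ((\<Sum>i<N. (p i)\<^sup>2) + (\<Sum>i<N. (r i)\<^sup>2)))"
proof -
  define D where "D = (\<Sum>i<N. (p i - r i)\<^sup>2)"
  define S where "S = (\<Sum>i<N. (p i)\<^sup>2) + (\<Sum>i<N. (r i)\<^sup>2)"
  have D0: "D \<ge> 0" and S0: "S \<ge> 0" unfolding D_def S_def by (intro add_nonneg_nonneg sum_nonneg; simp)+
  have "(quad_form N A p - quad_form N A r)\<^sup>2 \<le> 2 * K\<^sup>2 * D * S"
    unfolding D_def S_def by (rule quad_form_diff_bound[OF A])
  also have "\<dots> \<le> K\<^sup>2 * (D / \<eta> + \<eta> * S)\<^sup>2"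
  proof -
    have "(D / \<eta> + \<eta> * S)\<^sup>2 = (D / \<eta>)\<^sup>2 + (\<eta> * S)\<^sup>2 + 2 * (D * S)"
      using \<eta> by (simp add: power2_sum)
    then have "2 * (D * S) \<le> (D / \<eta> + \<eta> * S)\<^sup>2" by simp
    then have "K\<^sup>2 * (2 * (D * S)) \<le> K\<^sup>2 * (D / \<eta> + \<eta> * S)\<^sup>2" by (rule mult_left_mono) simp
    then show ?thesis by (simp add: mult_ac)
  qed
  finally have "(quad_form N A p - quad_form N A r)\<^sup>2 \<le> (K * (D / \<eta> + \<eta> * S))\<^sup>2" by (simp add: power_mult_distrib)
  then have "\<bar>quad_form N A p - quad_form N A r\<bar> \<le> \<bar>K * (D / \<eta> + \<eta> * S)\<bar>" by (simp only: abs_le_square_iff)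
  also have "\<dots> = K * (D / \<eta> + \<eta> * S)" using K \<eta> D0 S0 by (intro abs_of_nonneg) simp
  finally show ?thesis unfolding D_def S_def .
qed

lemma gram_cong:
  assumes "\<And>j. j < n \<Longrightarrow> u j = u' j" shows "gram n u = gram n u'"
  unfolding gram_def using assms by (intro ext arg_cong2[where f="(*)"] refl sum.cong) auto

lemma swap_const_nonneg: "Im z > 0 \<Longrightarrow> swap_const z \<ge> 0"
  by (simp add: swap_const_def)

lemma stieltjes_swap_div:
  assumes z: "Im z > 0" and j: "j < n" and N: "N > 0"
  shows "cmod (stieltjes (cmat N (gram n (u(j := p)))) z - stieltjes (cmat N (gram n (u(j := s)))) z)
    \<le> swap_const z / (real n * real N) * (\<Sum>t<4. \<bar>quad_form N (res_part N (gram n (u(j := \<lambda>_. 0))) z t) p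
         - quad_form N (res_part N (gram n (u(j := \<lambda>_. 0))) z t) s\<bar>)"
proof -
  have le: "x \<le> y / real N" if "real N * x \<le> y" for x y
    using that N by (simp add: pos_le_divide_eq mult.commute)
  have "cmod (stieltjes (cmat N (gram n (u(j := p)))) z - stieltjes (cmat N (gram n (u(j := s)))) z)
    \<le> (swap_const z / real n * (\<Sum>t<4. \<bar>quad_form N (res_part N (gram n (u(j := \<lambda>_. 0))) z t) p
         - quad_form N (res_part N (gram n (u(j := \<lambda>_. 0))) z t) s\<bar>)) / real N"
    by (rule le) (rule stieltjes_swap[OF z j])
  then show ?thesis by simp
qed

text \<open>The columns are exchanged one at a time. \<open>op_bound_res_part\<close> holds for
  every intermediate Gram matrix, so this comparison is deterministic.\<close>

lemma stieltjes_replace_columns: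
  assumes z: "Im z > 0" and N: "N > 0" and n: "n > 0" and \<eta>: "\<eta> > 0"
  defines "K \<equiv> 1 / Im z + 1 / (Im z)\<^sup>2"
  shows "cmod (stieltjes (cmat N (gram n u)) z - stieltjes (cmat N (gram n u')) z)
    \<le> (\<Sum>j<n. swap_const z / (real n * real N) * (4 * (K * ((\<Sum>i<N. (u j i - u' j i)\<^sup>2) / \<eta>
        + \<eta> * ((\<Sum>i<N. (u j i)\<^sup>2) + (\<Sum>i<N. (u' j i)\<^sup>2))))))"
proof -
  define h where "h j = (\<lambda>i. if i < j then u' i else u i)" for j :: nat
  define S where "S v = stieltjes (cmat N (gram n v)) z" for v
  have K: "K \<ge> 0" using z by (simp add: K_def)
  have step: "cmod (S (h j) - S (h (Suc j))) \<le> swap_const z / (real n * real N) * (4 * (K * ((\<Sum>i<N. (u j i - u' j i)\<^sup>2) / \<eta>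
        + \<eta> * ((\<Sum>i<N. (u j i)\<^sup>2) + (\<Sum>i<N. (u' j i)\<^sup>2)))))" if j: "j < n" for j
  proof -
    let ?B = "K * ((\<Sum>i<N. (u j i - u' j i)\<^sup>2) / \<eta> + \<eta> * ((\<Sum>i<N. (u j i)\<^sup>2) + (\<Sum>i<N. (u' j i)\<^sup>2)))"
    have e: "h j = (h j)(j := u j)" "h (Suc j) = (h j)(j := u' j)" by (auto simp: h_def fun_eq_iff)
    have "cmod (S (h j) - S (h (Suc j))) = cmod (stieltjes (cmat N (gram n ((h j)(j := u j)))) z - stieltjes (cmat N (gram n ((h j)(j := u' j)))) z)"
      unfolding S_def e(2) using e(1) by simp
    also have "\<dots> \<le> swap_const z / (real n * real N) * (\<Sum>t<4. \<bar>quad_form N (res_part N (gram n ((h j)(j := \<lambda>_. 0))) z t) (u j)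
         - quad_form N (res_part N (gram n ((h j)(j := \<lambda>_. 0))) z t) (u' j)\<bar>)"
      by (rule stieltjes_swap_div[OF z j N])
    also have "\<dots> \<le> swap_const z / (real n * real N) * (\<Sum>t<4::nat. ?B)"
      using swap_const_nonneg[OF z] quad_form_diff_young[OF op_bound_res_part[OF symmetric_gram z] _ \<eta>] K
      unfolding K_def[symmetric] by (intro mult_left_mono sum_mono) auto
    finally show ?thesis by simp
  qed
  have "S u - S u' = (\<Sum>j<n. S (h j) - S (h (Suc j)))"
  proof -
    have "S (h n) = S u'" unfolding S_def by (subst gram_cong[of n "h n" u']) (auto simp: h_def)
    moreover have "S (h 0) = S u" by (simp add: h_def)
    ultimately show ?thesis by (simp only: sum_lessThan_telescope'[of "\<lambda>j. S (h j)"])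
  qed
  then have "cmod (S u - S u') \<le> (\<Sum>j<n. cmod (S (h j) - S (h (Suc j))))" by (simp only: norm_sum)
  also have "\<dots> \<le> (\<Sum>j<n. swap_const z / (real n * real N) * (4 * (K * ((\<Sum>i<N. (u j i - u' j i)\<^sup>2) / \<eta>
        + \<eta> * ((\<Sum>i<N. (u j i)\<^sup>2) + (\<Sum>i<N. (u' j i)\<^sup>2))))))"
    by (rule sum_mono) (use step in simp)
  finally show ?thesis unfolding S_def .
qed

lemma norm_integral_le:
  fixes f :: "'x \<Rightarrow> complex"
  assumes "integrable M f" "integrable M g" "\<And>x. norm (f x) \<le> g x"
  shows "norm (\<integral>x. f x \<partial>M) \<le> (\<integral>x. g x \<partial>M)"
proof -
  have g0: "0 \<le> g x" for x using assms(3)[of x] norm_ge_zero[of "f x"] by linarith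
  have "ennreal (norm (\<integral>x. f x \<partial>M)) \<le> (\<integral>\<^sup>+x. norm (f x) \<partial>M)" by (rule integral_norm_bound_ennreal[OF assms(1)])
  also have "\<dots> \<le> (\<integral>\<^sup>+x. g x \<partial>M)" using assms(3) by (intro nn_integral_mono) (simp add: ennreal_leI)
  also have "\<dots> = ennreal (\<integral>x. g x \<partial>M)" using assms(2) g0 by (intro nn_integral_eq_integral) auto
  finally show ?thesis using g0 by (simp add: ennreal_le_iff integral_nonneg_AE)
qed

context prob_space begin

text \<open>Pointwise, an absolute deviation \<open>x\<close> is at most
  \<open>(x\<^sup>2 / a + a) / 2\<close>, which stands in for Jensen's inequality.\<close>

lemma abs_deviation_le:
  assumes f: "integrable M f" "integrable M (\<lambda>x. (f x)\<^sup>2)" and v: "var f \<le> a\<^sup>2" and a: "a > 0"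
  shows "(\<integral>x. \<bar>f x - (\<integral>y. f y \<partial>M)\<bar> \<partial>M) \<le> a"
proof -
  define u where "u = (\<integral>y. f y \<partial>M)"
  have i2: "integrable M (\<lambda>x. (f x - u)\<^sup>2)"
    unfolding power2_diff using f by simp
  have "(\<integral>x. \<bar>f x - u\<bar> \<partial>M) \<le> (\<integral>x. ((f x - u)\<^sup>2 / a + a) / 2 \<partial>M)"
  proof (rule integral_mono')
    show "\<bar>f x - u\<bar> \<le> ((f x - u)\<^sup>2 / a + a) / 2" for x
      using sum_squares_bound[of "\<bar>f x - u\<bar>" a] a by (simp add: field_simps power2_eq_square)
    show "integrable M (\<lambda>x. ((f x - u)\<^sup>2 / a + a) / 2)" using i2 by simp
    show "0 \<le> ((f x - u)\<^sup>2 / a + a) / 2" for x using a by simp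
  qed
  also have "\<dots> = (var f / a + a) / 2" using i2 by (simp add: var_def u_def prob_space)
  also have "\<dots> \<le> (a\<^sup>2 / a + a) / 2" using v a by (intro divide_right_mono add_mono) auto
  also have "\<dots> = a" using a by (simp add: power2_eq_square)
  finally show ?thesis unfolding u_def .
qed

end

context window_process begin

lemma quad_form_yv_abs_bound:
  "op_bound N K A \<Longrightarrow> K \<ge> 0 \<Longrightarrow> \<bar>quad_form N A (yv I s e)\<bar> \<le> K * T\<^sup>2 * real N"
  unfolding quad_form_bilin by (rule bilin_yv_abs_bound)

lemma quad_form_yv_measurable:
  "(\<lambda>e. quad_form N A (yv I s e)) \<in> borel_measurable seqs"
  unfolding quad_form_bilin by measurable

text \<open>Column \<open>j\<close> follows the preceding one in time without a gap. Dropping a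
  fixed number of its first entries creates one and changes the form only by the order of the square
  root of \<open>N\<close>.\<close>

lemma quad_form_gap:
  assumes A: "op_bound N K A"
  shows "(quad_form N A (yv UNIV s e) - quad_form N A (yv {g..} s e))\<^sup>2 \<le> 4 * K\<^sup>2 * T^4 * real g * real N"
proof -
  have "(\<Sum>i<N. (yv UNIV s e i - yv {g..} s e i)\<^sup>2) = (\<Sum>i<N. (yv {..<g} s e i)\<^sup>2)"
    by (intro sum.cong) (auto simp: yv_def)
  also have "\<dots> \<le> real g * T\<^sup>2" using yv_sum_sq_card[of "{..<g}"] by simp
  finally have 1: "(\<Sum>i<N. (yv UNIV s e i - yv {g..} s e i)\<^sup>2) \<le> real g * T\<^sup>2" .
  have "(quad_form N A (yv UNIV s e) - quad_form N A (yv {g..} s e))\<^sup>2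
     \<le> 2 * K\<^sup>2 * (\<Sum>i<N. (yv UNIV s e i - yv {g..} s e i)\<^sup>2) * ((\<Sum>i<N. (yv UNIV s e i)\<^sup>2) + (\<Sum>i<N. (yv {g..} s e i)\<^sup>2))"
    by (rule quad_form_diff_bound[OF A])
  also have "\<dots> \<le> 2 * K\<^sup>2 * (real g * T\<^sup>2) * (real N * T\<^sup>2 + real N * T\<^sup>2)"
    using 1 by (intro mult_mono mult_nonneg_nonneg add_nonneg_nonneg sum_nonneg add_mono yv_sum_sq order_refl mult_left_mono) auto
  also have "\<dots> = 4 * K\<^sup>2 * T^4 * real g * real N" by (simp add: power2_eq_square power4_eq_xxxx)
  finally show ?thesis .
qed

text \<open>Concentration is known for fixed matrices, whereas \<open>A\<close> is random but
  determined by times up to \<open>c\<close>. With the first \<open>g\<close> entries of the column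
  dropped, \<open>decouple\<close> makes the column independent of \<open>A\<close>, and
  \<open>conc\<close> applies for each fixed value of \<open>A\<close>. In
  \<open>3 * \<kappa>\<close>, two parts pay for dropping and restoring the entries, one for
  concentration; the last term is the decoupling error of a function bounded by
  \<open>2 * L\<close>.\<close>

lemma past_quad_form_deviation:
  fixes A :: "(int \<Rightarrow> real) \<Rightarrow> nat \<Rightarrow> nat \<Rightarrow> real"
  assumes A_meas: "\<And>i k. i < N \<Longrightarrow> k < N \<Longrightarrow> (\<lambda>e. A e i k) \<in> borel_measurable seqs"
    and A: "\<And>e. op_bound N K (A e)" and K: "K \<ge> 0"
    and A_past: "\<And>e e'. (\<And>i. i \<le> c \<Longrightarrow> e i = e' i) \<Longrightarrow> A e = A e'"
    and q: "q \<ge> 1" and sep: "c + int q \<le> s + int g - int m"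
    and conc: "\<And>A. op_bound N K A \<Longrightarrow> var (\<lambda>e. quad_form N A (yv UNIV s e)) \<le> (\<kappa> * real N)\<^sup>2"
    and N: "N > 0" and \<kappa>: "\<kappa> > 0"
    and gap: "4 * K\<^sup>2 * T^4 * real g * real N \<le> (\<kappa> * real N)\<^sup>2"
  defines "dev \<equiv> \<lambda>e. \<bar>quad_form N (A e) (yv UNIV s e) - (\<integral>e2. quad_form N (A e) (yv UNIV s e2) \<partial>P)\<bar>"
  shows "(\<integral>e. dev e \<partial>P) \<le> (3 * \<kappa> + 2 * K * T\<^sup>2 * b q) * real N" and "integrable P dev" and "\<And>e. dev e \<le> 2 * K * T\<^sup>2 * real N"
proof -
  define L where "L = K * T\<^sup>2 * real N"
  define tr where "tr B = (\<integral>e2. quad_form N B (yv UNIV s e2) \<partial>P)" for B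
  have qm2: "(\<lambda>(e1, e2). quad_form N (A e1) (yv I s e2)) \<in> borel_measurable (seqs \<Otimes>\<^sub>M seqs)" for I
    unfolding quad_form_def case_prod_unfold
    by (intro borel_measurable_sum borel_measurable_times measurable_compose[OF measurable_snd yv_meas]
        measurable_compose[OF measurable_fst A_meas]) auto
  have [measurable]: "(\<lambda>e. quad_form N B (yv I s e)) \<in> borel_measurable seqs" for B I by (rule quad_form_yv_measurable)
  have qb: "\<bar>quad_form N (A e) (yv I s e')\<bar> \<le> L" for e e' I unfolding L_def by (rule quad_form_yv_abs_bound[OF A K])
  have trb: "\<bar>tr (A e)\<bar> \<le> L" for e
  proof -
    have "\<bar>tr (A e)\<bar> \<le> (\<integral>e2. \<bar>quad_form N (A e) (yv UNIV s e2)\<bar> \<partial>P)" unfolding tr_def by (rule integral_abs_bound)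
    also have "\<dots> \<le> (\<integral>e2. L \<partial>P)"
      using qb by (intro integral_mono' integrable_const) (auto intro: order_trans[OF abs_ge_zero qb])
    finally show ?thesis by simp
  qed
  have trm: "(\<lambda>e. tr (A e)) \<in> borel_measurable seqs"
  proof -
    have "(\<lambda>(e1, e2). quad_form N (A e1) (yv UNIV s e2)) \<in> borel_measurable (seqs \<Otimes>\<^sub>M P)"
      using qm2 by (simp cong: measurable_cong_sets add: sets_pair_measure_cong[OF refl sets_P])
    then show ?thesis unfolding tr_def by (rule borel_measurable_lebesgue_integral)
  qed
  let ?h = "\<lambda>(e1, e2). \<bar>quad_form N (A e1) (yv {g..} s e2) - tr (A e1)\<bar>"
  have hm: "?h \<in> borel_measurable (seqs \<Otimes>\<^sub>M seqs)"
    using borel_measurable_abs[OF borel_measurable_diff[OF qm2[of "{g..}"] measurable_compose[OF measurable_fst trm]]]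
    by (simp add: case_prod_unfold)
  have dm: "dev \<in> borel_measurable seqs"
  proof -
    have "(\<lambda>e. (\<lambda>(e1, e2). quad_form N (A e1) (yv UNIV s e2)) (e, e)) \<in> borel_measurable seqs"
      by (rule measurable_compose[OF _ qm2]) simp
    then have "(\<lambda>e. quad_form N (A e) (yv UNIV s e)) \<in> borel_measurable seqs" by simp
    then show ?thesis unfolding dev_def tr_def[symmetric] using trm by measurable
  qed
  show db: "dev e \<le> 2 * K * T\<^sup>2 * real N" for e
    unfolding dev_def tr_def[symmetric] using qb[of e UNIV e] trb[of e] unfolding L_def by linarith
  have dev0: "dev e \<ge> 0" for e by (simp add: dev_def)
  show di: "integrable P dev"
    by (rule bounded_integrable[where C="2 * K * T\<^sup>2 * real N"]) (use dm db dev0 in auto)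
  have aN: "\<kappa> * real N > 0" using N \<kappa> by simp
  have gp: "\<bar>quad_form N (A e) (yv UNIV s e') - quad_form N (A e) (yv {g..} s e')\<bar> \<le> \<kappa> * real N" for e e'
  proof -
    have "(quad_form N (A e) (yv UNIV s e') - quad_form N (A e) (yv {g..} s e'))\<^sup>2 \<le> (\<kappa> * real N)\<^sup>2"
      using quad_form_gap[OF A, of e s e' g] gap by linarith
    then have "\<bar>quad_form N (A e) (yv UNIV s e') - quad_form N (A e) (yv {g..} s e')\<bar> \<le> \<bar>\<kappa> * real N\<bar>" by (simp only: abs_le_square_iff)
    then show ?thesis using aN by simp
  qed
  have hb: "\<bar>?h x\<bar> \<le> 2 * L" for x
    using qb[of "fst x" "{g..}" "snd x"] trb[of "fst x"] by (simp add: case_prod_unfold)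
  have dec: "\<bar>(\<integral>e. ?h (e, e) \<partial>P) - (\<integral>e1. \<integral>e2. ?h (e1, e2) \<partial>P \<partial>P)\<bar> \<le> 2 * L * b q"
  proof (rule decouple[OF q hm hb, where k=c])
    show "?h (e1, e2) = ?h (e1', e2')"
      if "\<And>j. j \<le> c \<Longrightarrow> e1 j = e1' j" "\<And>j. j \<ge> c + int q \<Longrightarrow> e2 j = e2' j" for e1 e1' e2 e2'
    proof -
      have "A e1 = A e1'" by (rule A_past[OF that(1)])
      moreover have "yv {g..} s e2 = yv {g..} s e2'"
        by (rule yv_cong_ge[OF _ that(2)]) (use sep in auto)
      ultimately show ?thesis by simp
    qed
  qed
  have hi: "integrable P (\<lambda>e. ?h (e, e))"
    by (rule bounded_integrable[where C="2 * L"]) (use measurable_compose[OF _ hm, of "\<lambda>e. (e, e)" seqs] hb in auto)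
  have inner: "(\<integral>e2. ?h (e1, e2) \<partial>P) \<le> 2 * \<kappa> * real N" for e1
  proof -
    have qi: "integrable P (\<lambda>e. quad_form N (A e1) (yv UNIV s e))"
      by (rule bounded_integrable[where C=L]) (use qb in auto)
    have q2i: "integrable P (\<lambda>e. (quad_form N (A e1) (yv UNIV s e))\<^sup>2)"
      by (rule bounded_integrable[where C="L\<^sup>2"]) (use qb square_bound in auto)
    have "(\<integral>e2. ?h (e1, e2) \<partial>P) \<le> (\<integral>e2. \<kappa> * real N + \<bar>quad_form N (A e1) (yv UNIV s e2) - tr (A e1)\<bar> \<partial>P)"
    proof (rule integral_mono')
      show "integrable P (\<lambda>e2. \<kappa> * real N + \<bar>quad_form N (A e1) (yv UNIV s e2) - tr (A e1)\<bar>)" using qi by simp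
      show "?h (e1, e2) \<le> \<kappa> * real N + \<bar>quad_form N (A e1) (yv UNIV s e2) - tr (A e1)\<bar>" for e2
        using gp[of e1 e2] by simp
      show "0 \<le> \<kappa> * real N + \<bar>quad_form N (A e1) (yv UNIV s e2) - tr (A e1)\<bar>" for e2 using aN by linarith
    qed
    also have "\<dots> = \<kappa> * real N + (\<integral>e2. \<bar>quad_form N (A e1) (yv UNIV s e2) - tr (A e1)\<bar> \<partial>P)" using qi by simp
    also have "\<dots> \<le> \<kappa> * real N + \<kappa> * real N"
      using abs_deviation_le[OF qi q2i conc[OF A] aN] by (simp add: tr_def)
    finally show ?thesis by simp
  qed
  have "(\<integral>e. dev e \<partial>P) \<le> (\<integral>e. \<kappa> * real N + ?h (e, e) \<partial>P)"
  proof (rule integral_mono')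
    show "integrable P (\<lambda>e. \<kappa> * real N + ?h (e, e))" using hi by simp
    show "dev e \<le> \<kappa> * real N + ?h (e, e)" for e
      unfolding dev_def tr_def[symmetric] using gp[of e e] by simp
    show "0 \<le> \<kappa> * real N + ?h (e, e)" for e using aN by simp
  qed
  also have "\<dots> = \<kappa> * real N + (\<integral>e. ?h (e, e) \<partial>P)" using hi by simp
  also have "\<dots> \<le> \<kappa> * real N + ((\<integral>e1. \<integral>e2. ?h (e1, e2) \<partial>P \<partial>P) + 2 * L * b q)" using dec by linarith
  also have "(\<integral>e1. \<integral>e2. ?h (e1, e2) \<partial>P \<partial>P) \<le> (\<integral>e1. 2 * \<kappa> * real N \<partial>P)"
    by (rule integral_mono') (use inner aN in auto)
  finally have "(\<integral>e. dev e \<partial>P) \<le> \<kappa> * real N + (2 * \<kappa> * real N + 2 * L * b q)" by simp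
  then show "(\<integral>e. dev e \<partial>P) \<le> (3 * \<kappa> + 2 * K * T\<^sup>2 * b q) * real N" by (simp add: L_def algebra_simps)
qed

end

lemma measurable_gram:
  assumes "\<And>l. l < n \<Longrightarrow> (\<lambda>x. u x l i) \<in> borel_measurable M" "\<And>l. l < n \<Longrightarrow> (\<lambda>x. u x l k) \<in> borel_measurable M"
  shows "(\<lambda>x. gram n (u x) i k) \<in> borel_measurable M"
  unfolding gram_def
  by (intro borel_measurable_times borel_measurable_const borel_measurable_sum assms) auto

lemma measurable_stieltjes_gram:
  assumes "Im z > 0" "\<And>l a. l < n \<Longrightarrow> a < N \<Longrightarrow> (\<lambda>x. u x l a) \<in> borel_measurable M"
  shows "(\<lambda>x. stieltjes (cmat N (gram n (u x))) z) \<in> borel_measurable M"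
  by (rule measurable_stieltjes[OF _ symmetric_gram assms(1)]) (intro measurable_gram assms(2))

text \<open>The \<open>+ 1\<close> matches the one-based coordinates of the Gaussian vectors in
  \<open>G_mat\<close>.\<close>

definition head_col :: "(int \<Rightarrow> real) \<Rightarrow> nat \<Rightarrow> real" where
  "head_col s a = s (int (a + 1))"

lemma measurable_head_col [measurable]: "(\<lambda>s. head_col s a) \<in> borel_measurable seqs"
  unfolding head_col_def by measurable

lemma (in prob_space) complex_bounded_integrable:
  assumes "f \<in> borel_measurable M" "\<And>x. cmod (f x) \<le> C"
  shows "integrable M f"
  by (rule integrable_const_bound[of _ C]) (use assms in auto)

lemma (in prob_space) cmod_integral_le:
  assumes "f \<in> borel_measurable M" "\<And>x. cmod (f x) \<le> C"
  shows "cmod (\<integral>x. f x \<partial>M) \<le> C"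
  using norm_integral_le[OF complex_bounded_integrable[OF assms] integrable_const assms(2)] by (simp add: prob_space)

context window_process begin

text \<open>Hybrid data matrices of the Lindeberg argument: window process in the columns below \<open>j\<close>, Gaussian columns \<open>x\<close> from \<open>j\<close> on.\<close>

definition cols :: "nat \<Rightarrow> nat \<Rightarrow> (int \<Rightarrow> real) \<Rightarrow> (nat \<Rightarrow> int \<Rightarrow> real) \<Rightarrow> nat \<Rightarrow> nat \<Rightarrow> real" where
  "cols N j e x i = (if i < j then yv {..<N} (int (i * N) + 1) e else head_col (x i))"

lemma quad_form_yv_restrict: "quad_form N A (yv {..<N} s e) = quad_form N A (yv UNIV s e)"
  unfolding quad_form_def by (intro sum.cong refl) (simp add: yv_def)

text \<open>Since the Gaussian columns in \<open>x\<close> are frozen, the forms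
  \<open>A t e\<close> depend on earlier times only. For each \<open>t\<close> the two quadratic
  forms are compared through their means: \<open>\<kappa>\<close> for the Gaussian form,
  \<open>\<rho>\<close> between the means, and the bound of \<open>past_quad_form_deviation\<close>
  for the window form. The outer \<open>4\<close> counts the values of \<open>t\<close>.\<close>

lemma hybrid_step:
  fixes x :: "nat \<Rightarrow> int \<Rightarrow> real"
  assumes Q: "prob_space Q" and sQ: "sets Q = sets seqs" and z: "Im z > 0" and N: "N > 0" and j: "j < n"
    and K_def: "K = 1 / Im z + 1 / (Im z)\<^sup>2"
    and Zint: "\<And>A. integrable Q (\<lambda>s. quad_form N A (head_col s))"
    and Zdev: "\<And>A. op_bound N K A \<Longrightarrow> (\<integral>s. \<bar>quad_form N A (head_col s) - (\<integral>s. quad_form N A (head_col s) \<partial>Q)\<bar> \<partial>Q) \<le> \<kappa> * real N"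
    and tr: "\<And>A. op_bound N K A \<Longrightarrow> \<bar>(\<integral>s. quad_form N A (head_col s) \<partial>Q) - (\<integral>e. quad_form N A (yv UNIV (int (j * N) + 1) e) \<partial>P)\<bar> \<le> \<rho> * real N"
    and q: "q \<ge> 1"
    and conc: "\<And>A s. op_bound N K A \<Longrightarrow> var (\<lambda>e. quad_form N A (yv UNIV s e)) \<le> (\<kappa> * real N)\<^sup>2"
    and \<kappa>: "\<kappa> > 0"
    and gap: "4 * K\<^sup>2 * T^4 * real (2 * m + q) * real N \<le> (\<kappa> * real N)\<^sup>2"
  defines "S \<equiv> \<lambda>u. stieltjes (cmat N (gram n u)) z"
  shows "cmod ((\<integral>s. \<integral>e. S ((cols N (Suc j) e x)(j := head_col s)) \<partial>P \<partial>Q) - (\<integral>e. S (cols N (Suc j) e x) \<partial>P))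
    \<le> swap_const z / real n * (4 * (4 * \<kappa> + \<rho> + 2 * K * T\<^sup>2 * b q))"
proof -
  interpret Q: prob_space Q by fact
  interpret PQ: pair_prob_space P Q ..
  note [measurable_cong] = sQ
  define c0 where "c0 = swap_const z / (real n * real N)"
  have c0: "c0 \<ge> 0" using swap_const_nonneg[OF z] by (simp add: c0_def)
  have K: "K \<ge> 0" using z by (simp add: K_def)
  define s0 where "s0 = int (j * N) + 1"
  define U where "U e = cols N (Suc j) e x" for e
  define A where "A t e = res_part N (gram n ((U e)(j := \<lambda>_. 0))) z t" for t e
  define trQ where "trQ B = (\<integral>s. quad_form N B (head_col s) \<partial>Q)" for B
  define dev where "dev t e = \<bar>quad_form N (A t e) (yv UNIV s0 e) - (\<integral>e2. quad_form N (A t e) (yv UNIV s0 e2) \<partial>P)\<bar>" for t e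
  have UU: "U e = (U e)(j := yv {..<N} s0 e)" for e by (simp add: U_def cols_def s0_def fun_eq_iff)
  have Um: "(\<lambda>e. U e l a) \<in> borel_measurable seqs" for l a
    unfolding U_def cols_def by (cases "l < Suc j") simp_all
  have Ujm: "(\<lambda>p. ((U (fst p))(j := head_col (snd p))) l a) \<in> borel_measurable (P \<Otimes>\<^sub>M Q)" for l a
  proof (cases "l = j")
    case True
    have "(\<lambda>s. head_col s a) \<in> borel_measurable Q" by measurable
    from measurable_compose[OF measurable_snd this] show ?thesis using True by simp
  next
    case False
    have "(\<lambda>e. U e l a) \<in> borel_measurable P" using Um by measurable
    from measurable_compose[OF measurable_fst this] show ?thesis using False by simp
  qed
  have Sb: "cmod (S u) \<le> 1 / Im z" for u unfolding S_def by (rule stieltjes_bound[OF symmetric_gram z])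
  have S1m: "(\<lambda>p. S ((U (fst p))(j := head_col (snd p)))) \<in> borel_measurable (P \<Otimes>\<^sub>M Q)"
    unfolding S_def by (rule measurable_stieltjes_gram[OF z]) (rule Ujm)
  have S2m: "(\<lambda>e. S (U e)) \<in> borel_measurable P"
    unfolding S_def by (rule measurable_stieltjes_gram[OF z]) (use Um in measurable)
  have i2: "integrable P (\<lambda>e. S (U e))" by (rule complex_bounded_integrable[OF S2m Sb])
  have S1e: "(\<lambda>e. S ((U e)(j := head_col s))) \<in> borel_measurable P" for s
    using measurable_compose[OF _ S1m, of "\<lambda>e. (e, s)" P] sets_eq_imp_space_eq[OF sQ] by simp
  have i1: "integrable P (\<lambda>e. S ((U e)(j := head_col s)))" for s by (rule complex_bounded_integrable[OF S1e Sb])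
  define D where "D e s = S ((U e)(j := head_col s)) - S (U e)" for e s
  have Db: "cmod (D e s) \<le> 2 / Im z" for e s
    unfolding D_def using norm_triangle_ineq4[of "S ((U e)(j := head_col s))" "S (U e)"] Sb[of "(U e)(j := head_col s)"] Sb[of "U e"] by simp
  have Dm: "(\<lambda>p. D (fst p) (snd p)) \<in> borel_measurable (P \<Otimes>\<^sub>M Q)"
    unfolding D_def by (intro borel_measurable_diff S1m measurable_compose[OF measurable_fst S2m])
  have Di: "integrable (P \<Otimes>\<^sub>M Q) (case_prod D)"
    unfolding case_prod_unfold by (rule PQ.complex_bounded_integrable[OF Dm Db])
  have Dsm: "D e \<in> borel_measurable Q" for e
    using measurable_compose[OF _ Dm, of "\<lambda>s. (e, s)" Q] by simp
  have A_op: "op_bound N K (A t e)" for t e unfolding A_def K_def by (rule op_bound_res_part[OF symmetric_gram z])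
  have A_meas: "(\<lambda>e. A t e i k) \<in> borel_measurable seqs" if "i < N" "k < N" for t i k
  proof -
    have "(\<lambda>e. ((U e)(j := \<lambda>_. 0)) l a) \<in> borel_measurable seqs" for l a
      using Um by (cases "l = j") simp_all
    then have g: "(\<lambda>e. gram n ((U e)(j := \<lambda>_. 0)) i k) \<in> borel_measurable seqs" for i k by (intro measurable_gram)
    show ?thesis unfolding A_def
      by (rule measurable_res_part[OF _ symmetric_gram z that]) (rule g)
  qed
  \<comment> \<open>A column \<open>l < j\<close> ends at time \<open>j * N\<close> at the latest,
    and its windows reach \<open>m\<close> further.\<close>
  have A_past: "A t e = A t e'" if e: "\<And>i. i \<le> int (j * N) + int m \<Longrightarrow> e i = e' i" for t e e'
  proof -
    have "(U e)(j := \<lambda>_. 0) = (U e')(j := \<lambda>_. 0)"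
    proof
      fix l
      show "((U e)(j := \<lambda>_. 0)) l = ((U e')(j := \<lambda>_. 0)) l"
      proof (cases "l < j")
        case True
        have "Suc l * N \<le> j * N" using True by (intro mult_le_mono1) simp
        then have lN: "int (l * N) + int N \<le> int (j * N)" by (simp add: algebra_simps flip: of_nat_add of_nat_mult)
        have "yv {..<N} (int (l * N) + 1) e = yv {..<N} (int (l * N) + 1) e'"
        proof (rule yv_cong_le[OF _ e])
          show "int (l * N) + 1 + int i + int m \<le> int (j * N) + int m" if "i \<in> {..<N}" for i
            using that lN by simp
        qed
        then show ?thesis using True by (simp add: U_def cols_def)
      next
        case False
        then show ?thesis by (simp add: U_def cols_def)
      qed
    qed
    then show ?thesis by (simp add: A_def)
  qed
  have sep: "int (j * N) + int m + int q \<le> s0 + int (2 * m + q) - int m" by (simp add: s0_def)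
  note pq = past_quad_form_deviation[OF A_meas A_op K A_past q sep conc N \<kappa> gap]
  have dev1: "(\<integral>e. dev t e \<partial>P) \<le> (3 * \<kappa> + 2 * K * T\<^sup>2 * b q) * real N" for t
    unfolding dev_def by (rule pq(1))
  have dev2: "integrable P (dev t)" for t
    unfolding dev_def[abs_def] by (rule pq(2))
  have inner: "cmod (\<integral>s. D e s \<partial>Q) \<le> c0 * (\<Sum>t<4. \<kappa> * real N + \<rho> * real N + dev t e)" for e
  proof -
    define G where "G s = c0 * (\<Sum>t<4. \<bar>quad_form N (A t e) (head_col s) - trQ (A t e)\<bar> + (\<rho> * real N + dev t e))" for s
    have Gi0: "integrable Q (\<lambda>s. \<bar>quad_form N (A t e) (head_col s) - trQ (A t e)\<bar>)" for t
      using Zint by simp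
    have Gi: "integrable Q G" unfolding G_def[abs_def] using Gi0
      by (intro integrable_mult_right Bochner_Integration.integrable_sum Bochner_Integration.integrable_add Q.integrable_const)
    have DG: "cmod (D e s) \<le> G s" for s
    proof -
      have "cmod (D e s) = cmod (stieltjes (cmat N (gram n ((U e)(j := head_col s)))) z - stieltjes (cmat N (gram n ((U e)(j := yv {..<N} s0 e)))) z)"
        unfolding D_def S_def using UU[of e] by simp
      also have "\<dots> \<le> c0 * (\<Sum>t<4. \<bar>quad_form N (A t e) (head_col s) - quad_form N (A t e) (yv {..<N} s0 e)\<bar>)"
        unfolding c0_def A_def by (rule stieltjes_swap_div[OF z j N])
      also have "\<dots> \<le> G s" unfolding G_def
      proof (intro mult_left_mono[OF _ c0] sum_mono)
        fix t
        have "\<bar>trQ (A t e) - (\<integral>e2. quad_form N (A t e) (yv UNIV s0 e2) \<partial>P)\<bar> \<le> \<rho> * real N"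
          using tr[OF A_op] unfolding trQ_def s0_def .
        then show "\<bar>quad_form N (A t e) (head_col s) - quad_form N (A t e) (yv {..<N} s0 e)\<bar>
          \<le> \<bar>quad_form N (A t e) (head_col s) - trQ (A t e)\<bar> + (\<rho> * real N + dev t e)"
          unfolding dev_def quad_form_yv_restrict by linarith
      qed
      finally show ?thesis .
    qed
    have "cmod (\<integral>s. D e s \<partial>Q) \<le> (\<integral>s. G s \<partial>Q)"
      by (rule norm_integral_le[OF Q.complex_bounded_integrable[OF Dsm Db] Gi DG])
    also have "\<dots> = c0 * (\<Sum>t<4. (\<integral>s. \<bar>quad_form N (A t e) (head_col s) - trQ (A t e)\<bar> \<partial>Q) + (\<rho> * real N + dev t e))"
      unfolding G_def using Gi0 by (simp add: Bochner_Integration.integral_sum Q.prob_space)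
    also have "\<dots> \<le> c0 * (\<Sum>t<4. \<kappa> * real N + (\<rho> * real N + dev t e))"
      using Zdev[OF A_op] unfolding trQ_def by (intro mult_left_mono[OF _ c0] sum_mono add_right_mono)
    finally show ?thesis by (simp only: add.assoc)
  qed
  \<comment> \<open>Exchanging the integrals lets the Gaussian column be integrated first, with
    \<open>e\<close> and hence \<open>A t e\<close> fixed.\<close>
  have "(\<integral>s. \<integral>e. S ((U e)(j := head_col s)) \<partial>P \<partial>Q) - (\<integral>e. S (U e) \<partial>P) = (\<integral>s. \<integral>e. D e s \<partial>P \<partial>Q)"
  proof -
    have m: "(\<lambda>s. \<integral>e. S ((U e)(j := head_col s)) \<partial>P) \<in> borel_measurable Q"
      by (rule borel_measurable_lebesgue_integral) (use measurable_compose[OF measurable_pair_swap' S1m] in \<open>simp add: case_prod_unfold\<close>)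
    have "integrable Q (\<lambda>s. \<integral>e. S ((U e)(j := head_col s)) \<partial>P)"
      by (rule Q.complex_bounded_integrable[OF m cmod_integral_le[OF S1e Sb]])
    then show ?thesis unfolding D_def using i1 i2 by (simp add: Q.prob_space)
  qed
  also have "\<dots> = (\<integral>e. \<integral>s. D e s \<partial>Q \<partial>P)" by (rule PQ.Fubini_integral[OF Di])
  finally have eq: "(\<integral>s. \<integral>e. S ((U e)(j := head_col s)) \<partial>P \<partial>Q) - (\<integral>e. S (U e) \<partial>P) = (\<integral>e. \<integral>s. D e s \<partial>Q \<partial>P)" .
  have "cmod (\<integral>e. \<integral>s. D e s \<partial>Q \<partial>P) \<le> (\<integral>e. c0 * (\<Sum>t<4. \<kappa> * real N + \<rho> * real N + dev t e) \<partial>P)"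
  proof (rule norm_integral_le[OF _ _ inner])
    show "integrable P (\<lambda>e. \<integral>s. D e s \<partial>Q)" using PQ.integrable_fst[OF Di] .
    show "integrable P (\<lambda>e. c0 * (\<Sum>t<4. \<kappa> * real N + \<rho> * real N + dev t e))"
      using dev2 by (intro integrable_mult_right Bochner_Integration.integrable_sum Bochner_Integration.integrable_add integrable_const)
  qed
  also have "\<dots> = c0 * (\<Sum>t<4. \<kappa> * real N + \<rho> * real N + (\<integral>e. dev t e \<partial>P))"
    using dev2 by (simp add: Bochner_Integration.integral_sum)
  also have "\<dots> \<le> c0 * (\<Sum>t<4::nat. \<kappa> * real N + \<rho> * real N + (3 * \<kappa> + 2 * K * T\<^sup>2 * b q) * real N)"
    using dev1 by (intro mult_left_mono[OF _ c0] sum_mono add_left_mono)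
  also have "\<dots> = c0 * real N * (4 * (4 * \<kappa> + \<rho> + 2 * K * T\<^sup>2 * b q))" by (simp add: algebra_simps)
  also have "c0 * real N = swap_const z / real n" using N by (simp add: c0_def)
  finally show ?thesis unfolding eq[symmetric] U_def .
qed

lemma hybrid_total:
  fixes n :: nat
  assumes Q: "prob_space Q" and sQ: "sets Q = sets seqs" and z: "Im z > 0" and N: "N > 0"
  defines "S \<equiv> \<lambda>u. stieltjes (cmat N (gram n u)) z"
  assumes step: "\<And>j x. j < n \<Longrightarrow>
    cmod ((\<integral>s. \<integral>e. S ((cols N (Suc j) e x)(j := head_col s)) \<partial>P \<partial>Q) - (\<integral>e. S (cols N (Suc j) e x) \<partial>P)) \<le> d"
  shows "cmod ((\<integral>w. S (\<lambda>i. head_col (w i)) \<partial>PiM {0..<n} (\<lambda>_. Q)) - (\<integral>e. S (\<lambda>i. yv {..<N} (int (i * N) + 1) e) \<partial>P)) \<le> real n * d"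
proof -
  interpret Q: prob_space Q by fact
  interpret PS: product_prob_space "\<lambda>_::nat. Q" by unfold_locales
  note [measurable_cong] = sQ
  define F where "F j w = (\<integral>e. S (cols N j e w) \<partial>P)" for j w
  define G where "G j w = (\<integral>s. \<integral>e. S ((cols N (Suc j) e w)(j := head_col s)) \<partial>P \<partial>Q)" for j w
  define R where "R j = (\<integral>w. F j w \<partial>PiM {j..<n} (\<lambda>_. Q))" for j
  have pp: "prob_space (PiM I (\<lambda>_::nat. Q))" for I by (rule prob_space_PiM) (rule Q)
  have Sb: "cmod (S u) \<le> 1 / Im z" for u unfolding S_def by (rule stieltjes_bound[OF symmetric_gram z])
  have hc: "(\<lambda>s. head_col s a) \<in> borel_measurable Q" for a by measurable
  have yP: "(\<lambda>e. yv I s e a) \<in> borel_measurable P" for I s a by measurable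
  have comp: "(\<lambda>w. head_col (w l) a) \<in> borel_measurable (PiM I (\<lambda>_. Q))" if "l \<in> I" for l I a
    by (rule measurable_compose[OF measurable_component_singleton[OF that] hc])
  have Scm: "(\<lambda>p. S (cols N j (snd p) (fst p))) \<in> borel_measurable (PiM {j..<n} (\<lambda>_. Q) \<Otimes>\<^sub>M P)" for j
    unfolding S_def
  proof (rule measurable_stieltjes_gram[OF z])
    fix l a assume "l < n" "a < N"
    show "(\<lambda>p. cols N j (snd p) (fst p) l a) \<in> borel_measurable (PiM {j..<n} (\<lambda>_. Q) \<Otimes>\<^sub>M P)"
    proof (cases "l < j")
      case True
      then show ?thesis unfolding cols_def using measurable_compose[OF measurable_snd yP] by simp
    next
      case False
      then show ?thesis unfolding cols_def using measurable_compose[OF measurable_fst comp[of l "{j..<n}"]] \<open>l < n\<close> by simp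
    qed
  qed
  have Sce: "(\<lambda>e. S (cols N j e w)) \<in> borel_measurable P" for j w
    unfolding S_def
  proof (rule measurable_stieltjes_gram[OF z])
    show "(\<lambda>e. cols N j e w l a) \<in> borel_measurable P" for l a
      unfolding cols_def using yP by (cases "l < j") simp_all
  qed
  have Fb: "cmod (F j w) \<le> 1 / Im z" for j w unfolding F_def by (rule cmod_integral_le[OF Sce Sb])
  have Fm: "F j \<in> borel_measurable (PiM {j..<n} (\<lambda>_. Q))" for j
    unfolding F_def[abs_def] by (rule borel_measurable_lebesgue_integral) (use Scm in \<open>simp add: case_prod_unfold\<close>)
  have Fi: "integrable (PiM {j..<n} (\<lambda>_. Q)) (F j)" for j
    by (rule prob_space.complex_bounded_integrable[OF pp Fm Fb])
  have Sum: "(\<lambda>p. S ((cols N (Suc j) (snd p) (fst (fst p)))(j := head_col (snd (fst p))))) \<in> borel_measurable ((PiM {Suc j..<n} (\<lambda>_. Q) \<Otimes>\<^sub>M Q) \<Otimes>\<^sub>M P)" for j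
    unfolding S_def
  proof (rule measurable_stieltjes_gram[OF z])
    fix l a assume "l < n" "a < N"
    show "(\<lambda>p. ((cols N (Suc j) (snd p) (fst (fst p)))(j := head_col (snd (fst p)))) l a) \<in> borel_measurable ((PiM {Suc j..<n} (\<lambda>_. Q) \<Otimes>\<^sub>M Q) \<Otimes>\<^sub>M P)"
    proof -
      consider "l = j" | "l < j" | "j < l" by linarith
      then show ?thesis
      proof cases
        case 1
        then show ?thesis using measurable_compose[OF measurable_fst measurable_compose[OF measurable_snd hc]] by simp
      next
        case 2
        then show ?thesis unfolding cols_def using measurable_compose[OF measurable_snd yP] by simp
      next
        case 3
        then show ?thesis unfolding cols_def
          using measurable_compose[OF measurable_fst measurable_compose[OF measurable_fst comp[of l "{Suc j..<n}"]]] \<open>l < n\<close> by simp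
      qed
    qed
  qed
  have Sume: "(\<lambda>e. S ((cols N (Suc j) e w)(j := head_col s))) \<in> borel_measurable P" for j w s
    unfolding S_def
  proof (rule measurable_stieltjes_gram[OF z])
    show "(\<lambda>e. ((cols N (Suc j) e w)(j := head_col s)) l a) \<in> borel_measurable P" for l a
      unfolding cols_def using yP by (cases "l = j"; cases "l < Suc j") simp_all
  qed
  have G1m: "(\<lambda>p. \<integral>e. S ((cols N (Suc j) e (fst p))(j := head_col (snd p))) \<partial>P) \<in> borel_measurable (PiM {Suc j..<n} (\<lambda>_. Q) \<Otimes>\<^sub>M Q)" for j
    by (rule borel_measurable_lebesgue_integral) (use Sum in \<open>simp add: case_prod_unfold\<close>)
  have G1s: "(\<lambda>s. \<integral>e. S ((cols N (Suc j) e w)(j := head_col s)) \<partial>P) \<in> borel_measurable Q" for j w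
  proof (rule borel_measurable_lebesgue_integral)
    have "(\<lambda>p. S ((cols N (Suc j) (snd p) w)(j := head_col (fst p)))) \<in> borel_measurable (Q \<Otimes>\<^sub>M P)"
      unfolding S_def
    proof (rule measurable_stieltjes_gram[OF z])
      fix l a
      show "(\<lambda>p. ((cols N (Suc j) (snd p) w)(j := head_col (fst p))) l a) \<in> borel_measurable (Q \<Otimes>\<^sub>M P)"
      proof (cases "l = j")
        case True
        then show ?thesis using measurable_compose[OF measurable_fst hc] by simp
      next
        case False
        then show ?thesis unfolding cols_def using measurable_compose[OF measurable_snd yP] by (cases "l < Suc j") simp_all
      qed
    qed
    then show "(\<lambda>(s, e). S ((cols N (Suc j) e w)(j := head_col s))) \<in> borel_measurable (Q \<Otimes>\<^sub>M P)" by (simp add: case_prod_unfold)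
  qed
  have Gm: "G j \<in> borel_measurable (PiM {Suc j..<n} (\<lambda>_. Q))" for j
    unfolding G_def[abs_def] by (rule Q.borel_measurable_lebesgue_integral) (use G1m in \<open>simp add: case_prod_unfold\<close>)
  have Gb: "cmod (G j w) \<le> 1 / Im z" for j w
    unfolding G_def by (rule Q.cmod_integral_le[OF G1s cmod_integral_le[OF Sume Sb]])
  have Gi: "integrable (PiM {Suc j..<n} (\<lambda>_. Q)) (G j)" for j
    by (rule prob_space.complex_bounded_integrable[OF pp Gm Gb])
  have RS: "cmod (R j - R (Suc j)) \<le> d" if j: "j < n" for j
  proof -
    have ins: "{j..<n} = insert j {Suc j..<n}" using j by auto
    have ce: "cols N j e (x(j := s)) = (cols N (Suc j) e x)(j := head_col s)" for e x s
      by (auto simp: cols_def fun_eq_iff)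
    have "R j = (\<integral>x. (\<integral>s. F j (x(j := s)) \<partial>Q) \<partial>PiM {Suc j..<n} (\<lambda>_. Q))"
      unfolding R_def ins by (rule PS.product_integral_insert) (use Fi[of j] ins in auto)
    also have "\<dots> = (\<integral>x. G j x \<partial>PiM {Suc j..<n} (\<lambda>_. Q))" unfolding F_def ce G_def ..
    finally have "R j - R (Suc j) = (\<integral>x. G j x - F (Suc j) x \<partial>PiM {Suc j..<n} (\<lambda>_. Q))"
      unfolding R_def using Gi Fi by simp
    moreover have "cmod (\<integral>x. G j x - F (Suc j) x \<partial>PiM {Suc j..<n} (\<lambda>_. Q)) \<le> d"
    proof (rule prob_space.cmod_integral_le[OF pp])
      show "(\<lambda>x. G j x - F (Suc j) x) \<in> borel_measurable (PiM {Suc j..<n} (\<lambda>_. Q))" using Gm Fm by (rule borel_measurable_diff)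
      show "cmod (G j x - F (Suc j) x) \<le> d" for x unfolding G_def F_def by (rule step[OF j])
    qed
    ultimately show ?thesis by simp
  qed
  have "R 0 - R n = (\<Sum>j<n. R j - R (Suc j))" by (simp only: sum_lessThan_telescope')
  then have "cmod (R 0 - R n) \<le> (\<Sum>j<n. cmod (R j - R (Suc j)))" by (simp only: norm_sum)
  also have "\<dots> \<le> (\<Sum>j<n. d)" by (rule sum_mono) (use RS in simp)
  finally have "cmod (R 0 - R n) \<le> real n * d" by simp
  moreover have "R 0 = (\<integral>w. S (\<lambda>i. head_col (w i)) \<partial>PiM {0..<n} (\<lambda>_. Q))"
  proof -
    have "F 0 w = S (\<lambda>i. head_col (w i))" for w
      unfolding F_def cols_def[abs_def] by simp
    then show ?thesis by (simp add: R_def)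
  qed
  moreover have "R n = (\<integral>e. S (\<lambda>i. yv {..<N} (int (i * N) + 1) e) \<partial>P)"
  proof -
    have "S (cols N n e w) = S (\<lambda>i. yv {..<N} (int (i * N) + 1) e)" for e w
      unfolding S_def by (subst gram_cong[of n "cols N n e w" "\<lambda>i. yv {..<N} (int (i * N) + 1) e"]) (simp_all add: cols_def[abs_def])
    then have "F n w = (\<integral>e. S (\<lambda>i. yv {..<N} (int (i * N) + 1) e) \<partial>P)" for w by (simp add: F_def)
    \<comment> \<open>No Gaussian column is left; the product over the empty index set is still a
      probability measure.\<close>
    then show ?thesis using prob_space.prob_space[OF pp[of "{n..<n}"]] by (simp add: R_def)
  qed
  ultimately show ?thesis by simp
qed

end

subsection \<open>Stationary processes\<close>

definition shift :: "int \<Rightarrow> (int \<Rightarrow> real) \<Rightarrow> int \<Rightarrow> real" where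
  "shift k e = (\<lambda>i. e (i + k))"

lemma shift_measurable [measurable]: "shift k \<in> measurable seqs seqs"
  unfolding shift_def[abs_def] by (rule measurable_abs_UNIV) simp

lemma shift_shift: "shift a (shift h e) = shift (a + h) e"
  by (simp add: shift_def add.assoc)

locale stationary_process = mixing_law P b for P b +
  fixes g :: "(int \<Rightarrow> real) \<Rightarrow> real"
  assumes shift_inv: "distr P seqs (shift h) = P"
    and g_meas [measurable]: "g \<in> borel_measurable seqs"
    and g_int: "integrable P g" and g_mean: "(\<integral>e. g e \<partial>P) = 0"
    and g_sq: "integrable P (\<lambda>e. (g e)\<^sup>2)"
begin

lemma shift_measurable_P [measurable]: "shift k \<in> measurable P seqs"
  using shift_measurable measurable_cong_sets[OF sets_P refl] by blast

lemma integral_shift: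
  fixes F :: "(int \<Rightarrow> real) \<Rightarrow> real"
  assumes [measurable]: "F \<in> borel_measurable seqs"
  shows "(\<integral>e. F (shift k e) \<partial>P) = (\<integral>e. F e \<partial>P)" "integrable P (\<lambda>e. F (shift k e)) \<longleftrightarrow> integrable P F"
proof -
  have "(\<integral>e. F e \<partial>distr P seqs (shift k)) = (\<integral>e. F (shift k e) \<partial>P)" by (rule integral_distr) measurable
  then show "(\<integral>e. F (shift k e) \<partial>P) = (\<integral>e. F e \<partial>P)" by (simp add: shift_inv)
  have "integrable (distr P seqs (shift k)) F \<longleftrightarrow> integrable P (\<lambda>e. F (shift k e))" by (rule integrable_distr_eq) measurable
  then show "integrable P (\<lambda>e. F (shift k e)) \<longleftrightarrow> integrable P F" by (simp add: shift_inv)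
qed

definition X :: "int \<Rightarrow> (int \<Rightarrow> real) \<Rightarrow> real" where "X k e = g (shift k e)"

lemma X_meas [measurable]: "X k \<in> borel_measurable seqs"
  unfolding X_def[abs_def] by measurable

definition \<sigma>2 :: real where "\<sigma>2 = (\<integral>e. (g e)\<^sup>2 \<partial>P)"

lemma \<sigma>2_nonneg: "\<sigma>2 \<ge> 0"
  by (simp add: \<sigma>2_def)

lemma X_sq: "integrable P (\<lambda>e. (X k e)\<^sup>2)" "(\<integral>e. (X k e)\<^sup>2 \<partial>P) = \<sigma>2"
  using integral_shift[of "\<lambda>e. (g e)\<^sup>2" k] g_sq by (simp_all add: X_def \<sigma>2_def)

lemma X_mult_int: "integrable P (\<lambda>e. X i e * X k e)"
  by (rule square_integrable_mult) (use X_sq in auto)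

lemma X_cov_shift: "(\<integral>e. X (i + h) e * X (k + h) e \<partial>P) = (\<integral>e. X i e * X k e \<partial>P)"
  using integral_shift(1)[of "\<lambda>e. X i e * X k e" h] by (simp add: X_def shift_shift)

text \<open>This is \<open>\<eta>\<^sup>2 / \<eta> + \<eta> * (\<sigma>2 + (2 * \<sigma>2 + 2 *
  \<eta>\<^sup>2))\<close>: squared L2 error over \<open>\<eta>\<close>, plus \<open>\<eta>\<close>
  times bounds on the second moments of \<open>X\<close> and of the approximant.\<close>

definition err :: "real \<Rightarrow> real" where
  "err \<eta> = \<eta> + \<eta> * (3 * \<sigma>2 + 2 * \<eta>\<^sup>2)"

lemma err_le:
  assumes "0 < \<eta>" "\<eta> \<le> 1" shows "err \<eta> \<le> \<eta> * (3 + 3 * \<sigma>2)"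
proof -
  have "\<eta>\<^sup>2 \<le> 1" using assms by (simp add: power_le_one)
  then have "\<eta> * (3 * \<sigma>2 + 2 * \<eta>\<^sup>2) \<le> \<eta> * (3 * \<sigma>2 + 2)" using assms by (intro mult_left_mono) auto
  then show ?thesis by (simp add: err_def algebra_simps)
qed

definition approx :: "real \<Rightarrow> ((int \<Rightarrow> real) \<Rightarrow> real) \<Rightarrow> nat \<Rightarrow> real \<Rightarrow> bool" where
  "approx \<eta> w m T \<longleftrightarrow> window_process P b (\<lambda>k e. w (shift k e)) m T \<and> w \<in> borel_measurable seqs \<and>
     (\<integral>e. (g e - w e)\<^sup>2 \<partial>P) \<le> \<eta>\<^sup>2"

lemma approx_exists:
  assumes "\<eta> > 0" shows "\<exists>w m T. approx \<eta> w m T"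
proof -
  have "\<eta>\<^sup>2 > 0" using assms by simp
  from window_fun_approx_centered[OF prob_space_axioms sets_P g_meas g_int g_mean g_sq this]
  obtain w where w: "window_fun w" "(\<integral>x. w x \<partial>P) = 0" "(\<integral>x. (g x - w x)\<^sup>2 \<partial>P) < \<eta>\<^sup>2"
    by (elim exE conjE) (rule that)
  obtain T m where wm[measurable]: "w \<in> borel_measurable seqs" and wT: "\<And>e. \<bar>w e\<bar> \<le> T"
    and win: "\<And>e e'. (\<forall>i. \<bar>i\<bar> \<le> int m \<longrightarrow> e i = e' i) \<Longrightarrow> w e = w e'"
    using w(1) unfolding window_fun_def by (elim conjE exE) (rule that, auto)
  have "window_process P b (\<lambda>k e. w (shift k e)) m T"
  proof unfold_locales
    show "(\<lambda>e. w (shift k e)) \<in> borel_measurable seqs" for k by measurable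
    show "\<bar>w (shift k e)\<bar> \<le> T" for k e by (rule wT)
    show "w (shift k e) = w (shift k e')" if "\<And>i. \<bar>i - k\<bar> \<le> int m \<Longrightarrow> e i = e' i" for k e e'
      by (rule win) (auto simp: shift_def intro!: that)
    show "(\<integral>e. w (shift k e) \<partial>P) = 0" for k using w(2) integral_shift(1)[OF wm] by simp
  qed
  then have "approx \<eta> w m T" using wm w(3) by (simp add: approx_def)
  then show ?thesis by blast
qed

text \<open>By Young's inequality sums of these terms dominate differences of quadratic forms and of products.\<close>

definition gap_term :: "real \<Rightarrow> real \<Rightarrow> real \<Rightarrow> real" where
  "gap_term \<eta> x y = (x - y)\<^sup>2 / \<eta> + \<eta> * (x\<^sup>2 + y\<^sup>2)"

text \<open>The second moment of the approximant is bounded through \<open>\<sigma>2\<close> and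
  \<open>\<eta>\<close>. The cruder bound by \<open>T\<close> would be useless, as \<open>T\<close>
  depends on \<open>\<eta>\<close> in an uncontrolled way.\<close>

lemma gap_term_integral:
  assumes ap: "approx \<eta> w m T" and \<eta>: "\<eta> > 0"
  shows "integrable P (\<lambda>e. gap_term \<eta> (X k e) (w (shift k e)))"
    "(\<integral>e. gap_term \<eta> (X k e) (w (shift k e)) \<partial>P) \<le> err \<eta>"
    "integrable P (\<lambda>e. (w (shift k e))\<^sup>2)"
proof -
  interpret W: window_process P b "\<lambda>k e. w (shift k e)" m T using ap by (simp add: approx_def)
  have [measurable]: "w \<in> borel_measurable seqs" using ap by (simp add: approx_def)
  show wi: "integrable P (\<lambda>e. (w (shift k e))\<^sup>2)"
    by (rule bounded_integrable[where C="T\<^sup>2"]) (use W.Y_sq in auto)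
  have di: "integrable P (\<lambda>e. (X k e - w (shift k e))\<^sup>2)"
  proof (rule Bochner_Integration.integrable_bound[of _ "\<lambda>e. 2 * (X k e)\<^sup>2 + 2 * (w (shift k e))\<^sup>2"])
    show "AE e in P. norm ((X k e - w (shift k e))\<^sup>2) \<le> norm (2 * (X k e)\<^sup>2 + 2 * (w (shift k e))\<^sup>2)"
      using square_add_le[of "X k e" "- w (shift k e)" for e] by (intro AE_I2) simp
  qed (use X_sq wi in auto)
  have dI: "(\<integral>e. (X k e - w (shift k e))\<^sup>2 \<partial>P) \<le> \<eta>\<^sup>2"
    using integral_shift(1)[of "\<lambda>e. (g e - w e)\<^sup>2" k] ap by (simp add: X_def approx_def)
  have wI: "(\<integral>e. (w (shift k e))\<^sup>2 \<partial>P) \<le> 2 * \<sigma>2 + 2 * \<eta>\<^sup>2"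
  proof -
    have "(\<integral>e. (w (shift k e))\<^sup>2 \<partial>P) \<le> (\<integral>e. 2 * (X k e)\<^sup>2 + 2 * (X k e - w (shift k e))\<^sup>2 \<partial>P)"
    proof (rule integral_mono')
      show "(w (shift k e))\<^sup>2 \<le> 2 * (X k e)\<^sup>2 + 2 * (X k e - w (shift k e))\<^sup>2" for e
        using square_add_le[of "X k e" "w (shift k e) - X k e"] by (simp add: power2_commute)
    qed (use X_sq di in auto)
    also have "\<dots> = 2 * \<sigma>2 + 2 * (\<integral>e. (X k e - w (shift k e))\<^sup>2 \<partial>P)" using X_sq di by simp
    finally show ?thesis using dI by linarith
  qed
  show "integrable P (\<lambda>e. gap_term \<eta> (X k e) (w (shift k e)))" unfolding gap_term_def using di X_sq wi by simp
  have "(\<integral>e. gap_term \<eta> (X k e) (w (shift k e)) \<partial>P) = (\<integral>e. (X k e - w (shift k e))\<^sup>2 \<partial>P) / \<eta> + \<eta> * (\<sigma>2 + (\<integral>e. (w (shift k e))\<^sup>2 \<partial>P))"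
    unfolding gap_term_def using di X_sq wi by simp
  also have "\<dots> \<le> \<eta>\<^sup>2 / \<eta> + \<eta> * (\<sigma>2 + (2 * \<sigma>2 + 2 * \<eta>\<^sup>2))"
    using dI wI \<eta> by (intro add_mono divide_right_mono mult_left_mono) auto
  also have "\<dots> = err \<eta>" using \<eta> by (simp add: err_def power2_eq_square)
  finally show "(\<integral>e. gap_term \<eta> (X k e) (w (shift k e)) \<partial>P) \<le> err \<eta>" .
qed

lemma cov_approx:
  assumes ap: "approx \<eta> w m T" and \<eta>: "\<eta> > 0"
  shows "\<bar>(\<integral>e. X i e * X k e \<partial>P) - (\<integral>e. w (shift i e) * w (shift k e) \<partial>P)\<bar> \<le> err \<eta>"
proof -
  interpret W: window_process P b "\<lambda>k e. w (shift k e)" m T using ap by (simp add: approx_def)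
  have [measurable]: "w \<in> borel_measurable seqs" using ap by (simp add: approx_def)
  note gi = gap_term_integral[OF ap \<eta>]
  have YY: "integrable P (\<lambda>e. w (shift i e) * w (shift k e))"
    by (rule square_integrable_mult) (use gi(3) in auto)
  have am: "\<bar>u * v\<bar> \<le> (u\<^sup>2 / \<eta> + \<eta> * v\<^sup>2) / 2" for u v :: real
  proof -
    have "2 * \<bar>u\<bar> * (\<eta> * \<bar>v\<bar>) \<le> \<bar>u\<bar>\<^sup>2 + (\<eta> * \<bar>v\<bar>)\<^sup>2" by (rule sum_squares_bound)
    then have "2 * \<eta> * \<bar>u * v\<bar> \<le> u\<^sup>2 + \<eta>\<^sup>2 * v\<^sup>2" by (simp add: abs_mult power_mult_distrib mult_ac)
    then show ?thesis using \<eta> by (simp add: field_simps power2_eq_square)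
  qed
  have pt: "\<bar>x1 * x2 - y1 * y2\<bar> \<le> (gap_term \<eta> x1 y1 + gap_term \<eta> x2 y2) / 2" for x1 x2 y1 y2
  proof -
    have "x1 * x2 - y1 * y2 = (x1 - y1) * x2 + (x2 - y2) * y1" by (simp add: algebra_simps)
    then have "\<bar>x1 * x2 - y1 * y2\<bar> \<le> \<bar>(x1 - y1) * x2\<bar> + \<bar>(x2 - y2) * y1\<bar>" by (simp only: abs_triangle_ineq)
    also have "\<dots> \<le> ((x1 - y1)\<^sup>2 / \<eta> + \<eta> * x2\<^sup>2) / 2 + ((x2 - y2)\<^sup>2 / \<eta> + \<eta> * y1\<^sup>2) / 2"
      by (intro add_mono am)
    also have "\<dots> \<le> (gap_term \<eta> x1 y1 + gap_term \<eta> x2 y2) / 2"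
    proof -
      have "0 \<le> \<eta> * x1\<^sup>2" "0 \<le> \<eta> * y2\<^sup>2" using \<eta> by simp_all
      then show ?thesis unfolding gap_term_def distrib_left add_divide_distrib[symmetric]
        by (intro divide_right_mono) simp_all
    qed
    finally show ?thesis .
  qed
  have gap0: "0 \<le> gap_term \<eta> x y" for x y using \<eta> by (simp add: gap_term_def)
  have "\<bar>(\<integral>e. X i e * X k e \<partial>P) - (\<integral>e. w (shift i e) * w (shift k e) \<partial>P)\<bar>
     = \<bar>\<integral>e. X i e * X k e - w (shift i e) * w (shift k e) \<partial>P\<bar>" using X_mult_int YY by simp
  also have "\<dots> \<le> (\<integral>e. \<bar>X i e * X k e - w (shift i e) * w (shift k e)\<bar> \<partial>P)" by (rule integral_abs_bound)
  also have "\<dots> \<le> (\<integral>e. (gap_term \<eta> (X i e) (w (shift i e)) + gap_term \<eta> (X k e) (w (shift k e))) / 2 \<partial>P)"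
    by (rule integral_mono') (use gi(1) pt gap0 in auto)
  also have "\<dots> = ((\<integral>e. gap_term \<eta> (X i e) (w (shift i e)) \<partial>P) + (\<integral>e. gap_term \<eta> (X k e) (w (shift k e)) \<partial>P)) / 2"
    using gi(1) by simp
  also have "\<dots> \<le> err \<eta>" using gi(2)[of i] gi(2)[of k] by simp
  finally show ?thesis .
qed

lemma X_cov_bound: "\<bar>\<integral>e. X i e * X k e \<partial>P\<bar> \<le> \<sigma>2"
proof -
  have "\<bar>\<integral>e. X i e * X k e \<partial>P\<bar> \<le> (\<integral>e. \<bar>X i e * X k e\<bar> \<partial>P)" by (rule integral_abs_bound)
  also have "\<dots> \<le> (\<integral>e. ((X i e)\<^sup>2 + (X k e)\<^sup>2) / 2 \<partial>P)"
  proof (rule integral_mono')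
    show "\<bar>X i e * X k e\<bar> \<le> ((X i e)\<^sup>2 + (X k e)\<^sup>2) / 2" for e
      using sum_squares_bound[of "\<bar>X i e\<bar>" "\<bar>X k e\<bar>"] by (simp add: abs_mult)
  qed (use X_sq in auto)
  also have "\<dots> = \<sigma>2" using X_sq by simp
  finally show ?thesis .
qed

text \<open>\<open>cov_far\<close> is about window processes. By \<open>cov_approx\<close> the
  covariances of \<open>X\<close> differ from those of an approximant by a small amount, uniformly
  in the indices, so they too are small far from the diagonal.\<close>

lemma X_gram_small:
  assumes "\<phi> > 0"
  shows "\<exists>N0. \<forall>N\<ge>N0. \<forall>s. (\<Sum>i<N. \<Sum>k<N. (\<integral>e. X (s + int i) e * X (s + int k) e \<partial>P)\<^sup>2) \<le> (\<phi> * real N)\<^sup>2"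
proof (rule sum_sq_small[OF X_cov_bound _ assms])
  fix \<zeta> :: real assume \<zeta>: "\<zeta> > 0"
  \<comment> \<open>With \<open>err_le\<close>, valid for \<open>\<eta> \<le> 1\<close>, this makes
    \<open>err \<eta>\<close> at most \<open>\<zeta> / 2\<close>.\<close>
  define \<eta> where "\<eta> = min 1 (\<zeta> / 2 / (3 + 3 * \<sigma>2))"
  have \<eta>: "\<eta> > 0" "\<eta> \<le> 1" using \<zeta> \<sigma>2_nonneg by (simp_all add: \<eta>_def)
  have pos: "3 + 3 * \<sigma>2 > 0" using \<sigma>2_nonneg by linarith
  have "\<eta> \<le> \<zeta> / 2 / (3 + 3 * \<sigma>2)" by (simp add: \<eta>_def)
  then have "\<eta> * (3 + 3 * \<sigma>2) \<le> \<zeta> / 2" using pos by (simp only: pos_le_divide_eq)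
  then have e: "err \<eta> \<le> \<zeta> / 2" using err_le[OF \<eta>] by linarith
  obtain w m T where ap: "approx \<eta> w m T" using approx_exists[OF \<eta>(1)] by blast
  interpret W: window_process P b "\<lambda>k e. w (shift k e)" m T using ap by (simp add: approx_def)
  obtain D where D: "\<And>s i k. i + D \<le> k \<or> k + D \<le> i \<Longrightarrow> \<bar>\<integral>e. w (shift (s + int i) e) * w (shift (s + int k) e) \<partial>P\<bar> \<le> \<zeta> / 2"
    using W.cov_far[of "\<zeta> / 2"] \<zeta> by auto
  have "\<bar>\<integral>e. X (s + int i) e * X (s + int k) e \<partial>P\<bar> \<le> \<zeta>" if "i + D \<le> k \<or> k + D \<le> i" for s i k
    using D[OF that, of s] cov_approx[OF ap \<eta>(1), of "s + int i" "s + int k"] e by linarith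
  then show "\<exists>D. \<forall>s i k. i + D \<le> k \<or> k + D \<le> i \<longrightarrow> \<bar>\<integral>e. X (s + int i) e * X (s + int k) e \<partial>P\<bar> \<le> \<zeta>" by blast
qed

lemma column_gap:
  assumes ap: "approx \<eta> w m T" and \<eta>: "\<eta> > 0"
  defines "G \<equiv> \<lambda>s N e. (\<Sum>i<N. (X (s + int i) e - w (shift (s + int i) e))\<^sup>2) / \<eta>
     + \<eta> * ((\<Sum>i<N. (X (s + int i) e)\<^sup>2) + (\<Sum>i<N. (w (shift (s + int i) e))\<^sup>2))"
  shows "integrable P (G s N)" "(\<integral>e. G s N e \<partial>P) \<le> real N * err \<eta>"
proof -
  note gi = gap_term_integral[OF ap \<eta>]
  have G: "G s N = (\<lambda>e. \<Sum>i<N. gap_term \<eta> (X (s + int i) e) (w (shift (s + int i) e)))"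
    unfolding G_def gap_term_def by (simp add: sum.distrib sum_divide_distrib sum_distrib_left distrib_left)
  show "integrable P (G s N)" unfolding G using gi(1) by simp
  have "(\<integral>e. G s N e \<partial>P) = (\<Sum>i<N. \<integral>e. gap_term \<eta> (X (s + int i) e) (w (shift (s + int i) e)) \<partial>P)"
    unfolding G using gi(1) by (simp add: Bochner_Integration.integral_sum)
  also have "\<dots> \<le> (\<Sum>i<N. err \<eta>)" by (rule sum_mono) (rule gi(2))
  finally show "(\<integral>e. G s N e \<partial>P) \<le> real N * err \<eta>" by simp
qed

text \<open>Each of the \<open>n\<close> columns contributes an expected error of order
  \<open>real N * err \<eta>\<close> with a weight proportional to
  \<open>1 / (real n * real N)\<close>, so the total is independent of both dimensions.\<close>

lemma X_columns_approx:
  fixes n N :: nat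
  assumes ap: "approx \<eta> w m T" and \<eta>: "\<eta> > 0" and z: "Im z > 0" and N: "N > 0" and n: "n > 0"
  defines "K \<equiv> 1 / Im z + 1 / (Im z)\<^sup>2"
  defines "S \<equiv> \<lambda>u. stieltjes (cmat N (gram n u)) z"
  shows "cmod ((\<integral>e. S (\<lambda>j a. X (int (j * N + a + 1)) e) \<partial>P)
      - (\<integral>e. S (\<lambda>j. window_process.yv (\<lambda>k e. w (shift k e)) {..<N} (int (j * N) + 1) e) \<partial>P))
    \<le> 4 * swap_const z * (K * err \<eta>)"
proof -
  interpret W: window_process P b "\<lambda>k e. w (shift k e)" m T using ap by (simp add: approx_def)
  define c0 where "c0 = swap_const z / (real n * real N)"
  have c0: "c0 \<ge> 0" using swap_const_nonneg[OF z] by (simp add: c0_def)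
  have K: "K \<ge> 0" using z by (simp add: K_def)
  define u where "u e j a = X (int (j * N + a + 1)) e" for e and j a :: nat
  define v where "v e j = W.yv {..<N} (int (j * N) + 1) e" for e and j :: nat
  define G where "G j e = (\<Sum>i<N. (X (int (j * N) + 1 + int i) e - w (shift (int (j * N) + 1 + int i) e))\<^sup>2) / \<eta>
     + \<eta> * ((\<Sum>i<N. (X (int (j * N) + 1 + int i) e)\<^sup>2) + (\<Sum>i<N. (w (shift (int (j * N) + 1 + int i) e))\<^sup>2))" for j e
  have Gi: "integrable P (G j)" and GI: "(\<integral>e. G j e \<partial>P) \<le> real N * err \<eta>" for j
    unfolding G_def[abs_def] using column_gap[OF ap \<eta>, of "int (j * N) + 1" N] by auto
  have uX: "u e j i = X (int (j * N) + 1 + int i) e" for e j i by (simp add: u_def add_ac)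
  have vY: "v e j i = w (shift (int (j * N) + 1 + int i) e)" if "i < N" for e j i
    using that by (simp add: v_def W.yv_def)
  have um: "(\<lambda>e. u e j a) \<in> borel_measurable P" for j a unfolding u_def by measurable
  have vm: "(\<lambda>e. v e j a) \<in> borel_measurable P" for j a unfolding v_def by measurable
  have Sb: "cmod (S u) \<le> 1 / Im z" for u unfolding S_def by (rule stieltjes_bound[OF symmetric_gram z])
  have Sm: "(\<lambda>e. S (u e)) \<in> borel_measurable P" "(\<lambda>e. S (v e)) \<in> borel_measurable P"
    unfolding S_def by (rule measurable_stieltjes_gram[OF z um] measurable_stieltjes_gram[OF z vm])+
  have Si: "integrable P (\<lambda>e. S (u e))" "integrable P (\<lambda>e. S (v e))"
    by (rule complex_bounded_integrable[OF Sm(1) Sb] complex_bounded_integrable[OF Sm(2) Sb])+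
  have bd: "cmod (S (u e) - S (v e)) \<le> (\<Sum>j<n. c0 * (4 * (K * G j e)))" for e
  proof -
    have "cmod (S (u e) - S (v e)) \<le> (\<Sum>j<n. c0 * (4 * (K * ((\<Sum>i<N. (u e j i - v e j i)\<^sup>2) / \<eta>
        + \<eta> * ((\<Sum>i<N. (u e j i)\<^sup>2) + (\<Sum>i<N. (v e j i)\<^sup>2))))))"
      unfolding S_def c0_def K_def by (rule stieltjes_replace_columns[OF z N n \<eta>])
    also have "\<dots> = (\<Sum>j<n. c0 * (4 * (K * G j e)))" unfolding G_def uX by (simp add: vY)
    finally show ?thesis .
  qed
  have "cmod ((\<integral>e. S (u e) \<partial>P) - (\<integral>e. S (v e) \<partial>P)) = cmod (\<integral>e. S (u e) - S (v e) \<partial>P)" using Si by simp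
  also have "\<dots> \<le> (\<integral>e. (\<Sum>j<n. c0 * (4 * (K * G j e))) \<partial>P)"
    by (rule norm_integral_le[OF _ _ bd]) (use Si Gi in auto)
  also have "\<dots> = (\<Sum>j<n. c0 * (4 * (K * (\<integral>e. G j e \<partial>P))))"
    using Gi by (simp add: Bochner_Integration.integral_sum)
  also have "\<dots> \<le> (\<Sum>j<n. c0 * (4 * (K * (real N * err \<eta>))))"
    using GI c0 K by (intro sum_mono mult_left_mono) auto
  also have "\<dots> = (real n * real N * c0) * (4 * (K * err \<eta>))" by simp
  also have "real n * real N * c0 = swap_const z" using N n by (simp add: c0_def)
  finally show ?thesis unfolding u_def v_def by (simp add: mult_ac)
qed

text \<open>Supplies the \<open>\<rho>\<close> of \<open>hybrid_step\<close>: the Gaussian columns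
  have the covariances of \<open>X\<close>, not those of the approximant, so the centres of the two
  forms differ slightly.\<close>

lemma trace_approx:
  fixes N :: nat
  assumes ap: "approx \<eta> w m T" and \<eta>: "\<eta> > 0" and A: "op_bound N K A" and K: "K \<ge> 0"
  shows "\<bar>(\<integral>e. quad_form N A (\<lambda>a. X (s + int a) e) \<partial>P)
      - (\<integral>e. quad_form N A (window_process.yv (\<lambda>k e. w (shift k e)) UNIV s e) \<partial>P)\<bar> \<le> (K * err \<eta>) * real N"
proof -
  interpret W: window_process P b "\<lambda>k e. w (shift k e)" m T using ap by (simp add: approx_def)
  note cg = column_gap[OF ap \<eta>, of s N]
  have Xi: "integrable P (\<lambda>e. quad_form N A (\<lambda>a. X (s + int a) e))"
  proof -
    have "quad_form N A (\<lambda>a. X (s + int a) e) = (\<Sum>i<N. \<Sum>k<N. A i k * (X (s + int i) e * X (s + int k) e))" for e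
      unfolding quad_form_def by (intro sum.cong refl) (simp only: mult_ac)
    then show ?thesis using X_mult_int by simp
  qed
  have Yi: "integrable P (\<lambda>e. quad_form N A (W.yv UNIV s e))"
    by (rule bounded_integrable[OF _ W.quad_form_yv_abs_bound[OF A K]]) (use W.quad_form_yv_measurable in measurable)
  have "\<bar>(\<integral>e. quad_form N A (\<lambda>a. X (s + int a) e) \<partial>P) - (\<integral>e. quad_form N A (W.yv UNIV s e) \<partial>P)\<bar>
     = \<bar>\<integral>e. quad_form N A (\<lambda>a. X (s + int a) e) - quad_form N A (W.yv UNIV s e) \<partial>P\<bar>" using Xi Yi by simp
  also have "\<dots> \<le> (\<integral>e. \<bar>quad_form N A (\<lambda>a. X (s + int a) e) - quad_form N A (W.yv UNIV s e)\<bar> \<partial>P)" by (rule integral_abs_bound)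
  also have "\<dots> \<le> (\<integral>e. K * ((\<Sum>i<N. (X (s + int i) e - w (shift (s + int i) e))\<^sup>2) / \<eta>
     + \<eta> * ((\<Sum>i<N. (X (s + int i) e)\<^sup>2) + (\<Sum>i<N. (w (shift (s + int i) e))\<^sup>2))) \<partial>P)"
  proof (rule integral_mono)
    show "integrable P (\<lambda>e. \<bar>quad_form N A (\<lambda>a. X (s + int a) e) - quad_form N A (W.yv UNIV s e)\<bar>)" using Xi Yi by simp
    show "integrable P (\<lambda>e. K * ((\<Sum>i<N. (X (s + int i) e - w (shift (s + int i) e))\<^sup>2) / \<eta>
     + \<eta> * ((\<Sum>i<N. (X (s + int i) e)\<^sup>2) + (\<Sum>i<N. (w (shift (s + int i) e))\<^sup>2))))"
      using cg(1) by (rule integrable_mult_right)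
    show "\<bar>quad_form N A (\<lambda>a. X (s + int a) e) - quad_form N A (W.yv UNIV s e)\<bar>
      \<le> K * ((\<Sum>i<N. (X (s + int i) e - w (shift (s + int i) e))\<^sup>2) / \<eta>
     + \<eta> * ((\<Sum>i<N. (X (s + int i) e)\<^sup>2) + (\<Sum>i<N. (w (shift (s + int i) e))\<^sup>2)))" for e
      using quad_form_diff_young[OF A K \<eta>, of "\<lambda>a. X (s + int a) e" "W.yv UNIV s e"] by (simp add: W.yv_def)
  qed
  also have "\<dots> \<le> K * (real N * err \<eta>)"
    using cg(2) K by (subst integral_mult_right_zero) (rule mult_left_mono)
  finally show ?thesis by (simp add: mult_ac)
qed

end

context stationary_process begin

text \<open>\<open>err \<eta>\<close> is paid twice, for replacing \<open>X\<close> by the window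
  process and for the difference of the centres in the exchanges; together this takes a quarter of
  \<open>r\<close>. Another quarter goes to \<open>5 * \<kappa>\<close>: four from
  \<open>hybrid_step\<close>, one for the decoupling error. Of Gaussianity only the moment
  identities of \<open>Q\<close> enter.\<close>

lemma stieltjes_difference_tendsto:
  assumes Q: "prob_space Q" and sQ: "sets Q = sets seqs"
    and Q4: "\<And>a b c d. integrable Q (\<lambda>s. s a * s b * s c * s d :: real)"
    and Q2: "\<And>a b. integrable Q (\<lambda>s. s a * s b)"
    and QX: "\<And>a b. (\<integral>s. s a * s b \<partial>Q) = (\<integral>e. X a e * X b e \<partial>P)"
    and QE: "\<And>a b c d. (\<integral>s. s a * s b * s c * s d \<partial>Q) = (\<integral>s. s a * s b \<partial>Q) * (\<integral>s. s c * s d \<partial>Q)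
      + (\<integral>s. s a * s c \<partial>Q) * (\<integral>s. s b * s d \<partial>Q) + (\<integral>s. s a * s d \<partial>Q) * (\<integral>s. s b * s c \<partial>Q)"
    and z: "Im z > 0" and N_pos: "\<And>n. N n > 0" and N_lim: "filterlim N at_top sequentially"
  shows "(\<lambda>n. cmod ((\<integral>e. stieltjes (cmat (N n) (gram n (\<lambda>j a. X (int (j * N n + a + 1)) e))) z \<partial>P)
     - (\<integral>w. stieltjes (cmat (N n) (gram n (\<lambda>i. head_col (w i)))) z \<partial>PiM {0..<n} (\<lambda>_. Q)))) \<longlonglongrightarrow> 0"
proof (rule tendstoI)
  fix r :: real assume r: "r > 0"
  interpret Q: prob_space Q by fact
  define K where "K = 1 / Im z + 1 / (Im z)\<^sup>2"
  have K: "K \<ge> 0" using z by (simp add: K_def)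
  define c where "c = 4 * swap_const z"
  have c: "c \<ge> 0" using swap_const_nonneg[OF z] by (simp add: c_def)
  \<comment> \<open>By \<open>err_le\<close> the two approximation errors together are at most
    \<open>\<eta> * B1\<close>.\<close>
  define B1 where "B1 = 2 * c * K * (3 + 3 * \<sigma>2)"
  have B1: "B1 \<ge> 0" using c K \<sigma>2_nonneg by (simp add: B1_def)
  define \<eta> where "\<eta> = min 1 (r / 4 / (B1 + 1))"
  have \<eta>: "\<eta> > 0" "\<eta> \<le> 1" using r B1 by (simp_all add: \<eta>_def)
  have err1: "2 * (c * (K * err \<eta>)) \<le> r / 4"
  proof -
    have "\<eta> \<le> r / 4 / (B1 + 1)" by (simp add: \<eta>_def)
    then have "\<eta> * (B1 + 1) \<le> r / 4" using B1 by (subst (asm) pos_le_divide_eq) auto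
    moreover have "\<eta> * B1 \<le> \<eta> * (B1 + 1)" using \<eta> by (intro mult_left_mono) auto
    moreover have "2 * c * K * err \<eta> \<le> 2 * c * K * (\<eta> * (3 + 3 * \<sigma>2))"
      using c K by (intro mult_left_mono err_le[OF \<eta>]) auto
    moreover have "2 * c * K * (\<eta> * (3 + 3 * \<sigma>2)) = \<eta> * B1" by (simp add: B1_def)
    ultimately have "2 * c * K * err \<eta> \<le> r / 4" by linarith
    then show ?thesis by (simp only: mult.assoc)
  qed
  define \<kappa> where "\<kappa> = r / 4 / (5 * c + 1)"
  have \<kappa>: "\<kappa> > 0" using r c by (simp add: \<kappa>_def)
  have \<kappa>1: "c * (5 * \<kappa>) \<le> r / 4"
  proof -
    have "c * (5 * \<kappa>) \<le> (5 * c + 1) * \<kappa>" using \<kappa> by (simp add: algebra_simps)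
    also have "\<dots> = r / 4"
    proof -
      show ?thesis unfolding \<kappa>_def by (rule mult_divide_self) (use c in simp)
    qed
    finally show ?thesis .
  qed
  obtain w m T where ap: "approx \<eta> w m T" using approx_exists[OF \<eta>(1)] by blast
  interpret W: window_process P b "\<lambda>k e. w (shift k e)" m T using ap by (simp add: approx_def)
  have "(\<lambda>q. 2 * K * T\<^sup>2 * b q) \<longlonglongrightarrow> 0" using tendsto_mult[OF tendsto_const b_lim, of "2 * K * T\<^sup>2"] by simp
  then have "eventually (\<lambda>q. 2 * K * T\<^sup>2 * b q < \<kappa>) sequentially" using \<kappa> by (rule order_tendstoD)
  then obtain q0 where "\<And>q. q \<ge> q0 \<Longrightarrow> 2 * K * T\<^sup>2 * b q < \<kappa>" by (auto simp: eventually_sequentially)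
  then have q0: "2 * K * T\<^sup>2 * b (Suc q0) < \<kappa>" by simp
  define q where "q = Suc q0"
  have q: "q \<ge> 1" "2 * K * T\<^sup>2 * b q < \<kappa>" using q0 by (simp_all add: q_def)
  have "\<kappa>\<^sup>2 > 0" using \<kappa> by simp
  from W.quad_form_concentration[OF K this]
  obtain N1 where N1: "\<forall>M\<ge>N1. \<forall>s A. op_bound M K A \<longrightarrow> var (\<lambda>e. quad_form M A (\<lambda>i. w (shift (s + int i) e))) \<le> \<kappa>\<^sup>2 * (real M)\<^sup>2"
    by (elim exE) (rule that)
  \<comment> \<open>The Isserlis bound becomes \<open>2 * (K * \<phi> * real M)\<^sup>2\<close>;
    since \<open>K * \<phi> \<le> \<kappa> / 2\<close>, this is below
    \<open>(\<kappa> * real M)\<^sup>2\<close>.\<close>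
  define \<phi> where "\<phi> = \<kappa> / 2 / (K + 1)"
  have \<phi>: "\<phi> > 0" using \<kappa> K by (simp add: \<phi>_def)
  from X_gram_small[OF \<phi>]
  obtain N2 where N2: "\<forall>M\<ge>N2. \<forall>s. (\<Sum>i<M. \<Sum>k<M. (\<integral>e. X (s + int i) e * X (s + int k) e \<partial>P)\<^sup>2) \<le> (\<phi> * real M)\<^sup>2"
    by (elim exE) (rule that)
  define E where "E = 4 * K\<^sup>2 * T^4 * real (2 * m + q)"
  obtain N3 :: nat where N3: "E / \<kappa>\<^sup>2 \<le> real N3" using real_arch_simple[of "E / \<kappa>\<^sup>2"] by (elim exE) (rule that)
  have key: "cmod ((\<integral>e. stieltjes (cmat M (gram n (\<lambda>j a. X (int (j * M + a + 1)) e))) z \<partial>P)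
     - (\<integral>w. stieltjes (cmat M (gram n (\<lambda>i. head_col (w i)))) z \<partial>PiM {0..<n} (\<lambda>_. Q))) < r"
    if M: "M > 0" "M \<ge> N1" "M \<ge> N2" "M \<ge> N3" and n: "n > 0" for M n
  proof -
    have Zint: "integrable Q (\<lambda>s. quad_form M A (head_col s))" for A
    proof -
      have "quad_form M A (head_col s) = (\<Sum>i<M. \<Sum>k<M. A i k * (s (int (i + 1)) * s (int (k + 1))))" for s
        unfolding quad_form_def head_col_def by (intro sum.cong refl) (simp only: mult_ac)
      then show ?thesis using Q2 by simp
    qed
    note h2 = Q2[of "int (a + 1)" "int (b + 1)" for a b, folded head_col_def]
    note h4 = Q4[of "int (a + 1)" "int (b + 1)" "int (c + 1)" "int (d + 1)" for a b c d, folded head_col_def]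
    note hE = QE[of "int (a + 1)" "int (b + 1)" "int (c + 1)" "int (d + 1)" for a b c d, folded head_col_def]
    have iss: "Q.var (\<lambda>s. quad_form M A (head_col s)) \<le> 2 * K\<^sup>2 * (\<Sum>i<M. \<Sum>k<M. (\<integral>s. head_col s i * head_col s k \<partial>Q)\<^sup>2)"
      "integrable Q (\<lambda>s. (quad_form M A (head_col s))\<^sup>2)" if A: "op_bound M K A" for A
      using Q.isserlis_quad_form_variance[of "\<lambda>i s. head_col s i", OF h2 h4 hE A] by simp_all
    have aM: "\<kappa> * real M > 0" using \<kappa> M by simp
    have Zdev: "(\<integral>s. \<bar>quad_form M A (head_col s) - (\<integral>s. quad_form M A (head_col s) \<partial>Q)\<bar> \<partial>Q) \<le> \<kappa> * real M"
      if A: "op_bound M K A" for A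
    proof (rule Q.abs_deviation_le[OF Zint iss(2)[OF A] _ aM])
      have "(\<Sum>i<M. \<Sum>k<M. (\<integral>s. head_col s i * head_col s k \<partial>Q)\<^sup>2) = (\<Sum>i<M. \<Sum>k<M. (\<integral>e. X (1 + int i) e * X (1 + int k) e \<partial>P)\<^sup>2)"
        unfolding head_col_def QX by (simp add: add.commute)
      also have "\<dots> \<le> (\<phi> * real M)\<^sup>2" using N2 M(3) by blast
      finally have s: "(\<Sum>i<M. \<Sum>k<M. (\<integral>s. head_col s i * head_col s k \<partial>Q)\<^sup>2) \<le> (\<phi> * real M)\<^sup>2" .
      have "Q.var (\<lambda>s. quad_form M A (head_col s)) \<le> 2 * K\<^sup>2 * (\<phi> * real M)\<^sup>2"
        using iss(1)[OF A] mult_left_mono[OF s, of "2 * K\<^sup>2"] by simp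
      also have "\<dots> = 2 * (K * \<phi> * real M)\<^sup>2" by (simp add: power_mult_distrib)
      also have "\<dots> \<le> 2 * (\<kappa> / 2 * real M)\<^sup>2"
      proof (intro mult_left_mono power_mono mult_right_mono)
        have "K * \<phi> \<le> (K + 1) * \<phi>" using \<phi> by (intro mult_right_mono) auto
        also have "\<dots> = \<kappa> / 2"
        proof -
          show ?thesis unfolding \<phi>_def by (rule mult_divide_self) (use K in simp)
        qed
        finally show "K * \<phi> \<le> \<kappa> / 2" .
      qed (use K \<phi> in auto)
      also have "\<dots> \<le> (\<kappa> * real M)\<^sup>2" by (simp add: power_mult_distrib power_divide)
      finally show "Q.var (\<lambda>s. quad_form M A (head_col s)) \<le> (\<kappa> * real M)\<^sup>2" .
    qed
    have tr: "\<bar>(\<integral>s. quad_form M A (head_col s) \<partial>Q) - (\<integral>e. quad_form M A (W.yv UNIV (int (j * M) + 1) e) \<partial>P)\<bar> \<le> (K * err \<eta>) * real M"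
      if A: "op_bound M K A" for A j
    proof -
      have "(\<integral>s. quad_form M A (head_col s) \<partial>Q) = (\<Sum>i<M. \<Sum>k<M. A i k * (\<integral>e. X (int (i + 1)) e * X (int (k + 1)) e \<partial>P))"
      proof -
        have "quad_form M A (head_col s) = (\<Sum>i<M. \<Sum>k<M. A i k * (s (int (i + 1)) * s (int (k + 1))))" for s
          unfolding quad_form_def head_col_def by (intro sum.cong refl) (simp only: mult_ac)
        then show ?thesis using Q2 unfolding QX[symmetric] by (simp add: Bochner_Integration.integral_sum)
      qed
      \<comment> \<open>Stationarity carries the covariances of the first column over to column
        \<open>j\<close>.\<close>
      also have "\<dots> = (\<Sum>i<M. \<Sum>k<M. A i k * (\<integral>e. X (int (j * M) + 1 + int i) e * X (int (j * M) + 1 + int k) e \<partial>P))"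
        using X_cov_shift[of "int (i + 1)" "int (j * M)" "int (k + 1)" for i k] by (simp add: add_ac)
      also have "\<dots> = (\<integral>e. quad_form M A (\<lambda>a. X (int (j * M) + 1 + int a) e) \<partial>P)"
      proof -
        have "quad_form M A (\<lambda>a. X (int (j * M) + 1 + int a) e)
          = (\<Sum>i<M. \<Sum>k<M. A i k * (X (int (j * M) + 1 + int i) e * X (int (j * M) + 1 + int k) e))" for e
          unfolding quad_form_def by (intro sum.cong refl) (simp only: mult_ac)
        then show ?thesis using X_mult_int by (simp add: Bochner_Integration.integral_sum)
      qed
      finally show ?thesis using trace_approx[OF ap \<eta>(1) A K, of "int (j * M) + 1"] by (simp only:)
    qed
    have conc: "var (\<lambda>e. quad_form M A (W.yv UNIV s e)) \<le> (\<kappa> * real M)\<^sup>2" if A: "op_bound M K A" for A s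
    proof -
      have "W.yv UNIV s e = (\<lambda>i. w (shift (s + int i) e))" for e by (simp add: W.yv_def fun_eq_iff)
      then show ?thesis using N1 M(2) A by (simp add: power_mult_distrib)
    qed
    have gap: "4 * K\<^sup>2 * T^4 * real (2 * m + q) * real M \<le> (\<kappa> * real M)\<^sup>2"
    proof -
      have "E / \<kappa>\<^sup>2 \<le> real M" using N3 M(4) by linarith
      then have "E \<le> real M * \<kappa>\<^sup>2" using \<kappa> by (simp add: pos_divide_le_eq)
      then have "E * real M \<le> real M * \<kappa>\<^sup>2 * real M" by (rule mult_right_mono) simp
      then show ?thesis unfolding E_def[symmetric] by (simp add: power2_eq_square mult_ac)
    qed
    define d where "d = swap_const z / real n * (4 * (4 * \<kappa> + K * err \<eta> + 2 * K * T\<^sup>2 * b q))"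
    have step: "cmod ((\<integral>s. \<integral>e. stieltjes (cmat M (gram n ((W.cols M (Suc j) e x)(j := head_col s)))) z \<partial>P \<partial>Q)
       - (\<integral>e. stieltjes (cmat M (gram n (W.cols M (Suc j) e x))) z \<partial>P)) \<le> d" if j: "j < n" for j x
      unfolding d_def by (rule W.hybrid_step[OF Q sQ z M(1) j K_def Zint Zdev tr q(1) conc \<kappa> gap])
    have h: "cmod ((\<integral>w. stieltjes (cmat M (gram n (\<lambda>i. head_col (w i)))) z \<partial>PiM {0..<n} (\<lambda>_. Q))
       - (\<integral>e. stieltjes (cmat M (gram n (\<lambda>i. W.yv {..<M} (int (i * M) + 1) e))) z \<partial>P)) \<le> real n * d"
      by (rule W.hybrid_total[OF Q sQ z M(1) step])
    have x: "cmod ((\<integral>e. stieltjes (cmat M (gram n (\<lambda>j a. X (int (j * M + a + 1)) e))) z \<partial>P)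
       - (\<integral>e. stieltjes (cmat M (gram n (\<lambda>i. W.yv {..<M} (int (i * M) + 1) e))) z \<partial>P)) \<le> c * (K * err \<eta>)"
      unfolding c_def K_def by (rule X_columns_approx[OF ap \<eta>(1) z M(1) n])
    have "real n * d = c * (4 * \<kappa> + K * err \<eta> + 2 * K * T\<^sup>2 * b q)" using n by (simp add: d_def c_def)
    also have "\<dots> \<le> c * (4 * \<kappa> + K * err \<eta> + \<kappa>)" using q(2) c by (intro mult_left_mono) auto
    also have "\<dots> = c * (5 * \<kappa>) + c * (K * err \<eta>)" by (simp add: algebra_simps)
    finally have nd: "real n * d \<le> c * (5 * \<kappa>) + c * (K * err \<eta>)" .
    have tri: "cmod (a - b) \<le> cmod (a - y) + cmod (b - y)" for a b y :: complex
      using norm_triangle_ineq4[of "a - y" "b - y"] by simp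
    from tri[of "\<integral>e. stieltjes (cmat M (gram n (\<lambda>j a. X (int (j * M + a + 1)) e))) z \<partial>P"
        "\<integral>w. stieltjes (cmat M (gram n (\<lambda>i. head_col (w i)))) z \<partial>PiM {0..<n} (\<lambda>_. Q)"
        "\<integral>e. stieltjes (cmat M (gram n (\<lambda>i. W.yv {..<M} (int (i * M) + 1) e))) z \<partial>P"]
    show ?thesis using h x nd err1 \<kappa>1 r by linarith
  qed
  have "eventually (\<lambda>n. N n \<ge> max N1 (max N2 N3)) sequentially"
    by (rule N_lim[unfolded filterlim_at_top, rule_format])
  moreover have "eventually (\<lambda>n. n > 0) sequentially" by (rule eventually_gt_at_top)
  ultimately show "\<forall>\<^sub>F n in sequentially. dist (cmod ((\<integral>e. stieltjes (cmat (N n) (gram n (\<lambda>j a. X (int (j * N n + a + 1)) e))) z \<partial>P)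
     - (\<integral>w. stieltjes (cmat (N n) (gram n (\<lambda>i. head_col (w i)))) z \<partial>PiM {0..<n} (\<lambda>_. Q)))) 0 < r"
  proof eventually_elim
    case (elim n)
    then show ?case using key[OF N_pos[of n], of n] by simp
  qed
qed

end

text \<open>Used with \<open>Some\<close>, to extract the independence of the Gaussian copies from a
  family over \<open>nat option\<close> in which \<open>None\<close> stands for
  \<open>X\<close>.\<close>

lemma (in prob_space) indep_vars_reindex_inj:
  assumes ind: "indep_vars (\<lambda>_. S) X UNIV" and inj: "inj f"
  shows "indep_vars (\<lambda>_. S) (\<lambda>i. X (f i)) I"
  unfolding indep_vars_def2 indep_sets_def
proof (intro conjI ballI allI impI)
  have rv: "X i \<in> measurable M S" for i using ind by (simp add: indep_vars_def2)
  show "random_variable S (X (f i))" for i by (rule rv)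
  show "{X (f i) -` A \<inter> space M |A. A \<in> sets S} \<subseteq> events" for i using rv by (auto intro: measurable_sets)
  fix J A assume J: "J \<subseteq> I" "J \<noteq> {}" "finite J" and A: "A \<in> (\<Pi> i\<in>J. {X (f i) -` A \<inter> space M |A. A \<in> sets S})"
  define A' where "A' y = A (the_inv_into UNIV f y)" for y
  have A'f: "A' (f i) = A i" for i by (simp add: A'_def the_inv_into_f_f[OF inj])
  have "\<forall>y\<in>f ` J. A' y \<in> {X y -` A \<inter> space M |A. A \<in> sets S}"
    using A by (simp add: A'f Pi_iff)
  moreover have "indep_sets (\<lambda>i. {X i -` A \<inter> space M |A. A \<in> sets S}) UNIV" using ind by (simp add: indep_vars_def2)
  ultimately have "prob (\<Inter>y\<in>f ` J. A' y) = (\<Prod>y\<in>f ` J. prob (A' y))"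
    using J by (intro indep_setsD[of "\<lambda>i. {X i -` A \<inter> space M |A. A \<in> sets S}" UNIV]) auto
  then show "prob (\<Inter>j\<in>J. A j) = (\<Prod>j\<in>J. prob (A j))"
    using inj_on_subset[OF inj subset_UNIV, of J] by (simp add: A'f prod.reindex)
qed

lemma B_mat_gram: "B_mat X N n \<omega> = cmat N (gram n (\<lambda>j a. X (int (j * N + a + 1)) \<omega>))"
  by (simp add: B_mat_def cmat_def gram_def)

lemma G_mat_gram: "G_mat Zc N n \<omega> = cmat N (gram n (\<lambda>i. head_col (\<lambda>k. Zc i k \<omega>)))"
  by (simp add: G_mat_def cmat_def gram_def head_col_def)

text \<open>Both expectations are rewritten on canonical spaces, over the law \<open>P\<close> of
  the sequence \<open>eps\<close> and over the \<open>n\<close>-fold product of the law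
  \<open>Q\<close> of \<open>Z\<close>, where \<open>stieltjes_difference_tendsto\<close>
  applies.\<close>

theorem theorem2p2:
  fixes M :: "'a measure"
    and eps :: "int \<Rightarrow> 'a \<Rightarrow> real"
    and g :: "(int \<Rightarrow> real) \<Rightarrow> real"
    and X :: "int \<Rightarrow> 'a \<Rightarrow> real"
    and Z :: "int \<Rightarrow> 'a \<Rightarrow> real"
    and Zc :: "nat \<Rightarrow> int \<Rightarrow> 'a \<Rightarrow> real"
    and N :: "nat \<Rightarrow> nat"
    and c :: real
    and z :: complex
  assumes "prob_space M"
    and eps_rv: "\<And>i. eps i \<in> borel_measurable M"
    and stat: "strictly_stationary M eps"
    and g_meas: "g \<in> borel_measurable (PiM UNIV (\<lambda>_::int. borel))"
    and X_def: "\<And>k \<omega>. X k \<omega> = g (\<lambda>i. eps (k + i) \<omega>)"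
    and X_int: "\<And>k. integrable M (X k)"
    and X_mean: "\<And>k. (\<integral>\<omega>. X k \<omega> \<partial>M) = 0"
    and X_sq: "\<And>k. integrable M (\<lambda>\<omega>. (X k \<omega>)\<^sup>2)"
    and Z_gauss: "centered_gaussian_process M Z"
    and Z_sq: "\<And>k. integrable M (\<lambda>\<omega>. (Z k \<omega>)\<^sup>2)"
    and Z_cov: "\<And>k l. covariance M (Z k) (Z l) = covariance M (X k) (X l)"
    and Zc_copy: "\<And>i. distr M (PiM UNIV (\<lambda>_::int. borel)) (\<lambda>\<omega> k. Zc i k \<omega>)
                      = distr M (PiM UNIV (\<lambda>_::int. borel)) (\<lambda>\<omega> k. Z k \<omega>)"
    and indep: "prob_space.indep_vars M (\<lambda>_. PiM UNIV (\<lambda>_::int. borel))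
                  (\<lambda>idx \<omega>. case idx of None \<Rightarrow> (\<lambda>k. X k \<omega>) | Some i \<Rightarrow> (\<lambda>k. Zc i k \<omega>)) UNIV"
    and N_pos: "\<And>n. N n > 0"
    and ratio: "(\<lambda>n. real (N n) / real n) \<longlonglongrightarrow> c"
    and c_pos: "c > 0"
    and beta_lim: "beta_mixing M eps \<longlonglongrightarrow> 0"
    and z_upper: "Im z > 0"
  shows "(\<lambda>n. cmod ((\<integral>\<omega>. stieltjes (B_mat X (N n) n \<omega>) z \<partial>M)
                    - (\<integral>\<omega>. stieltjes (G_mat Zc (N n) n \<omega>) z \<partial>M))) \<longlonglongrightarrow> 0"
proof -
  interpret prob_space M by fact
  note [measurable] = eps_rv
  define E where "E \<omega> = (\<lambda>i. eps i \<omega>)" for \<omega>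
  have E_meas [measurable]: "E \<in> measurable M seqs" unfolding E_def[abs_def] by (rule measurable_abs_UNIV) (rule eps_rv)
  define P where "P = distr M seqs E"
  define b where "b q = 4 * \<bar>beta_mixing M eps q\<bar>" for q
  have ml: "mixing_law P b"
    using mixing_law_distr[OF eps_rv beta_lim] unfolding P_def b_def[abs_def] E_def[abs_def] .
  interpret MX: mixing_law P b by (rule ml)
  have XE: "X k \<omega> = g (shift k (E \<omega>))" for k \<omega>
    by (simp add: X_def shift_def E_def add.commute)
  have X0: "g (E \<omega>) = X 0 \<omega>" for \<omega> by (simp add: XE shift_def)
  interpret SP: stationary_process P b g
  proof unfold_locales
    show "distr P seqs (shift h) = P" for h
    proof -
      have "distr P seqs (shift h) = distr M seqs (shift h \<circ> E)"
        unfolding P_def by (rule distr_distr) measurable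
      also have "shift h \<circ> E = (\<lambda>\<omega> i. eps (i + h) \<omega>)" by (simp add: fun_eq_iff shift_def E_def)
      also have "distr M seqs \<dots> = P" using stat by (simp add: strictly_stationary_def P_def E_def[abs_def])
      finally show ?thesis .
    qed
    show gm: "g \<in> borel_measurable seqs" by (rule g_meas)
    show "integrable P g" unfolding P_def using integrable_distr_eq[OF E_meas gm] X_int[of 0] by (simp add: X0)
    show "(\<integral>e. g e \<partial>P) = 0" unfolding P_def using integral_distr[OF E_meas gm] X_mean[of 0] by (simp add: X0)
    show "integrable P (\<lambda>e. (g e)\<^sup>2)"
      unfolding P_def using integrable_distr_eq[OF E_meas, of "\<lambda>e. (g e)\<^sup>2"] X_sq[of 0] gm by (simp add: X0)
  qed
  have XX: "SP.X k (E \<omega>) = X k \<omega>" for k \<omega> by (simp add: SP.X_def XE)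
  have Zm [measurable]: "Z k \<in> borel_measurable M" for k by (rule centered_gaussian_measurable[OF Z_gauss])
  define Zp where "Zp \<omega> = (\<lambda>k. Z k \<omega>)" for \<omega>
  have Zp_meas [measurable]: "Zp \<in> measurable M seqs" unfolding Zp_def[abs_def] by (rule measurable_abs_UNIV) (rule Zm)
  define Q where "Q = distr M seqs Zp"
  have Q: "prob_space Q" unfolding Q_def by (rule prob_space_distr) measurable
  have sQ: "sets Q = sets seqs" by (simp add: Q_def)
  have Z0: "(\<integral>\<omega>. Z k \<omega> \<partial>M) = 0" for k using Z_gauss by (simp add: centered_gaussian_process_def)
  have Q2: "integrable Q (\<lambda>s. s i * s k)" and QI2: "(\<integral>s. s i * s k \<partial>Q) = (\<integral>\<omega>. Z i \<omega> * Z k \<omega> \<partial>M)" for i k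
  proof -
    have "integrable M (\<lambda>\<omega>. Z i \<omega> * Z k \<omega>)" by (rule square_integrable_mult[OF Zm Zm Z_sq Z_sq])
    then show "integrable Q (\<lambda>s. s i * s k)"
      unfolding Q_def by (subst integrable_distr_eq[OF Zp_meas]) (simp_all add: Zp_def)
    show "(\<integral>s. s i * s k \<partial>Q) = (\<integral>\<omega>. Z i \<omega> * Z k \<omega> \<partial>M)"
      unfolding Q_def by (subst integral_distr[OF Zp_meas]) (simp_all add: Zp_def)
  qed
  note iss = isserlis[OF Z_gauss Z_sq]
  have Q4: "integrable Q (\<lambda>s. s i * s j * s k * s l)" for i j k l
    unfolding Q_def using iss(1)[of i j k l] by (subst integrable_distr_eq[OF Zp_meas]) (simp_all add: Zp_def)
  have QE: "(\<integral>s. s i * s j * s k * s l \<partial>Q) = (\<integral>s. s i * s j \<partial>Q) * (\<integral>s. s k * s l \<partial>Q)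
      + (\<integral>s. s i * s k \<partial>Q) * (\<integral>s. s j * s l \<partial>Q) + (\<integral>s. s i * s l \<partial>Q) * (\<integral>s. s j * s k \<partial>Q)" for i j k l
  proof -
    have "(\<integral>s. s i * s j * s k * s l \<partial>Q) = (\<integral>\<omega>. Z i \<omega> * Z j \<omega> * Z k \<omega> * Z l \<omega> \<partial>M)"
      unfolding Q_def by (subst integral_distr[OF Zp_meas]) (simp_all add: Zp_def)
    then show ?thesis unfolding QI2 iss(2) .
  qed
  \<comment> \<open>Both processes are centered, so their covariances are expectations of
    products.\<close>
  have QX: "(\<integral>s. s i * s k \<partial>Q) = (\<integral>e. SP.X i e * SP.X k e \<partial>P)" for i k
  proof -
    have "(\<integral>s. s i * s k \<partial>Q) = covariance M (Z i) (Z k)" unfolding QI2 covariance_def by (simp add: Z0)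
    also have "\<dots> = (\<integral>\<omega>. X i \<omega> * X k \<omega> \<partial>M)" unfolding Z_cov by (simp add: covariance_def X_mean)
    also have "\<dots> = (\<integral>e. SP.X i e * SP.X k e \<partial>P)"
      unfolding P_def by (subst integral_distr[OF E_meas]) (simp_all add: XX)
    finally show ?thesis .
  qed
  \<comment> \<open>The positive limit of the ratio makes the dimension grow, as the concentration
    estimates require.\<close>
  have N_lim: "filterlim N at_top sequentially"
  proof -
    have "filterlim (\<lambda>n. real (N n) / real n * real n) at_top sequentially"
      by (rule filterlim_tendsto_pos_mult_at_top[OF ratio c_pos filterlim_real_sequentially])
    moreover have "\<forall>\<^sub>F n in sequentially. real (N n) / real n * real n = real (N n)"
      using eventually_gt_at_top[of 0] by eventually_elim simp
    ultimately have "filterlim (\<lambda>n. real (N n)) at_top sequentially" by (simp add: filterlim_cong[OF refl refl])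
    then show ?thesis by (simp add: filterlim_sequentially_iff_filterlim_real)
  qed
  have Zc_ind: "indep_vars (\<lambda>_. seqs) (\<lambda>i \<omega> k. Zc i k \<omega>) {0..<n}" for n
    using indep_vars_reindex_inj[OF indep, of Some "{0..<n}"] by simp
  have Zc_meas: "(\<lambda>\<omega> k. Zc i k \<omega>) \<in> measurable M seqs" for i
    using Zc_ind[of "Suc i"] by (simp add: indep_vars_def2)
  have Zc_law: "distr M seqs (\<lambda>\<omega> k. Zc i k \<omega>) = Q" for i
    using Zc_copy[of i] by (simp add: Q_def Zp_def[abs_def])
  have Bint: "(\<integral>\<omega>. stieltjes (B_mat X (N n) n \<omega>) z \<partial>M)
      = (\<integral>e. stieltjes (cmat (N n) (gram n (\<lambda>j a. SP.X (int (j * N n + a + 1)) e))) z \<partial>P)" for n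
  proof -
    have "(\<lambda>e. stieltjes (cmat (N n) (gram n (\<lambda>j a. SP.X (int (j * N n + a + 1)) e))) z) \<in> borel_measurable seqs"
      by (rule measurable_stieltjes_gram[OF z_upper]) (rule SP.X_meas)
    from integral_distr[OF E_meas this] show ?thesis unfolding P_def B_mat_gram XX by simp
  qed
  \<comment> \<open>The characterisation of independence by product laws asks for a nonempty index
    set, hence \<open>n > 0\<close>; the limit is not affected.\<close>
  have Gint: "(\<integral>\<omega>. stieltjes (G_mat Zc (N n) n \<omega>) z \<partial>M)
      = (\<integral>w. stieltjes (cmat (N n) (gram n (\<lambda>i. head_col (w i)))) z \<partial>PiM {0..<n} (\<lambda>_. Q))" if n: "n > 0" for n
  proof -
    let ?V = "\<lambda>\<omega>. \<lambda>i\<in>{0..<n}. \<lambda>k. Zc i k \<omega>"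
    let ?S = "\<lambda>w. stieltjes (cmat (N n) (gram n (\<lambda>i. head_col (w i)))) z"
    have V: "?V \<in> measurable M (PiM {0..<n} (\<lambda>_. seqs))" by (rule measurable_restrict) (rule Zc_meas)
    have Sm: "?S \<in> borel_measurable (PiM {0..<n} (\<lambda>_. seqs))"
    proof (rule measurable_stieltjes_gram[OF z_upper])
      show "(\<lambda>w. head_col (w l) a) \<in> borel_measurable (PiM {0..<n} (\<lambda>_. seqs))" if "l < n" for l a
      proof -
        have "(\<lambda>w. w l) \<in> measurable (PiM {0..<n} (\<lambda>_. seqs)) seqs"
          by (rule measurable_component_singleton) (use that in simp)
        from measurable_compose[OF this measurable_head_col] show ?thesis .
      qed
    qed
    have "distr M (PiM {0..<n} (\<lambda>_. seqs)) ?V = PiM {0..<n} (\<lambda>i. distr M seqs (\<lambda>\<omega> k. Zc i k \<omega>))"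
      using indep_vars_iff_distr_eq_PiM[where I="{0..<n}" and M'="\<lambda>_. seqs" and X="\<lambda>i \<omega> k. Zc i k \<omega>"] n Zc_meas Zc_ind by simp
    then have dV: "distr M (PiM {0..<n} (\<lambda>_. seqs)) ?V = PiM {0..<n} (\<lambda>_. Q)" unfolding Zc_law .
    have "(\<integral>w. ?S w \<partial>PiM {0..<n} (\<lambda>_. Q)) = (\<integral>\<omega>. ?S (?V \<omega>) \<partial>M)"
      unfolding dV[symmetric] by (rule integral_distr[OF V Sm])
    moreover have "?S (?V \<omega>) = stieltjes (G_mat Zc (N n) n \<omega>) z" for \<omega>
      unfolding G_mat_gram
      by (subst gram_cong[of n "\<lambda>i. head_col (?V \<omega> i)" "\<lambda>i. head_col (\<lambda>k. Zc i k \<omega>)"]) simp_all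
    ultimately show ?thesis by simp
  qed
  from SP.stieltjes_difference_tendsto[OF Q sQ Q4 Q2 QX QE z_upper N_pos N_lim]
  show ?thesis
  proof (rule Lim_transform_eventually)
    show "\<forall>\<^sub>F n in sequentially. cmod ((\<integral>e. stieltjes (cmat (N n) (gram n (\<lambda>j a. SP.X (int (j * N n + a + 1)) e))) z \<partial>P)
     - (\<integral>w. stieltjes (cmat (N n) (gram n (\<lambda>i. head_col (w i)))) z \<partial>PiM {0..<n} (\<lambda>_. Q)))
      = cmod ((\<integral>\<omega>. stieltjes (B_mat X (N n) n \<omega>) z \<partial>M) - (\<integral>\<omega>. stieltjes (G_mat Zc (N n) n \<omega>) z \<partial>M))"
      using eventually_gt_at_top[of 0] by eventually_elim (simp only: Bint Gint)
  qed
qed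

end
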